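(* Let $T\in\mathcal{K}(V)$ be bisectorial of angle $\omega\in(0,\frac{\pi}{2})$, let $\theta\in(\omega,\frac{\pi}{2})$, $g\in\mathcal{N}^0(D_\theta)$ and $f\in\mathcal{SH}_L^0(D_\theta)$. Then $gf\in\mathcal{SH}_L^0(D_\theta)$ and the product rule $$(gf)(T)=g(T)f(T)$$ holds, where all three operators are given by the $\omega$-functional calculus.
   Context: Clifford setting. Fix an integer $n\geq 1$. $\mathbb{R}_n$ is the real Clifford algebra generated by $e_1,\dots,e_n$ with $e_i^2=-1$, $e_ie_j=-e_je_i$ ($i\neq j$), with basis $e_A=e_{i_1}\cdots e_{i_r}$ for $A=(i_1<\dots<i_r)$, $e_\emptyset=1$, and $|s|^2=\sum_As_A^2$ for $s=\sum_As_Ae_A$. Paravectors: $\mathbb{R}^{n+1}=\{s_0+s_1e_1+\dots+s_ne_n\}\subseteq\mathbb{R}_n$ with $\overline{s}=s_0-s_1e_1-\dots-s_ne_n$. $\mathbb{S}=\{s\in\mathbb{R}^{n+1}: s_0=0,|s|=1\}$ and $\mathbb{C}_J=\{x+Jy: x,y\in\mathbb{R}\}$ for $J\in\mathbb{S}$. $U\subseteq\mathbb{R}^{n+1}$ is axially symmetric if $x+Jy\in U$ ($x,y\in\mathbb{R}$, $J\in\mathbb{S}$) implies $x+Iy\in U$ for all $I\in\mathbb{S}$. Slice hyperholomorphic functions. For $U$ open and axially symmetric, $f:U\to\mathbb{R}_n$ is left slice hyperholomorphic ($f\in\mathcal{SH}_L(U)$) if there are continuously differentiable $f_0,f_1:\{(x,y)\in\mathbb{R}^2: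 x+\mathbb{S}y\subseteq U\}\to\mathbb{R}_n$ with $f(x+Jy)=f_0(x,y)+Jf_1(x,y)$ for all $J\in\mathbb{S}$, $f_0(x,-y)=f_0(x,y)$, $f_1(x,-y)=-f_1(x,y)$, $\partial_xf_0=\partial_yf_1$, $\partial_yf_0=-\partial_xf_1$. If $f_0,f_1$ are real valued, $f$ is called intrinsic ($f\in\mathcal{N}(U)$). Operators. $V_\mathbb{R}$ is a real Banach space, $V=\{\sum_Av_A\otimes e_A: v_A\in V_\mathbb{R}\}$ the corresponding Clifford module with norm $\|v\|^2=\sum_A\|v_A\|^2$ and the natural left and right multiplications by $\mathbb{R}_n$. $\mathcal{B}(V)$: bounded everywhere defined right-linear operators; $\mathcal{K}(V)$: closed right-linear operators $T:\operatorname{dom}(T)\to V$ with right-linear domain $\operatorname{dom}(T)\subseteq V$. A Clifford number $a$ is identified with the operator $v\mapsto av$, so $(aT)v=a(Tv)$, $(Ta)v=T(av)$. For $s\in\mathbb{R}^{n+1}$, $Q_s[T]=T^2-2s_0T+|s|^2$ on $\operatorname{dom}(T^2)$; $\rho_S(T)=\{s\in\mathbb{R}^{n+1}: Q_s[T]^{-1}\in\mathcal{B}(V)\}$, $\sigma_S(T)=\mathbb{R}^{n+1}\setminus\rho_S(T)$, and $S_L^{-1}(s,T)=Q_s[T]^{-1}\overline{s}-TQ_s[T]^{-1}$ for $s\in\rho_S(T)$. Bisectorial operators. For $\omega\in(0,\frac{\pi}{2})$, $I_\omega=(-\omega,\omega)\cup(\pi-\omega,\pi+\omega)$ and $D_\omega=\{re^{J\phi}: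 r>0,\,J\in\mathbb{S},\,\phi\in I_\omega\}\subseteq\mathbb{R}^{n+1}$. $T\in\mathcal{K}(V)$ is bisectorial of angle $\omega$ if $\sigma_S(T)\subseteq\overline{D_\omega}$ and for every $\varphi\in(\omega,\frac{\pi}{2})$ there is $C_\varphi\geq 0$ with $\|S_L^{-1}(s,T)\|\leq\frac{C_\varphi}{|s|}$ for all $s\in\mathbb{R}^{n+1}\setminus(D_\varphi\cup\{0\})$. $\omega$-functional calculus. $\mathcal{SH}_L^0(D_\theta)$ is the set of bounded $f\in\mathcal{SH}_L(D_\theta)$ with $\int_0^\infty|f(te^{J\phi})|\frac{dt}{t}<\infty$ for all $J\in\mathbb{S}$, $\phi\in I_\theta$; $\mathcal{N}^0(D_\theta)$ is the set of intrinsic such functions. For $T$ bisectorial of angle $\omega$, $\theta\in(\omega,\frac{\pi}{2})$ and $f\in\mathcal{SH}_L^0(D_\theta)$, $$f(T)=\frac{1}{2\pi}\int_{\partial D_\varphi\cap\mathbb{C}_J}S_L^{-1}(s,T)ds_Jf(s):=\frac{1}{2\pi}\sum_\pm\int_\mathbb{R}S_L^{-1}(\gamma_\pm(t),T)\frac{\gamma_\pm'(t)}{J}f(\gamma_\pm(t))dt\in\mathcal{B}(V),$$ with $\gamma_\pm(t)=\pm|t|e^{-\operatorname{sgn}(t)J\varphi}$; it does not depend on the choice of $\varphi\in(\omega,\theta)$ and $J\in\mathbb{S}$. *)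

theory Defs
  imports "HOL-Analysis.Analysis"
begin

section \<open>The Clifford algebra and Clifford modules\<close>

text \<open>
  The generators are indexed by a finite linearly ordered type \<open>'n\<close>, so that n is the
  cardinality of \<open>'n\<close> (hence n is at least 1), and the basis elements are indexed by the
  subsets of \<open>'n\<close>. The Euclidean norm of the library vector type is exactly the norm
  required on the algebra and on the module.

  Pitfall: the library also puts a componentwise product and a unit with all components
  equal to 1 on this type. They are not the Clifford product and unit and are never used.
\<close>

type_synonym 'n clifford = "(real, 'n set) vec"
type_synonym ('v, 'n) cmodule = "('v, 'n set) vec"

definition basis_elt :: "'n set \<Rightarrow> 'n::finite clifford" where
  "basis_elt A = axis A 1"

definition creal :: "real \<Rightarrow> 'n::finite clifford" where
  "creal x = x *\<^sub>R basis_elt {}"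

text \<open>
  The sign in \<open>e_A e_B = \<plusminus> e_(A \<triangle> B)\<close>: reordering produces a factor -1 for
  every pair a in A, b in B with b < a, and the relation \<open>e_a e_a = -1\<close> one for every
  common index.
\<close>

definition csign :: "'n set \<Rightarrow> 'n::{finite,linorder} set \<Rightarrow> real" where
  "csign A B = (\<Prod>a\<in>A. \<Prod>b\<in>B. if b \<le> a then - 1 else 1)"

definition cmult :: "'n clifford \<Rightarrow> 'n clifford \<Rightarrow> 'n::{finite,linorder} clifford"
    (infixl \<open>\<odot>\<close> 70) where
  "s \<odot> t = (\<Sum>A\<in>UNIV. \<Sum>B\<in>UNIV. (csign A B * (s $ A * t $ B)) *\<^sub>R basis_elt (sym_diff A B))"

text \<open>The two module structures: a basis element multiplies the Clifford factor of
  \<open>v_B \<otimes> e_B\<close> from the left, respectively from the right.\<close>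

definition lmult :: "'n clifford \<Rightarrow> ('v::real_vector, 'n) cmodule
    \<Rightarrow> ('v, 'n::{finite,linorder}) cmodule" where
  "lmult a v = (\<Sum>A\<in>UNIV. \<Sum>B\<in>UNIV. axis (sym_diff A B) ((csign A B * a $ A) *\<^sub>R v $ B))"

definition rmult :: "('v::real_vector, 'n) cmodule \<Rightarrow> 'n clifford
    \<Rightarrow> ('v, 'n::{finite,linorder}) cmodule" where
  "rmult v a = (\<Sum>B\<in>UNIV. \<Sum>A\<in>UNIV. axis (sym_diff B A) ((csign B A * a $ A) *\<^sub>R v $ B))"

lemma prod_sym_diff:
  fixes h :: "'a::finite \<Rightarrow> real"
  assumes "\<And>a. h a * h a = 1"
  shows "prod h (sym_diff A B) = prod h A * prod h B"
proof -
  have I: "prod h (A \<inter> B) * prod h (A \<inter> B) = 1"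
    by (simp add: prod.distrib [symmetric] assms)
  have A: "prod h A = prod h (A - B) * prod h (A \<inter> B)"
    by (subst prod.union_disjoint [symmetric]) (auto simp: Un_Diff_Int)
  have B: "prod h B = prod h (B - A) * prod h (A \<inter> B)"
    by (subst prod.union_disjoint [symmetric]) (auto intro: prod.cong)
  have "prod h (sym_diff A B) = prod h (A - B) * prod h (B - A)"
    by (rule prod.union_disjoint) auto
  also have "\<dots> = prod h (A - B) * prod h (B - A) * (prod h (A \<inter> B) * prod h (A \<inter> B))"
    by (simp add: I)
  also have "\<dots> = prod h A * prod h B"
    by (simp add: A B mult_ac)
  finally show ?thesis .
qed

lemma csign_square: "csign A B * csign A B = 1"
  unfolding csign_def prod.distrib [symmetric] by (intro prod.neutral ballI) simp

lemma csign_sym_diff_left: "csign (sym_diff A B) C = csign A C * csign B C"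
  unfolding csign_def
  by (rule prod_sym_diff) (simp add: prod.distrib [symmetric] if_distrib cong: if_cong)

lemma csign_sym_diff_right: "csign A (sym_diff B C) = csign A B * csign A C"
proof -
  have "(\<Prod>b\<in>sym_diff B C. if b \<le> a then - 1 else 1 :: real) =
      (\<Prod>b\<in>B. if b \<le> a then - 1 else 1) * (\<Prod>b\<in>C. if b \<le> a then - 1 else 1)" for a
    by (rule prod_sym_diff) simp
  then show ?thesis
    unfolding csign_def by (simp add: prod.distrib)
qed

lemma basis_elt_mult: "basis_elt A \<odot> basis_elt B = csign A B *\<^sub>R basis_elt (sym_diff A B)"
proof -
  have nth: "basis_elt X $ Y = (if Y = X then 1 else 0)" for X Y :: "'a set"
    by (simp add: basis_elt_def axis_def)
  have "(csign C D * (basis_elt A $ C * basis_elt B $ D)) *\<^sub>R basis_elt (sym_diff C D)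
      = (if D = B then if C = A then csign A B *\<^sub>R basis_elt (sym_diff A B) else 0 else 0)" for C D
    unfolding nth by simp
  then show ?thesis by (simp add: cmult_def)
qed

lemma basis_elt_mult_assoc:
  "(basis_elt A \<odot> basis_elt B) \<odot> basis_elt C = basis_elt A \<odot> (basis_elt B \<odot> basis_elt C)"
proof -
  have scale: "(r *\<^sub>R s) \<odot> t = r *\<^sub>R (s \<odot> t)" "s \<odot> (r *\<^sub>R t) = r *\<^sub>R (s \<odot> t)"
    for r and s t :: "'a clifford"
    by (simp_all add: cmult_def scaleR_sum_right mult_ac)
  have "sym_diff (sym_diff A B) C = sym_diff A (sym_diff B C)" by blast
  then show ?thesis
    by (simp add: basis_elt_mult scale csign_sym_diff_left csign_sym_diff_right mult_ac
        del: Diff_Un Un_Diff)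
qed

lemma basis_elt_empty_mult:
  "basis_elt {} \<odot> basis_elt A = basis_elt A" "basis_elt A \<odot> basis_elt {} = basis_elt A"
  by (simp_all add: basis_elt_mult csign_def)

lemma generator_square: "basis_elt {i} \<odot> basis_elt {i} = - basis_elt {}"
  by (simp add: basis_elt_mult csign_def)

lemma generators_anticommute:
  "i \<noteq> j \<Longrightarrow> basis_elt {i} \<odot> basis_elt {j} = - (basis_elt {j} \<odot> basis_elt {i})"
  by (auto simp: basis_elt_mult csign_def insert_Diff_if insert_commute)

lemma basis_elt_insert:
  assumes "\<And>a. a \<in> A \<Longrightarrow> i < a"
  shows "basis_elt (insert i A) = basis_elt {i} \<odot> basis_elt A"
proof -
  have "csign {i} A = 1"
    unfolding csign_def using assms by (auto simp: not_le intro!: prod.neutral)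
  moreover have "sym_diff {i} A = insert i A" using assms by auto
  ultimately show ?thesis by (simp add: basis_elt_mult)
qed

lemma lmult_real: "lmult a b = a \<odot> b" and rmult_real: "rmult a b = a \<odot> b"
  by (simp_all add: lmult_def rmult_def cmult_def basis_elt_def vec_eq_iff axis_def
      if_distrib mult_ac cong: if_cong)


section \<open>Paravectors, axial symmetry and slice hyperholomorphic functions\<close>

definition paravectors :: "'n::finite clifford set" where
  "paravectors = {s. \<forall>A. s $ A \<noteq> 0 \<longrightarrow> card A \<le> 1}"

text \<open>Only used for paravectors; on the whole algebra this is not Clifford conjugation.\<close>

definition pconj :: "'n::finite clifford \<Rightarrow> 'n clifford" where
  "pconj s = (\<chi> A. if A = {} then s $ A else - s $ A)"

definition imag_sphere :: "'n::finite clifford set" where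
  "imag_sphere = {s \<in> paravectors. s $ {} = 0 \<and> norm s = 1}"

definition slice_point :: "'n clifford \<Rightarrow> real \<Rightarrow> real \<Rightarrow> 'n::finite clifford" where
  "slice_point J x y = creal x + y *\<^sub>R J"

definition axially_symmetric :: "'n::finite clifford set \<Rightarrow> bool" where
  "axially_symmetric U \<longleftrightarrow>
     (\<forall>x y. \<forall>J\<in>imag_sphere. slice_point J x y \<in> U \<longrightarrow> (\<forall>I\<in>imag_sphere. slice_point I x y \<in> U))"

definition slice_domain :: "'n::finite clifford set \<Rightarrow> (real \<times> real) set" where
  "slice_domain U = {(x, y). \<forall>J\<in>imag_sphere. slice_point J x y \<in> U}"

definition C1_on :: "(real \<times> real) set \<Rightarrow> (real \<times> real \<Rightarrow> 'b::real_normed_vector) \<Rightarrow> bool" where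
  "C1_on \<Omega> h \<longleftrightarrow>
     (\<exists>h'. (\<forall>p\<in>\<Omega>. (h has_derivative blinfun_apply (h' p)) (at p)) \<and> continuous_on \<Omega> h')"

definition partial_x :: "(real \<times> real \<Rightarrow> 'b::real_normed_vector) \<Rightarrow> real \<times> real \<Rightarrow> 'b" where
  "partial_x h p = vector_derivative (\<lambda>x. h (x, snd p)) (at (fst p))"

definition partial_y :: "(real \<times> real \<Rightarrow> 'b::real_normed_vector) \<Rightarrow> real \<times> real \<Rightarrow> 'b" where
  "partial_y h p = vector_derivative (\<lambda>y. h (fst p, y)) (at (snd p))"

definition slice_components :: "'n clifford set \<Rightarrow> ('n clifford \<Rightarrow> 'n clifford)
    \<Rightarrow> (real \<times> real \<Rightarrow> 'n clifford) \<Rightarrow> (real \<times> real \<Rightarrow> 'n::{finite,linorder} clifford) \<Rightarrow> bool"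
  where
  "slice_components U f f0 f1 \<longleftrightarrow>
     C1_on (slice_domain U) f0 \<and> C1_on (slice_domain U) f1 \<and>
     (\<forall>(x, y)\<in>slice_domain U.
        (\<forall>J\<in>imag_sphere. f (slice_point J x y) = f0 (x, y) + J \<odot> f1 (x, y)) \<and>
        f0 (x, - y) = f0 (x, y) \<and> f1 (x, - y) = - f1 (x, y) \<and>
        partial_x f0 (x, y) = partial_y f1 (x, y) \<and>
        partial_y f0 (x, y) = - partial_x f1 (x, y))"

text \<open>Functions on \<open>U\<close> are represented by total functions; membership in the classes below
  depends only on their values on \<open>U\<close>.\<close>

definition SH_L :: "'n clifford set \<Rightarrow> ('n clifford \<Rightarrow> 'n::{finite,linorder} clifford) set" where
  "SH_L U = {f. openin (top_of_set paravectors) U \<and> axially_symmetric U \<and>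
                (\<exists>f0 f1. slice_components U f f0 f1)}"

definition SH_intrinsic ::
    "'n clifford set \<Rightarrow> ('n clifford \<Rightarrow> 'n::{finite,linorder} clifford) set" where
  "SH_intrinsic U = {f. openin (top_of_set paravectors) U \<and> axially_symmetric U \<and>
                (\<exists>f0 f1. slice_components U f f0 f1 \<and>
                   (\<forall>p\<in>slice_domain U. f0 p \<in> range creal \<and> f1 p \<in> range creal))}"


section \<open>Double sectors and the function classes of the calculus\<close>

text \<open>For \<open>J\<close> in the imaginary sphere this is the exponential of \<open>J \<phi>\<close>.\<close>

definition cexp :: "'n clifford \<Rightarrow> real \<Rightarrow> 'n::finite clifford" where
  "cexp J \<phi> = slice_point J (cos \<phi>) (sin \<phi>)"

definition angles :: "real \<Rightarrow> real set" where
  "angles \<omega> = {- \<omega><..<\<omega>} \<union> {pi - \<omega><..<pi + \<omega>}"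

definition double_sector :: "real \<Rightarrow> 'n::finite clifford set" where
  "double_sector \<omega> = {r *\<^sub>R cexp J \<phi> | r J \<phi>. r > 0 \<and> J \<in> imag_sphere \<and> \<phi> \<in> angles \<omega>}"

definition omega_decay :: "real \<Rightarrow> ('n::finite clifford \<Rightarrow> 'n clifford) \<Rightarrow> bool" where
  "omega_decay \<theta> f \<longleftrightarrow> bounded (f ` double_sector \<theta>) \<and>
     (\<forall>J\<in>imag_sphere. \<forall>\<phi>\<in>angles \<theta>.
        (\<integral>\<^sup>+t\<in>{0<..}. ennreal (norm (f (t *\<^sub>R cexp J \<phi>)) / t) \<partial>lborel) < \<infinity>)"

definition SH_L0 :: "real \<Rightarrow> ('n clifford \<Rightarrow> 'n::{finite,linorder} clifford) set" where
  "SH_L0 \<theta> = {f \<in> SH_L (double_sector \<theta>). omega_decay \<theta> f}"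

definition SH_intrinsic0 :: "real \<Rightarrow> ('n clifford \<Rightarrow> 'n::{finite,linorder} clifford) set" where
  "SH_intrinsic0 \<theta> = {f \<in> SH_intrinsic (double_sector \<theta>). omega_decay \<theta> f}"


section \<open>Closed operators, S-spectrum and bisectorial operators\<close>

text \<open>An operator with domain is a partial map \<open>T\<close>; its domain is \<open>dom T\<close>, and
  \<open>T \<circ>\<^sub>m T\<close> is the square of \<open>T\<close> with its natural domain.\<close>

definition bounded_right_linear ::
    "(('v::real_normed_vector, 'n) cmodule \<Rightarrow> ('v, 'n::{finite,linorder}) cmodule) \<Rightarrow> bool" where
  "bounded_right_linear F \<longleftrightarrow> bounded_linear F \<and> (\<forall>v a. F (rmult v a) = rmult (F v) a)"

definition closed_right_linear ::
    "(('v::real_normed_vector, 'n) cmodule \<rightharpoonup> ('v, 'n::{finite,linorder}) cmodule) \<Rightarrow> bool" where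
  "closed_right_linear T \<longleftrightarrow>
     T 0 = Some 0 \<and>
     (\<forall>u v u' v'. T u = Some u' \<and> T v = Some v' \<longrightarrow> T (u + v) = Some (u' + v')) \<and>
     (\<forall>v v' a. T v = Some v' \<longrightarrow> T (rmult v a) = Some (rmult v' a)) \<and>
     closed {(v, v'). T v = Some v'}"

definition Q_op :: "(('v::real_normed_vector, 'n) cmodule \<rightharpoonup> ('v, 'n) cmodule) \<Rightarrow> 'n clifford
    \<Rightarrow> ('v, 'n::{finite,linorder}) cmodule \<rightharpoonup> ('v, 'n) cmodule" where
  "Q_op T s v = (if v \<in> dom (T \<circ>\<^sub>m T)
     then Some (the ((T \<circ>\<^sub>m T) v) - (2 * s $ {}) *\<^sub>R the (T v) + (norm s)\<^sup>2 *\<^sub>R v) else None)"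

definition Q_inv :: "(('v::real_normed_vector, 'n) cmodule \<rightharpoonup> ('v, 'n) cmodule) \<Rightarrow> 'n clifford
    \<Rightarrow> ('v, 'n::{finite,linorder}) cmodule \<Rightarrow> ('v, 'n) cmodule" where
  "Q_inv T s w = (THE v. Q_op T s v = Some w)"

definition S_resolvent_set ::
    "(('v::real_normed_vector, 'n) cmodule \<rightharpoonup> ('v, 'n) cmodule) \<Rightarrow> 'n::{finite,linorder} clifford set"
  where
  "S_resolvent_set T = {s \<in> paravectors.
     inj_on (Q_op T s) (dom (Q_op T s)) \<and> ran (Q_op T s) = UNIV \<and> bounded_right_linear (Q_inv T s)}"

definition S_spectrum ::
    "(('v::real_normed_vector, 'n) cmodule \<rightharpoonup> ('v, 'n) cmodule) \<Rightarrow> 'n::{finite,linorder} clifford set"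
  where
  "S_spectrum T = paravectors - S_resolvent_set T"

definition SL_resolvent ::
    "(('v::real_normed_vector, 'n) cmodule \<rightharpoonup> ('v, 'n) cmodule) \<Rightarrow> 'n clifford
      \<Rightarrow> ('v, 'n::{finite,linorder}) cmodule \<Rightarrow> ('v, 'n) cmodule" where
  "SL_resolvent T s v = Q_inv T s (lmult (pconj s) v) - the (T (Q_inv T s v))"

text \<open>The norm in the resolvent estimate presupposes that the resolvent operator is bounded
  (which holds by the closed graph theorem); as \<open>onorm\<close> is only meaningful for bounded
  operators, this is spelled out.\<close>

definition bisectorial ::
    "real \<Rightarrow> (('v::real_normed_vector, 'n) cmodule \<rightharpoonup> ('v, 'n::{finite,linorder}) cmodule) \<Rightarrow> bool"
  where
  "bisectorial \<omega> T \<longleftrightarrow>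
     closed_right_linear T \<and>
     S_spectrum T \<subseteq> closure (double_sector \<omega>) \<and>
     (\<forall>\<phi>\<in>{\<omega><..<pi / 2}. \<exists>C\<ge>0. \<forall>s\<in>paravectors - (double_sector \<phi> \<union> {0}).
        bounded_linear (SL_resolvent T s) \<and> onorm (SL_resolvent T s) \<le> C / norm s)"


section \<open>The functional calculus\<close>

text \<open>The two boundary curves are obtained for \<open>\<sigma> = 1\<close> and \<open>\<sigma> = - 1\<close>.\<close>

definition sector_path :: "'n clifford \<Rightarrow> real \<Rightarrow> real \<Rightarrow> real \<Rightarrow> 'n::finite clifford" where
  "sector_path J \<phi> \<sigma> t = (\<sigma> * \<bar>t\<bar>) *\<^sub>R cexp J (- sgn t * \<phi>)"

text \<open>
  The integral is the library's Henstock-Kurzweil integral, as the Bochner integral of the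
  library requires a separable target and the operator space is not separable in general.
  The division by \<open>J\<close> is multiplication by its inverse \<open>- J\<close>. The integrand
  at \<open>t = 0\<close>, where the path is not differentiable, is irrelevant.
\<close>

definition omega_integral :: "(('v::real_normed_vector, 'n) cmodule \<rightharpoonup> ('v, 'n) cmodule)
    \<Rightarrow> ('n clifford \<Rightarrow> 'n clifford) \<Rightarrow> real \<Rightarrow> 'n clifford
    \<Rightarrow> ('v, 'n::{finite,linorder}) cmodule \<Rightarrow>\<^sub>L ('v, 'n) cmodule" where
  "omega_integral T f \<phi> J = (1 / (2 * pi)) *\<^sub>R (\<Sum>\<sigma>\<in>{1, - 1}. integral UNIV (\<lambda>t.
     Blinfun (\<lambda>v. SL_resolvent T (sector_path J \<phi> \<sigma> t)
       (lmult (vector_derivative (sector_path J \<phi> \<sigma>) (at t) \<odot> (- J) \<odot> f (sector_path J \<phi> \<sigma> t)) v))))"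

text \<open>The operator \<open>f(T)\<close>: the common value of these integrals for all admissible angles and
  imaginary units.\<close>

definition omega_calculus :: "real \<Rightarrow> real
    \<Rightarrow> (('v::real_normed_vector, 'n) cmodule \<rightharpoonup> ('v, 'n) cmodule)
    \<Rightarrow> ('n clifford \<Rightarrow> 'n clifford)
    \<Rightarrow> ('v, 'n::{finite,linorder}) cmodule \<Rightarrow>\<^sub>L ('v, 'n) cmodule" where
  "omega_calculus \<omega> \<theta> T f =
     (THE F. \<forall>\<phi>\<in>{\<omega><..<\<theta>}. \<forall>J\<in>imag_sphere. omega_integral T f \<phi> J = F)"

end

theory Submission
  imports Defs "HOL-Complex_Analysis.Complex_Analysis"
begin

text \<open>
  Right multiplication by a generator turns \<open>V\<close> into a complex Banach space on which \<open>T\<close> is complex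
  linear, and for \<open>z = x + iy\<close> the operator \<open>Q_s[T]\<close> with \<open>s = x + Jy\<close> factors as
  \<open>(T - z)(T - cnj z)\<close>. Hence the S-resolvent is \<open>E(z) - O(z) J\<close>, where \<open>K(z) = E(z) - i O(z)\<close>
  splits the ordinary resolvent \<open>K(z) = (z - T)\<^sup>-\<^sup>1\<close> into its parts even and odd under conjugation. Likewise each real
  component of \<open>f\<close> gives an ordinary holomorphic function \<open>h_A = f0_A + i f1_A\<close> with
  \<open>h_A (cnj z) = cnj (h_A z)\<close>. Pairing conjugate points of the contour cancels the terms containing
  \<open>J\<close>, and \<open>f(T)\<close> becomes the sum over \<open>A\<close> of \<open>h_A(T) e_A\<close>, where \<open>h_A(T)\<close> is given by the classical
  calculus for bisectorial operators. For an intrinsic \<open>g\<close> only \<open>A = {}\<close> contributes, so the product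
  rule reduces to the classical one, which follows from the resolvent identity and Cauchy's
  theorem. Since the hypotheses only bound the integrals along rays, without pointwise
  decay at 0 and infinity, the functions are first multiplied by a regulariser
  \<open>n\<^sup>4 z\<^sup>2 / ((n\<^sup>2 + z\<^sup>2) (1 + n\<^sup>2 z\<^sup>2))\<close>, and then \<open>n\<close> tends to infinity.
\<close>

section \<open>Improper integrals of Banach-valued functions\<close>

text \<open>Left multiplication need not commute with \<open>T\<close>, right multiplication does.
  The complex unit is therefore taken from the right, while the basis elements \<open>e_A\<close>
  stay at the far right of each operator, where they act first. In \<open>g(T) f(T)\<close> nothing
  stands between the two scalar calculi as long as \<open>g\<close> has no component besides
  \<open>{}\<close>; this is where an intrinsic \<open>g\<close> on the left is decisive.
  Operator-valued integrals are handled through continuity and a real dominating function, so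
  interchanging two of them calls for a bound of the form \<open>a r * b s\<close>. The two factors
  are integrated over contours of different angles, for then the distance of the rays controls the
  Cauchy kernel, and linear decay of both functions at 0 and infinity turns the bounds into
  multiples of \<open>1 / (1 + r^2)\<close>. Cauchy's theorem is used for scalar functions only;
  that the operator integrals do not depend on the angle comes from differentiating in the
  angle.\<close>

lemma integrable_dominated_approx:
  fixes F :: "'a::euclidean_space \<Rightarrow> 'b::banach"
  assumes approx: "\<And>e. e > 0 \<Longrightarrow> \<exists>F' h. F' integrable_on cbox a b \<and> h integrable_on cbox a b \<and>
      (\<forall>x\<in>cbox a b. norm (F x - F' x) \<le> h x) \<and> integral (cbox a b) h < e"
  shows "F integrable_on cbox a b"
  unfolding integrable_Cauchy
proof (intro allI impI)
  fix e :: real assume "e > 0"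
  then have e: "e / 5 > 0" by simp
  from approx[OF this] obtain F' h where F': "F' integrable_on cbox a b"
    and h: "h integrable_on cbox a b"
    and le: "\<And>x. x \<in> cbox a b \<Longrightarrow> norm (F x - F' x) \<le> h x" and small: "integral (cbox a b) h < e / 5"
    by blast
  from F' e obtain \<gamma>1 where g1: "gauge \<gamma>1" and c1: "\<And>D E. D tagged_division_of cbox a b \<Longrightarrow> \<gamma>1 fine D \<Longrightarrow>
      E tagged_division_of cbox a b \<Longrightarrow> \<gamma>1 fine E \<Longrightarrow>
      norm ((\<Sum>(x,K)\<in>D. measure lborel K *\<^sub>R F' x) - (\<Sum>(x,K)\<in>E. measure lborel K *\<^sub>R F' x)) < e / 5"
    unfolding integrable_Cauchy by meson
  have "(h has_integral integral (cbox a b) h) (cbox a b)" using h by (rule integrable_integral)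
  with e obtain \<gamma>2 where g2: "gauge \<gamma>2" and c2: "\<And>D. D tagged_division_of cbox a b \<Longrightarrow> \<gamma>2 fine D \<Longrightarrow>
      norm ((\<Sum>(x,K)\<in>D. measure lborel K *\<^sub>R h x) - integral (cbox a b) h) < e / 5"
    unfolding has_integral by meson
  \<comment> \<open>On a \<open>\<gamma>2\<close>-fine division the Riemann sums of \<open>F\<close>
    and \<open>F'\<close> differ by at most the Riemann sum of \<open>h\<close>, which is less than
    \<open>integral (cbox a b) h + e / 5\<close>. Comparing two divisions for \<open>F\<close> then
    costs 2 + 1 + 2 fifths of \<open>e\<close>.\<close>
  have close: "norm ((\<Sum>(x,K)\<in>D. measure lborel K *\<^sub>R F x) - (\<Sum>(x,K)\<in>D. measure lborel K *\<^sub>R F' x)) < 2 * (e / 5)"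
    if D: "D tagged_division_of cbox a b" "\<gamma>2 fine D" for D
  proof -
    have "(\<Sum>(x,K)\<in>D. measure lborel K *\<^sub>R F x) - (\<Sum>(x,K)\<in>D. measure lborel K *\<^sub>R F' x)
        = (\<Sum>(x,K)\<in>D. measure lborel K *\<^sub>R (F x - F' x))"
      unfolding sum_subtractf[symmetric] by (intro sum.cong) (auto simp: scaleR_diff_right)
    also have "norm \<dots> \<le> (\<Sum>(x,K)\<in>D. measure lborel K *\<^sub>R h x)"
      using D(1) by (intro sum_norm_le) (auto intro!: mult_left_mono le dest: tag_in_interval[rotated])
    also have "\<dots> < 2 * (e / 5)" using c2[OF D] small unfolding real_norm_def real_scaleR_def by linarith
    finally show ?thesis .
  qed
  show "\<exists>\<gamma>. gauge \<gamma> \<and> (\<forall>D E. D tagged_division_of cbox a b \<and> \<gamma> fine D \<and>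
      E tagged_division_of cbox a b \<and> \<gamma> fine E \<longrightarrow>
      norm ((\<Sum>(x,K)\<in>D. measure lborel K *\<^sub>R F x) - (\<Sum>(x,K)\<in>E. measure lborel K *\<^sub>R F x)) < e)"
  proof (intro exI conjI allI impI)
    show "gauge (\<lambda>x. \<gamma>1 x \<inter> \<gamma>2 x)" using g1 g2 by auto
    fix D E assume "D tagged_division_of cbox a b \<and> (\<lambda>x. \<gamma>1 x \<inter> \<gamma>2 x) fine D \<and>
      E tagged_division_of cbox a b \<and> (\<lambda>x. \<gamma>1 x \<inter> \<gamma>2 x) fine E"
    then have D: "D tagged_division_of cbox a b" "\<gamma>1 fine D" "\<gamma>2 fine D"
      and E: "E tagged_division_of cbox a b" "\<gamma>1 fine E" "\<gamma>2 fine E" by (auto simp: fine_Int)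
    let ?S = "\<lambda>D F. \<Sum>(x,K)\<in>D. measure lborel K *\<^sub>R F x"
    have "norm (?S D F - ?S E F) \<le> norm (?S D F - ?S D F') + norm (?S D F' - ?S E F') + norm (?S E F - ?S E F')"
      using norm_triangle_ineq[of "?S D F - ?S D F'" "?S D F' - ?S E F'"]
        norm_triangle_ineq4[of "?S D F - ?S D F' + (?S D F' - ?S E F')" "?S E F - ?S E F'"] by simp
    then show "norm (?S D F - ?S E F) < e"
      using close[OF D(1,3)] close[OF E(1,3)] c1[OF D(1,2) E(1,2)] by linarith
  qed
qed

section \<open>Truncation to compact intervals and integrals over the half-line\<close>

text \<open>\<open>Suc n\<close> instead of \<open>n\<close> matters at \<open>n = 0\<close>, where
  \<open>1 / 0 = 0\<close> would give the interval \<open>{0}\<close>, outside the open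
  half-line.\<close>

definition trunc :: "nat \<Rightarrow> real set" where
  "trunc n = {1 / real (Suc n)..real (Suc n)}"

lemma trunc_subset: "trunc n \<subseteq> {0<..}"
  unfolding trunc_def by (auto intro: less_le_trans[of 0 "1 / real (Suc n)"])

lemma eventually_mem_trunc:
  assumes "0 < (r::real)" shows "eventually (\<lambda>n. r \<in> trunc n) sequentially"
proof -
  obtain N1 where N1: "r \<le> real N1" using real_arch_simple by blast
  obtain N2 where N2: "1 / r \<le> real N2" using real_arch_simple by blast
  show ?thesis
  proof (rule eventually_sequentiallyI[of "max N1 N2"])
    fix n assume n: "max N1 N2 \<le> n"
    then have "1 / r \<le> real (Suc n)" "r \<le> real (Suc n)" using N1 N2 by linarith+
    then show "r \<in> trunc n" using assms unfolding trunc_def by (auto simp: field_simps)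
  qed
qed

text \<open>Henstock-Kurzweil integrability alone does not pass to measurable subsets; nonnegativity
  makes \<open>b\<close> absolutely integrable, and that property does.\<close>

lemma nonneg_integrable_on_trunc:
  fixes b :: "real \<Rightarrow> real"
  assumes b: "b integrable_on {0<..}" and nn: "\<And>r. r > 0 \<Longrightarrow> 0 \<le> b r"
    and S: "S \<subseteq> {0<..}" "S \<in> sets lebesgue"
  shows "b integrable_on S"
proof -
  have "b absolutely_integrable_on {0<..}"
    using b nn by (intro nonnegative_absolutely_integrable_1) auto
  then have "b absolutely_integrable_on S" by (rule set_integrable_subset) (use S in auto)
  then show ?thesis by (rule set_lebesgue_integral_eq_integral(1))
qed

lemma trunc_lebesgue: "trunc n \<in> sets lebesgue" by (simp add: trunc_def)

lemma integral_trunc_tendsto: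
  fixes b :: "real \<Rightarrow> real"
  assumes b: "b integrable_on {0<..}" and nn: "\<And>r. r > 0 \<Longrightarrow> 0 \<le> b r"
  shows "(\<lambda>n. integral (trunc n) b) \<longlonglongrightarrow> integral {0<..} b"
proof -
  let ?f = "\<lambda>n s. if s \<in> trunc n then b s else 0"
  have "(\<lambda>n. integral {0<..} (?f n)) \<longlonglongrightarrow> integral {0<..} b"
  proof (rule dominated_convergence(2)[OF _ b])
    show "?f n integrable_on {0<..}" for n
      using nonneg_integrable_on_trunc[OF b nn trunc_subset trunc_lebesgue, of n] trunc_subset[of n]
      by (simp add: integrable_restrict_Int inf.absorb1)
    show "norm (?f n s) \<le> b s" if "s \<in> {0<..}" for n s using nn that by auto
    show "(\<lambda>n. ?f n s) \<longlonglongrightarrow> b s" if "s \<in> {0<..}" for s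
      by (rule tendsto_eventually, rule eventually_mono[OF eventually_mem_trunc[of s]]) (use that in auto)
  qed
  moreover have "integral {0<..} (?f n) = integral (trunc n) b" for n
    unfolding Henstock_Kurzweil_Integration.integral_restrict_Int inf.absorb1[OF trunc_subset] by (rule refl)
  ultimately show ?thesis by simp
qed

text \<open>The library has this for measurable functions only when the target is Euclidean.\<close>

lemma dominated_integrable_halfline:
  fixes G :: "real \<Rightarrow> 'b::banach"
  assumes cont: "continuous_on {0<..} G" and dom: "\<And>r. r > 0 \<Longrightarrow> norm (G r) \<le> b r"
    and b: "b integrable_on {0<..}"
  shows "G integrable_on {0<..}"
proof (rule integrable_on_all_intervals_integrable_bound[OF _ _ b])
  show "norm (G r) \<le> b r" if "r \<in> {0<..}" for r using dom that by auto
  have nn: "0 \<le> b r" if "r > 0" for r using dom[OF that] norm_ge_zero order_trans by blast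
  fix c d :: real
  let ?F = "\<lambda>x. if x \<in> {0<..} then G x else 0"
  show "?F integrable_on cbox c d"
  proof (rule integrable_dominated_approx)
    fix e :: real assume "e > 0"
    \<comment> \<open>\<open>\<delta> n\<close> is the price of discarding
      \<open>(0, 1 / (n + 1))\<close>, the only place where \<open>G\<close> may be unbounded on the
      given interval. Its integral tends to 0 by dominated convergence of real functions; what
      remains of \<open>G\<close> is continuous on a compact interval.\<close>
    define \<delta> where "\<delta> n = (\<lambda>x. if x \<in> {0<..<1 / real (Suc n)} then b x else 0)" for n
    have di: "\<delta> n integrable_on {0<..}" for n
      unfolding \<delta>_def integrable_restrict_Int
      by (rule nonneg_integrable_on_trunc[OF b nn]) auto
    have "(\<lambda>n. integral {0<..} (\<delta> n)) \<longlonglongrightarrow> integral {0<..} (\<lambda>x::real. 0::real)"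
    proof (rule dominated_convergence(2)[OF di b])
      show "norm (\<delta> n x) \<le> b x" if "x \<in> {0<..}" for n x using nn that by (auto simp: \<delta>_def)
      show "(\<lambda>n. \<delta> n x) \<longlonglongrightarrow> 0" if "x \<in> {0<..}" for x
        by (rule tendsto_eventually, rule eventually_mono[OF eventually_mem_trunc[of x]])
          (use that in \<open>auto simp: \<delta>_def trunc_def\<close>)
    qed
    then have "eventually (\<lambda>n. integral {0<..} (\<delta> n) < e) sequentially"
      using \<open>e > 0\<close> by (auto intro: order_tendstoD)
    then obtain n where n: "integral {0<..} (\<delta> n) < e" by (auto simp: eventually_sequentially)
    have dU: "\<delta> n integrable_on UNIV" "integral UNIV (\<delta> n) = integral {0<..} (\<delta> n)"
    proof -
      have "(\<lambda>x. if x \<in> {0<..} then \<delta> n x else 0) = \<delta> n" by (auto simp: \<delta>_def)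
      then show "\<delta> n integrable_on UNIV" "integral UNIV (\<delta> n) = integral {0<..} (\<delta> n)"
        using di[of n] Henstock_Kurzweil_Integration.integrable_restrict_UNIV[of "{0<..}" "\<delta> n"]
          Henstock_Kurzweil_Integration.integral_restrict_UNIV[of "{0<..}" "\<delta> n"] by simp_all
    qed
    have d0: "0 \<le> \<delta> n x" for x using nn by (auto simp: \<delta>_def)
    have dab: "\<delta> n integrable_on cbox c d" using integrable_on_subcbox dU(1) by blast
    have "integral (cbox c d) (\<delta> n) \<le> integral UNIV (\<delta> n)"
      by (rule integral_subset_le) (use dab dU d0 in auto)
    then have small: "integral (cbox c d) (\<delta> n) < e" using n dU by linarith
    let ?F' = "\<lambda>x. if x \<in> {1 / real (Suc n)..} then G x else 0"
    have "?F' integrable_on cbox c d"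
    proof -
      have "cbox c d \<inter> {1 / real (Suc n)..} = cbox (max c (1 / real (Suc n))) d" by auto
      moreover have "cbox (max c (1 / real (Suc n))) d \<subseteq> {0<..}"
        by (auto intro: less_le_trans[of 0 "1 / real (Suc n)"])
      ultimately show ?thesis unfolding integrable_restrict_Int
        by (metis cont continuous_on_subset inf_commute integrable_continuous)
    qed
    moreover have "norm (?F x - ?F' x) \<le> \<delta> n x" for x
    proof -
      have "0 < 1 / real (Suc n)" by simp
      then have "1 / real (Suc n) \<le> x \<Longrightarrow> 0 < x" by linarith
      then show ?thesis using dom[of x] by (auto simp: \<delta>_def simp del: of_nat_Suc)
    qed
    ultimately show "\<exists>F' h. F' integrable_on cbox c d \<and> h integrable_on cbox c d \<and>
      (\<forall>x\<in>cbox c d. norm (?F x - F' x) \<le> h x) \<and> integral (cbox c d) h < e"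
      using dab small by blast
  qed
qed

text \<open>Off \<open>trunc n\<close> the function is dominated by \<open>b\<close>, on it nothing
  is left. \<open>G\<close> enters the error only through \<open>b\<close>, so the estimate is
  uniform in any parameter on which \<open>G\<close> depends but \<open>b\<close> does not.\<close>

lemma integral_halfline_trunc_error:
  fixes G :: "real \<Rightarrow> 'b::banach"
  assumes cont: "continuous_on {0<..} G" and dom: "\<And>r. r > 0 \<Longrightarrow> norm (G r) \<le> b r"
    and b: "b integrable_on {0<..}"
  shows "norm (integral {0<..} G - integral (trunc n) G) \<le> integral {0<..} b - integral (trunc n) b"
proof -
  have nn: "0 \<le> b r" if "r > 0" for r using dom[OF that] norm_ge_zero order_trans by blast
  have Gi: "G integrable_on {0<..}" by (rule dominated_integrable_halfline[OF assms])
  have Gt: "G integrable_on trunc n" unfolding trunc_def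
    by (rule integrable_continuous_interval, rule continuous_on_subset[OF cont])
       (use trunc_subset[of n] in \<open>auto simp: trunc_def\<close>)
  have bt: "b integrable_on trunc n" by (rule nonneg_integrable_on_trunc[OF b nn trunc_subset trunc_lebesgue])
  let ?r = "\<lambda>f s. if s \<in> trunc n then f s else 0"
  have i: "?r G integrable_on {0<..}" "?r b integrable_on {0<..}"
    using Gt bt trunc_subset[of n] by (simp_all add: integrable_restrict_Int inf.absorb1)
  have e: "integral (trunc n) G = integral {0<..} (?r G)" "integral (trunc n) b = integral {0<..} (?r b)"
    unfolding Henstock_Kurzweil_Integration.integral_restrict_Int inf.absorb1[OF trunc_subset] by (rule refl)+
  show ?thesis unfolding e integral_diff[OF Gi i(1), symmetric] integral_diff[OF b i(2), symmetric]
    by (rule integral_norm_bound_integral) (use Gi b i dom in \<open>auto intro!: integrable_diff\<close>)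
qed

lemma integral_halfline_trunc_tendsto:
  fixes G :: "real \<Rightarrow> 'b::banach"
  assumes cont: "continuous_on {0<..} G" and dom: "\<And>r. r > 0 \<Longrightarrow> norm (G r) \<le> b r"
    and b: "b integrable_on {0<..}"
  shows "(\<lambda>n. integral (trunc n) G) \<longlonglongrightarrow> integral {0<..} G"
proof -
  have nn: "0 \<le> b r" if "r > 0" for r using dom[OF that] norm_ge_zero order_trans by blast
  have "(\<lambda>n. integral {0<..} b - integral (trunc n) b) \<longlonglongrightarrow> integral {0<..} b - integral {0<..} b"
    by (intro tendsto_intros integral_trunc_tendsto b nn)
  then have "(\<lambda>n. integral {0<..} G - integral (trunc n) G) \<longlonglongrightarrow> 0"
    by (intro Lim_null_comparison[OF always_eventually[OF allI[OF integral_halfline_trunc_error[OF assms]]]]) auto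
  then show ?thesis using tendsto_diff[OF tendsto_const[of "integral {0<..} G"]] by fastforce
qed

lemma integral_halfline_norm_bound:
  fixes G :: "real \<Rightarrow> 'b::banach"
  assumes "continuous_on {0<..} G" "\<And>r. r > 0 \<Longrightarrow> norm (G r) \<le> b r" "b integrable_on {0<..}"
  shows "norm (integral {0<..} G) \<le> integral {0<..} b"
  by (rule integral_norm_bound_integral[OF dominated_integrable_halfline[OF assms] assms(3)])
     (use assms in auto)

section \<open>Iterated integrals of kernels dominated by a product\<close>

context
  fixes k :: "real \<Rightarrow> real \<Rightarrow> 'b::banach" and a b :: "real \<Rightarrow> real"
  assumes cont: "continuous_on ({0<..} \<times> {0<..}) (\<lambda>(r, s). k r s)"
    and dom: "\<And>r s. r > 0 \<Longrightarrow> s > 0 \<Longrightarrow> norm (k r s) \<le> a r * b s"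
    and a: "a integrable_on {0<..}" "continuous_on {0<..} a" "\<And>r. r > 0 \<Longrightarrow> 0 \<le> a r"
    and b: "b integrable_on {0<..}" "continuous_on {0<..} b" "\<And>r. r > 0 \<Longrightarrow> 0 \<le> b r"
begin

lemma cont2: "r > 0 \<Longrightarrow> continuous_on {0<..} (k r)"
  by (rule continuous_on_compose2[OF cont, where f="Pair r", simplified]) (auto intro!: continuous_intros)

lemma inner_trunc_continuous:
  "continuous_on {0<..} (\<lambda>r. integral (trunc n) (k r))"
  unfolding trunc_def cbox_interval[symmetric]
  by (rule integral_continuous_on_param)
     (rule continuous_on_subset[OF cont], use trunc_subset[of n] in \<open>auto simp: trunc_def\<close>)

lemma scaled_integrable: "(\<lambda>s. c * b s) integrable_on {0<..}"
  using integrable_cmul[OF b(1), of c] by simp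

lemma inner_error:
  assumes "r > 0"
  shows "norm (integral {0<..} (k r) - integral (trunc n) (k r))
    \<le> a r * (integral {0<..} b - integral (trunc n) b)"
proof -
  have "norm (integral {0<..} (k r) - integral (trunc n) (k r))
      \<le> integral {0<..} (\<lambda>s. a r * b s) - integral (trunc n) (\<lambda>s. a r * b s)"
    by (rule integral_halfline_trunc_error) (fact cont2[OF assms] dom[OF assms] scaled_integrable)+
  then show ?thesis by (simp only: right_diff_distrib integral_mult_right)
qed

text \<open>The truncated inner integrals are continuous by compactness, and they converge locally
  uniformly: on \<open>[u, v]\<close> their error is at most \<open>M\<close> times the tail of
  \<open>b\<close>, where \<open>M\<close> bounds the continuous function \<open>a\<close> there.
  Open intervals \<open>{u<..<v}\<close> cover the half-line.\<close>

lemma inner_continuous: "continuous_on {0<..} (\<lambda>r. integral {0<..} (k r))"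
proof -
  have "continuous_on {u<..<v} (\<lambda>r. integral {0<..} (k r))" if uv: "0 < u" for u v
  proof (rule uniform_limit_theorem)
    show "\<forall>\<^sub>F n in sequentially. continuous_on {u<..<v} (\<lambda>r. integral (trunc n) (k r))"
      using uv by (auto intro!: always_eventually continuous_on_subset[OF inner_trunc_continuous])
    have "compact (a ` {u..v})"
      by (rule compact_continuous_image[OF continuous_on_subset[OF a(2)]]) (use uv in auto)
    then obtain M where M: "\<And>r. r \<in> {u..v} \<Longrightarrow> \<bar>a r\<bar> \<le> M"
      by (fastforce dest!: compact_imp_bounded simp: bounded_iff)
    have lim: "(\<lambda>n. M * (integral {0<..} b - integral (trunc n) b)) \<longlonglongrightarrow> M * (integral {0<..} b - integral {0<..} b)"
      by (intro tendsto_intros integral_trunc_tendsto b)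
    have pos: "0 \<le> integral {0<..} b - integral (trunc n) b" for n
      using integral_halfline_trunc_error[OF b(2) _ b(1), of n] b(3) norm_ge_zero order_trans
      by (metis abs_of_nonneg order_refl real_norm_def)
    show "uniform_limit {u<..<v} (\<lambda>n r. integral (trunc n) (k r)) (\<lambda>r. integral {0<..} (k r)) sequentially"
    proof (rule uniform_limitI)
      fix e :: real assume "e > 0"
      have "\<forall>\<^sub>F n in sequentially. M * (integral {0<..} b - integral (trunc n) b) < e"
        using order_tendstoD(2)[OF lim] \<open>e > 0\<close> by simp
      then show "\<forall>\<^sub>F n in sequentially. \<forall>r\<in>{u<..<v}. dist (integral (trunc n) (k r)) (integral {0<..} (k r)) < e"
      proof (rule eventually_mono, intro ballI)
        fix n r assume n: "M * (integral {0<..} b - integral (trunc n) b) < e" and r: "r \<in> {u<..<v}"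
        have "dist (integral (trunc n) (k r)) (integral {0<..} (k r)) \<le> a r * (integral {0<..} b - integral (trunc n) b)"
          using inner_error[of r n] r uv by (simp add: dist_norm norm_minus_commute)
        also have "\<dots> \<le> M * (integral {0<..} b - integral (trunc n) b)"
          using M[of r] r pos by (intro mult_right_mono) auto
        finally show "dist (integral (trunc n) (k r)) (integral {0<..} (k r)) < e" using n by linarith
      qed
    qed
  qed auto
  then have "continuous_on (\<Union>p\<in>{p. 0 < fst p}. {fst p<..<snd p}) (\<lambda>r. integral {0<..} (k r))"
    by (intro continuous_on_open_UN) auto
  moreover have "{0<..} \<subseteq> (\<Union>p\<in>{p. 0 < fst p}. {fst p<..<snd p :: real})"
  proof
    fix x :: real assume "x \<in> {0<..}"
    then show "x \<in> (\<Union>p\<in>{p. 0 < fst p}. {fst p<..<snd p})" by (intro UN_I[of "(x/2, 2*x)"]) auto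
  qed
  ultimately show ?thesis by (rule continuous_on_subset)
qed

lemma inner_bound:
  assumes "r > 0"
  shows "norm (integral {0<..} (k r)) \<le> a r * integral {0<..} b"
proof -
  have "norm (integral {0<..} (k r)) \<le> integral {0<..} (\<lambda>s. a r * b s)"
    by (rule integral_halfline_norm_bound) (fact cont2[OF assms] dom[OF assms] scaled_integrable)+
  then show ?thesis by (simp only: integral_mult_right)
qed

lemma iterated_integrable: "(\<lambda>r. integral {0<..} (k r)) integrable_on {0<..}"
proof (rule dominated_integrable_halfline)
  show "(\<lambda>r. a r * integral {0<..} b) integrable_on {0<..}"
    using integrable_on_cmult_right[OF a(1), of "integral {0<..} b"] by simp
qed (fact inner_continuous inner_bound)+

text \<open>One index truncates both variables: shortening the inner integrals costs at most
  \<open>integral {0<..} a\<close> times the tail of \<open>b\<close>, and the outer truncation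
  converges because the inner integral is itself continuous and dominated.\<close>

lemma iterated_integral_limit:
  "(\<lambda>n. integral (trunc n) (\<lambda>r. integral (trunc n) (k r))) \<longlonglongrightarrow> integral {0<..} (\<lambda>r. integral {0<..} (k r))"
proof -
  let ?F = "\<lambda>r. integral {0<..} (k r)" and ?Fn = "\<lambda>n r. integral (trunc n) (k r)"
  let ?t = "\<lambda>n. integral {0<..} b - integral (trunc n) b"
  have F: "(\<lambda>n. integral (trunc n) ?F) \<longlonglongrightarrow> integral {0<..} ?F"
  proof (rule integral_halfline_trunc_tendsto)
    show "(\<lambda>r. a r * integral {0<..} b) integrable_on {0<..}"
      using integrable_on_cmult_right[OF a(1), of "integral {0<..} b"] by simp
  qed (fact inner_continuous inner_bound)+
  have ct: "f integrable_on trunc n" if "continuous_on {0<..} f" for f :: "real \<Rightarrow> 'c::banach" and n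
    unfolding trunc_def
    by (rule integrable_continuous_interval, rule continuous_on_subset[OF that])
       (use trunc_subset[of n] in \<open>auto simp: trunc_def\<close>)
  have err: "norm (integral (trunc n) (?Fn n) - integral (trunc n) ?F) \<le> integral {0<..} a * ?t n" for n
  proof -
    have pos: "0 \<le> ?t n"
      using integral_halfline_trunc_error[OF b(2) _ b(1), of n] b(3) norm_ge_zero order_trans
      by (metis abs_of_nonneg order_refl real_norm_def)
    have "norm (integral (trunc n) (\<lambda>r. ?Fn n r - ?F r)) \<le> integral (trunc n) (\<lambda>r. a r * ?t n)"
    proof (rule integral_norm_bound_integral)
      show "norm (?Fn n r - ?F r) \<le> a r * ?t n" if "r \<in> trunc n" for r
        using inner_error[of r n] trunc_subset[of n] that by (auto simp: norm_minus_commute)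
    qed (auto intro!: ct continuous_intros inner_trunc_continuous inner_continuous a)
    also have "\<dots> = integral (trunc n) a * ?t n" by simp
    also have "\<dots> \<le> integral {0<..} a * ?t n"
      by (intro mult_right_mono pos integral_subset_le) (use a trunc_subset[of n] ct[OF a(2)] in auto)
    also have "integral (trunc n) (\<lambda>r. ?Fn n r - ?F r) = integral (trunc n) (?Fn n) - integral (trunc n) ?F"
      by (intro integral_diff ct inner_trunc_continuous inner_continuous)
    finally show ?thesis .
  qed
  have "(\<lambda>n. integral {0<..} a * ?t n) \<longlonglongrightarrow> integral {0<..} a * (integral {0<..} b - integral {0<..} b)"
    by (intro tendsto_intros integral_trunc_tendsto b)
  then have "(\<lambda>n. integral (trunc n) (?Fn n) - integral (trunc n) ?F) \<longlonglongrightarrow> 0"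
    by (intro Lim_null_comparison[OF always_eventually[OF allI[OF err]]]) auto
  from tendsto_add[OF this F] show ?thesis by simp
qed

end

text \<open>Fubini's theorem for continuous kernels: on the compact squares
  \<open>trunc n \<times> trunc n\<close> the order is free, and both iterated integrals are limits
  of these square integrals. The hypotheses are symmetric in the two variables, so the second limit
  is the first one with the roles exchanged.\<close>

lemma integral_halfline_swap:
  fixes k :: "real \<Rightarrow> real \<Rightarrow> 'b::banach"
  assumes cont: "continuous_on ({0<..} \<times> {0<..}) (\<lambda>(r, s). k r s)"
    and dom: "\<And>r s. r > 0 \<Longrightarrow> s > 0 \<Longrightarrow> norm (k r s) \<le> a r * b s"
    and a: "a integrable_on {0<..}" "continuous_on {0<..} a" "\<And>r. r > 0 \<Longrightarrow> 0 \<le> a r"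
    and b: "b integrable_on {0<..}" "continuous_on {0<..} b" "\<And>r. r > 0 \<Longrightarrow> 0 \<le> b r"
  shows "integral {0<..} (\<lambda>r. integral {0<..} (k r)) = integral {0<..} (\<lambda>s. integral {0<..} (\<lambda>r. k r s))"
    and "(\<lambda>r. integral {0<..} (k r)) integrable_on {0<..}"
    and "(\<lambda>s. integral {0<..} (\<lambda>r. k r s)) integrable_on {0<..}"
proof -
  have cont': "continuous_on ({0<..} \<times> {0<..}) (\<lambda>(s, r). k r s)"
  proof -
    have "continuous_on ({0<..} \<times> {0<..}) (\<lambda>p. (\<lambda>(r, s). k r s) (snd p, fst p))"
      by (rule continuous_on_compose2[OF cont]) (auto intro!: continuous_intros)
    then show ?thesis by (simp add: case_prod_unfold)
  qed
  have dom': "norm (k r s) \<le> b s * a r" if "0 < s" "0 < r" for s r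
    using dom[OF that(2,1)] by (simp add: mult.commute)
  show "(\<lambda>r. integral {0<..} (k r)) integrable_on {0<..}"
    by (rule iterated_integrable[where a=a and b=b]) (fact assms)+
  show "(\<lambda>s. integral {0<..} (\<lambda>r. k r s)) integrable_on {0<..}"
    by (rule iterated_integrable[where a=b and b=a]) (fact cont' dom' a b)+
  show "integral {0<..} (\<lambda>r. integral {0<..} (k r)) = integral {0<..} (\<lambda>s. integral {0<..} (\<lambda>r. k r s))"
  proof (rule LIMSEQ_unique)
  show "(\<lambda>n. integral (trunc n) (\<lambda>r. integral (trunc n) (k r))) \<longlonglongrightarrow> integral {0<..} (\<lambda>r. integral {0<..} (k r))"
    by (rule iterated_integral_limit[where a=a and b=b]) (fact assms)+
  have "(\<lambda>n. integral (trunc n) (\<lambda>s. integral (trunc n) (\<lambda>r. k r s)))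
      \<longlonglongrightarrow> integral {0<..} (\<lambda>s. integral {0<..} (\<lambda>r. k r s))"
    by (rule iterated_integral_limit[where a=b and b=a]) (fact cont' dom' a b)+
  moreover have "integral (trunc n) (\<lambda>r. integral (trunc n) (k r)) = integral (trunc n) (\<lambda>s. integral (trunc n) (\<lambda>r. k r s))" for n
    unfolding trunc_def cbox_interval[symmetric]
    by (rule integral_swap_continuous, rule continuous_on_subset[OF cont])
      (use trunc_subset[of n] in \<open>auto simp: trunc_def cbox_Pair_eq\<close>)
  ultimately show "(\<lambda>n. integral (trunc n) (\<lambda>r. integral (trunc n) (k r)))
      \<longlonglongrightarrow> integral {0<..} (\<lambda>s. integral {0<..} (\<lambda>r. k r s))" by simp
  qed
qed

section \<open>Double sectors and the Cauchy theorem\<close>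

text \<open>The rays of the contour: \<open>\<sigma>\<close> is the sign of the curve and
  \<open>\<tau>\<close> the sign of its parameter \<open>t\<close>; the minus sign is the one in
  \<open>- sgn t * \<phi>\<close>. The ray with \<open>\<tau> = 1\<close> leaves the origin, the one
  with \<open>\<tau> = -1\<close> is traversed towards it, which is why sums over rays carry the
  weight \<open>\<tau>\<close>.\<close>

definition ray_dir :: "real \<Rightarrow> real \<Rightarrow> real \<Rightarrow> complex" where
  "ray_dir \<sigma> \<tau> \<phi> = of_real \<sigma> * cis (- \<tau> * \<phi>)"

text \<open>For angles in \<open>(0, pi / 2)\<close> these are the open double sector and, in
  \<open>cobisector\<close>, the complement of its closure. Inequalities between
  \<open>\<bar>Re z\<bar>\<close> and \<open>\<bar>Im z\<bar>\<close> avoid choosing an argument and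
  are visibly invariant under conjugation and \<open>z \<mapsto> - z\<close>.\<close>

definition bisector :: "real \<Rightarrow> complex set" where
  "bisector \<theta> = {z. cos \<theta> * \<bar>Im z\<bar> < sin \<theta> * \<bar>Re z\<bar>}"

definition cobisector :: "real \<Rightarrow> complex set" where
  "cobisector \<omega> = {z. sin \<omega> * \<bar>Re z\<bar> < cos \<omega> * \<bar>Im z\<bar>}"

lemma norm_ray_dir: "\<sigma> \<in> {1, -1} \<Longrightarrow> cmod (ray_dir \<sigma> \<tau> \<phi>) = 1"
  by (auto simp: ray_dir_def norm_mult)

lemma ray_dir_Re_Im:
  assumes "\<sigma> \<in> {1, -1}" "\<tau> \<in> {1, -1}"
  shows "Re (ray_dir \<sigma> \<tau> \<phi>) = \<sigma> * cos \<phi>" "Im (ray_dir \<sigma> \<tau> \<phi>) = - \<sigma> * \<tau> * sin \<phi>"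
  using assms by (auto simp: ray_dir_def)

lemma ray_abs:
  assumes "\<sigma> \<in> {1, -1}" "\<tau> \<in> {1, -1}" "\<phi> \<in> {0<..<pi/2}" "r \<ge> 0"
  shows "\<bar>Re (of_real r * ray_dir \<sigma> \<tau> \<phi>)\<bar> = r * cos \<phi>" "\<bar>Im (of_real r * ray_dir \<sigma> \<tau> \<phi>)\<bar> = r * sin \<phi>"
proof -
  have "cos \<phi> > 0" "sin \<phi> > 0" using assms(3) by (auto intro: cos_gt_zero sin_gt_zero)
  then show "\<bar>Re (of_real r * ray_dir \<sigma> \<tau> \<phi>)\<bar> = r * cos \<phi>" "\<bar>Im (of_real r * ray_dir \<sigma> \<tau> \<phi>)\<bar> = r * sin \<phi>"
    using assms by (auto simp: ray_dir_Re_Im abs_mult)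
qed

lemma open_bisector: "open (bisector \<theta>)" and open_cobisector: "open (cobisector \<theta>)"
  unfolding bisector_def cobisector_def by (intro open_Collect_less continuous_intros)+

lemma ray_in_bisector:
  assumes "\<sigma> \<in> {1, -1}" "\<tau> \<in> {1, -1}" "\<phi> \<in> {0<..<pi/2}" "r > 0" "\<phi> < \<theta>" "\<theta> < pi / 2"
  shows "of_real r * ray_dir \<sigma> \<tau> \<phi> \<in> bisector \<theta>"
proof -
  have "0 < sin (\<theta> - \<phi>)" using assms by (intro sin_gt_zero) auto
  then have "cos \<theta> * sin \<phi> < sin \<theta> * cos \<phi>" by (simp add: sin_diff)
  then have "r * (cos \<theta> * sin \<phi>) < r * (sin \<theta> * cos \<phi>)" using assms(4) by (rule mult_strict_left_mono)
  then show ?thesis using ray_abs[of \<sigma> \<tau> \<phi> r] assms unfolding bisector_def by (simp add: mult_ac)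
qed

lemma ray_in_cobisector:
  assumes "\<sigma> \<in> {1, -1}" "\<tau> \<in> {1, -1}" "\<phi> \<in> {0<..<pi/2}" "r > 0" "\<omega> < \<phi>" "0 < \<omega>"
  shows "of_real r * ray_dir \<sigma> \<tau> \<phi> \<in> cobisector \<omega>"
proof -
  have "0 < sin (\<phi> - \<omega>)" using assms by (intro sin_gt_zero) auto
  then have "cos \<phi> * sin \<omega> < sin \<phi> * cos \<omega>" by (simp add: sin_diff)
  then have "r * (cos \<phi> * sin \<omega>) < r * (sin \<phi> * cos \<omega>)" using assms(4) by (rule mult_strict_left_mono)
  then show ?thesis using ray_abs[of \<sigma> \<tau> \<phi> r] assms unfolding cobisector_def by (simp add: mult_ac)
qed

text \<open>The linear functional vanishing on the ray of angle \<open>(\<phi> + \<psi>) / 2\<close> separates the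
  two rays.\<close>

lemma ray_distance:
  assumes "\<sigma> \<in> {1, -1}" "\<tau> \<in> {1, -1}" "\<sigma>' \<in> {1, -1}" "\<tau>' \<in> {1, -1}"
    "\<phi> \<in> {0<..<pi/2}" "\<psi> \<in> {0<..<pi/2}" "r \<ge> 0" "s \<ge> 0"
  shows "sin ((\<psi> - \<phi>) / 2) * (r + s) \<le> cmod (of_real r * ray_dir \<sigma> \<tau> \<phi> - of_real s * ray_dir \<sigma>' \<tau>' \<psi>)"
proof -
  define z w where "z = of_real r * ray_dir \<sigma> \<tau> \<phi>" and "w = of_real s * ray_dir \<sigma>' \<tau>' \<psi>"
  define \<mu> where "\<mu> = (\<phi> + \<psi>) / 2"
  define x y where "x = \<bar>Re w\<bar> - \<bar>Re z\<bar>" and "y = \<bar>Im w\<bar> - \<bar>Im z\<bar>"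
  have "cos \<mu> * (s * sin \<psi> - r * sin \<phi>) - sin \<mu> * (s * cos \<psi> - r * cos \<phi>)
      = s * sin (\<psi> - \<mu>) + r * sin (\<mu> - \<phi>)"
    by (simp add: sin_diff algebra_simps)
  also have "\<psi> - \<mu> = (\<psi> - \<phi>) / 2" by (simp add: \<mu>_def field_simps)
  also have "\<mu> - \<phi> = (\<psi> - \<phi>) / 2" by (simp add: \<mu>_def field_simps)
  finally have "sin ((\<psi> - \<phi>) / 2) * (r + s) = cos \<mu> * y - sin \<mu> * x"
    using ray_abs[of \<sigma> \<tau> \<phi> r] ray_abs[of \<sigma>' \<tau>' \<psi> s] assms by (simp add: x_def y_def z_def w_def algebra_simps)
  \<comment> \<open>The second factor has modulus 1, so the real part of the product is bounded by
    the length of \<open>(x, y)\<close>: Cauchy-Schwarz in complex notation.\<close>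
  also have "\<dots> = Re (Complex x y * Complex (- sin \<mu>) (- cos \<mu>))" by simp
  also have "\<dots> \<le> cmod (Complex x y * Complex (- sin \<mu>) (- cos \<mu>))" by (rule complex_Re_le_cmod)
  also have "\<dots> = cmod (Complex x y)" by (simp add: norm_mult cmod_def[of "Complex (- sin \<mu>) _"])
  also have "\<dots> \<le> cmod (w - z)"
  proof -
    have "x\<^sup>2 \<le> (Re (w - z))\<^sup>2" "y\<^sup>2 \<le> (Im (w - z))\<^sup>2"
      unfolding x_def y_def abs_le_square_iff[symmetric] minus_complex.sel by (rule abs_triangle_ineq3)+
    then show ?thesis by (simp add: cmod_def)
  qed
  finally show ?thesis by (simp add: z_def w_def norm_minus_commute)
qed

section \<open>The regulariser and its bounds\<close>

text \<open>The product of \<open>n^2 z^2 / (1 + n^2 z^2)\<close>, which forces decay at 0, and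
  \<open>n^2 / (n^2 + z^2)\<close>, which forces it at infinity. Only squares of \<open>z\<close>
  occur, so the poles are on the imaginary axis, outside every bisector of angle below
  \<open>pi / 2\<close>; \<open>n = Suc k\<close> excludes 0.\<close>

definition regularizer :: "nat \<Rightarrow> complex \<Rightarrow> complex" where
  "regularizer k z = (let n = of_nat (Suc k) in
     n ^ 4 * z ^ 2 / ((n ^ 2 + z ^ 2) * (1 + n ^ 2 * z ^ 2)))"

text \<open>Two complex numbers enclosing an angle of at most \<open>2 \<theta>\<close> satisfy
  \<open>\<bar>u + v\<bar> \<ge> cos \<theta> (\<bar>u\<bar> + \<bar>v\<bar>)\<close>, and
  \<open>z ^ 2\<close> encloses at most that angle with the positive axis. The proof is algebraic:
  the difference of the squares of the two sides is a sum of two terms, the second of which is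
  nonnegative by \<open>le\<close>.\<close>

lemma bisector_norm_square:
  assumes "z \<in> bisector \<theta>" "\<theta> \<in> {0<..<pi/2}" "a \<ge> 0" "b \<ge> 0"
  shows "cos \<theta> * (a + b * (cmod z)\<^sup>2) \<le> cmod (of_real a + of_real b * z ^ 2)"
proof -
  define x y c where "x = (Re z)\<^sup>2" and "y = (Im z)\<^sup>2" and "c = (cos \<theta>)\<^sup>2"
  have cpos: "cos \<theta> > 0" "sin \<theta> > 0" using assms by (auto intro: cos_gt_zero sin_gt_zero)
  have "(cos \<theta> * \<bar>Im z\<bar>)\<^sup>2 \<le> (sin \<theta> * \<bar>Re z\<bar>)\<^sup>2"
    using assms(1) cpos by (intro power_mono) (auto simp: bisector_def)
  then have le: "c * y \<le> (1 - c) * x" by (simp add: x_def y_def c_def power_mult_distrib sin_squared_eq)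
  have c01: "0 \<le> c" "c \<le> 1" by (auto simp: c_def abs_square_le_1)
  have sq: "(cmod z)\<^sup>2 = x + y" by (simp add: x_def y_def cmod_power2)
  have "(cmod (of_real a + of_real b * z ^ 2))\<^sup>2 = (a + b * (x - y))\<^sup>2 + 4 * b\<^sup>2 * x * y"
    unfolding cmod_power2 x_def y_def by (simp add: power2_eq_square algebra_simps)
  also have "\<dots> - c * (a + b * (x + y))\<^sup>2 = (1 - c) * (a - b * (x + y))\<^sup>2 + 4 * a * b * ((1 - c) * x - c * y)"
    by (simp add: power2_eq_square algebra_simps)
  moreover have "\<dots> \<ge> 0" using c01 le assms by (intro add_nonneg_nonneg mult_nonneg_nonneg) auto
  ultimately have "(cos \<theta> * (a + b * (cmod z)\<^sup>2))\<^sup>2 \<le> (cmod (of_real a + of_real b * z ^ 2))\<^sup>2"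
    by (simp add: sq c_def power_mult_distrib)
  then show ?thesis by (rule power2_le_imp_le) simp
qed

context
  fixes \<theta> :: real assumes \<theta>: "\<theta> \<in> {0<..<pi/2}"
begin

lemma cos_theta_pos: "cos \<theta> > 0" using \<theta> by (auto intro: cos_gt_zero)

text \<open>Each factor of the denominator is bounded below by \<open>bisector_norm_square\<close>,
  whence the \<open>(cos \<theta>)\<^sup>2\<close>. The first bound is uniform in \<open>k\<close>
  and serves dominated convergence; the second deteriorates with \<open>k\<close> but gives linear
  decay at 0 and at infinity for each single \<open>k\<close>.\<close>

lemma regularizer_bounds:
  assumes z: "z \<in> bisector \<theta>"
  shows "cmod (regularizer k z) \<le> 1 / (cos \<theta>)\<^sup>2"
    and "cmod (regularizer k z) \<le> real (Suc k) ^ 4 / (cos \<theta>)\<^sup>2 * (cmod z / (1 + (cmod z)\<^sup>2))"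
    and "of_nat (Suc k) ^ 2 + z ^ 2 \<noteq> 0" "1 + of_nat (Suc k) ^ 2 * z ^ 2 \<noteq> 0"
proof -
  define n where "n = real (Suc k)"
  define c where "c = cos \<theta>"
  define m where "m = cmod z"
  have n1: "n \<ge> 1" by (simp add: n_def)
  have m0: "m > 0" using z by (auto simp: m_def bisector_def)
  have c0: "c > 0" using cos_theta_pos by (simp add: c_def)
  have b1: "c * (n\<^sup>2 + m\<^sup>2) \<le> cmod (of_nat (Suc k) ^ 2 + z ^ 2)"
    using bisector_norm_square[OF z \<theta>, of "n\<^sup>2" 1] by (simp add: n_def c_def m_def)
  have b2: "c * (1 + n\<^sup>2 * m\<^sup>2) \<le> cmod (1 + of_nat (Suc k) ^ 2 * z ^ 2)"
    using bisector_norm_square[OF z \<theta>, of 1 "n\<^sup>2"] by (simp add: n_def c_def m_def)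
  have p1: "0 < c * (n\<^sup>2 + m\<^sup>2)" using c0 n1 by (intro mult_pos_pos add_pos_nonneg) auto
  have p2: "0 < c * (1 + n\<^sup>2 * m\<^sup>2)" using c0 by (intro mult_pos_pos add_pos_nonneg) auto
  show "of_nat (Suc k) ^ 2 + z ^ 2 \<noteq> 0" "1 + of_nat (Suc k) ^ 2 * z ^ 2 \<noteq> 0"
    using b1 p1 b2 p2 by auto
  have "cmod (regularizer k z) = n ^ 4 * m\<^sup>2 / (cmod (of_nat (Suc k) ^ 2 + z ^ 2) * cmod (1 + of_nat (Suc k) ^ 2 * z ^ 2))"
    unfolding regularizer_def Let_def norm_divide norm_mult norm_power norm_of_nat n_def m_def by simp
  also have "\<dots> \<le> n ^ 4 * m\<^sup>2 / ((c * (n\<^sup>2 + m\<^sup>2)) * (c * (1 + n\<^sup>2 * m\<^sup>2)))"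
  proof (rule divide_left_mono)
    show D: "(c * (n\<^sup>2 + m\<^sup>2)) * (c * (1 + n\<^sup>2 * m\<^sup>2))
        \<le> cmod (of_nat (Suc k) ^ 2 + z ^ 2) * cmod (1 + of_nat (Suc k) ^ 2 * z ^ 2)"
      by (rule mult_mono[OF b1 b2]) (use p2 in linarith | simp)+
    show "0 < cmod (of_nat (Suc k) ^ 2 + z ^ 2) * cmod (1 + of_nat (Suc k) ^ 2 * z ^ 2) * ((c * (n\<^sup>2 + m\<^sup>2)) * (c * (1 + n\<^sup>2 * m\<^sup>2)))"
      by (rule mult_pos_pos[OF less_le_trans[OF mult_pos_pos[OF p1 p2] D] mult_pos_pos[OF p1 p2]])
    show "0 \<le> n ^ 4 * m\<^sup>2" by (simp add: n_def)
  qed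
  also have "\<dots> = n ^ 4 * m\<^sup>2 / ((n\<^sup>2 + m\<^sup>2) * (1 + n\<^sup>2 * m\<^sup>2)) / c\<^sup>2"
    by (simp add: power2_eq_square)
  finally have main: "cmod (regularizer k z) \<le> n ^ 4 * m\<^sup>2 / ((n\<^sup>2 + m\<^sup>2) * (1 + n\<^sup>2 * m\<^sup>2)) / c\<^sup>2" .
  have "n ^ 4 * m\<^sup>2 = n\<^sup>2 * (n\<^sup>2 * m\<^sup>2)" by (simp add: power2_eq_square power4_eq_xxxx)
  also have "\<dots> \<le> (n\<^sup>2 + m\<^sup>2) * (1 + n\<^sup>2 * m\<^sup>2)" by (intro mult_mono) auto
  finally have "n ^ 4 * m\<^sup>2 / ((n\<^sup>2 + m\<^sup>2) * (1 + n\<^sup>2 * m\<^sup>2)) \<le> 1"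
    by (subst divide_le_eq_1_pos) (use n1 in \<open>auto intro!: mult_pos_pos add_pos_nonneg\<close>)
  then have "n ^ 4 * m\<^sup>2 / ((n\<^sup>2 + m\<^sup>2) * (1 + n\<^sup>2 * m\<^sup>2)) / c\<^sup>2 \<le> 1 / c\<^sup>2"
    by (rule divide_right_mono) simp
  with main show "cmod (regularizer k z) \<le> 1 / (cos \<theta>)\<^sup>2" unfolding c_def by linarith
  have n2: "1 \<le> n\<^sup>2" using n1 by (simp add: one_le_power)
  have "m \<le> 1 + m\<^sup>2" using power2_diff[of m 1] zero_le_power2[of "m - 1"] m0 by simp
  then have "m * (1 + m\<^sup>2) \<le> (1 + m\<^sup>2) * (1 + m\<^sup>2)" by (intro mult_right_mono) auto
  also have "\<dots> \<le> (n\<^sup>2 + m\<^sup>2) * (1 + n\<^sup>2 * m\<^sup>2)"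
    using n2 mult_right_mono[OF n2, of "m\<^sup>2"] by (intro mult_mono) auto
  finally have D: "m * (1 + m\<^sup>2) \<le> (n\<^sup>2 + m\<^sup>2) * (1 + n\<^sup>2 * m\<^sup>2)" .
  have mp: "0 < m * (1 + m\<^sup>2)" using m0 by (intro mult_pos_pos add_pos_nonneg) auto
  have "n ^ 4 * m\<^sup>2 / ((n\<^sup>2 + m\<^sup>2) * (1 + n\<^sup>2 * m\<^sup>2)) \<le> n ^ 4 * m\<^sup>2 / (m * (1 + m\<^sup>2))"
    by (rule divide_left_mono[OF D]) (use mp D in \<open>auto intro!: mult_pos_pos less_le_trans[OF mp]\<close>)
  also have "\<dots> = n ^ 4 * (m / (1 + m\<^sup>2))" using m0 by (simp add: power2_eq_square)
  finally have "n ^ 4 * m\<^sup>2 / ((n\<^sup>2 + m\<^sup>2) * (1 + n\<^sup>2 * m\<^sup>2)) \<le> n ^ 4 * (m / (1 + m\<^sup>2))" .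
  then have "n ^ 4 * m\<^sup>2 / ((n\<^sup>2 + m\<^sup>2) * (1 + n\<^sup>2 * m\<^sup>2)) / c\<^sup>2 \<le> n ^ 4 * (m / (1 + m\<^sup>2)) / c\<^sup>2"
    by (rule divide_right_mono) simp
  with main show "cmod (regularizer k z) \<le> real (Suc k) ^ 4 / (cos \<theta>)\<^sup>2 * (cmod z / (1 + (cmod z)\<^sup>2))"
    unfolding c_def n_def m_def by (simp add: mult.commute)
qed

lemma regularizer_holomorphic: "regularizer k holomorphic_on bisector \<theta>"
  unfolding regularizer_def Let_def using regularizer_bounds(3,4)
  by (intro holomorphic_intros) auto

end

lemma regularizer_tendsto:
  assumes "z \<noteq> 0" shows "(\<lambda>k. regularizer k z) \<longlonglongrightarrow> 1"
proof -
  let ?u = "\<lambda>k. inverse (of_nat (Suc k)) :: complex"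
  have u: "?u \<longlonglongrightarrow> 0" using tendsto_of_real[OF LIMSEQ_inverse_real_of_nat, where 'a=complex] by simp
  \<comment> \<open>Cancelling \<open>n ^ 4\<close> leaves an expression in \<open>1 / n\<close>
    that is continuous at 0, with value \<open>z\<^sup>2 / z\<^sup>2\<close> there.\<close>
  have "regularizer k z = z\<^sup>2 / ((1 + z\<^sup>2 * (?u k)\<^sup>2) * ((?u k)\<^sup>2 + z\<^sup>2))" for k
  proof -
    define n where "n = (of_nat (Suc k) :: complex)"
    have n: "n \<noteq> 0" unfolding n_def by (metis of_nat_eq_0_iff nat.distinct(1))
    have i: "n\<^sup>2 * (inverse n)\<^sup>2 = 1" using n by (simp flip: power_mult_distrib)
    have "n\<^sup>2 * (1 + z\<^sup>2 * (inverse n)\<^sup>2) = n\<^sup>2 + z\<^sup>2 * (n\<^sup>2 * (inverse n)\<^sup>2)"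
      "n\<^sup>2 * ((inverse n)\<^sup>2 + z\<^sup>2) = n\<^sup>2 * (inverse n)\<^sup>2 + n\<^sup>2 * z\<^sup>2" by (simp_all add: distrib_left mult_ac)
    note ab = this
    have m4: "n ^ 4 * (A * B) = (n\<^sup>2 * A) * (n\<^sup>2 * B)" for A B :: complex
      by (simp add: power2_eq_square power4_eq_xxxx)
    have "n ^ 4 * ((1 + z\<^sup>2 * (inverse n)\<^sup>2) * ((inverse n)\<^sup>2 + z\<^sup>2)) = (n\<^sup>2 + z\<^sup>2) * (1 + n\<^sup>2 * z\<^sup>2)"
      unfolding m4 ab i by simp
    then have "n ^ 4 * z\<^sup>2 / ((n\<^sup>2 + z\<^sup>2) * (1 + n\<^sup>2 * z\<^sup>2)) =
        n ^ 4 * z\<^sup>2 / (n ^ 4 * ((1 + z\<^sup>2 * (inverse n)\<^sup>2) * ((inverse n)\<^sup>2 + z\<^sup>2)))" by simp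
    then show ?thesis using n unfolding regularizer_def Let_def n_def[symmetric] by simp
  qed
  moreover have "(\<lambda>k. z\<^sup>2 / ((1 + z\<^sup>2 * (?u k)\<^sup>2) * ((?u k)\<^sup>2 + z\<^sup>2))) \<longlonglongrightarrow> z\<^sup>2 / ((1 + z\<^sup>2 * 0\<^sup>2) * (0\<^sup>2 + z\<^sup>2))"
    using assms by (intro tendsto_intros u) auto
  ultimately show ?thesis using assms by simp
qed

lemma integrable_inverse_one_plus_square: "(\<lambda>s::real. 1 / (1 + s\<^sup>2)) integrable_on {0<..}"
proof -
  have "(\<integral>\<^sup>+x. ennreal (1 / (1 + x\<^sup>2)) * indicator {0 ..} x \<partial>lborel) = pi / 2 - arctan 0"
    by (rule nn_integral_FTC_atLeast)
       (auto intro!: derivative_eq_intros tendsto_arctan_at_top simp: field_simps)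
  then have "(\<lambda>x::real. 1 / (1 + x\<^sup>2) * indicator {0 ..} x) integrable_on UNIV"
    by (intro nn_integral_integrable_on)
       (auto simp flip: ennreal_mult' ennreal_indicator simp: ennreal_mult' less_top[symmetric])
  then have "(\<lambda>x::real. 1 / (1 + x\<^sup>2)) integrable_on {0..}"
    by (subst Henstock_Kurzweil_Integration.integrable_restrict_UNIV[symmetric])
       (simp add: indicator_def of_bool_def if_distrib[of "\<lambda>c. c / _"] cong: if_cong)
  then show ?thesis
    by (rule integrable_spike_set) (rule negligible_subset[of "{0::real}"]; auto)+
qed

section \<open>Cauchy's theorem and integral formula on sectors\<close>

definition right_sector :: "real \<Rightarrow> complex set" where
  "right_sector \<theta> = {z. cos \<theta> * \<bar>Im z\<bar> < sin \<theta> * Re z}"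

definition closed_right_sector :: "real \<Rightarrow> complex set" where
  "closed_right_sector \<theta> = {z. cos \<theta> * \<bar>Im z\<bar> \<le> sin \<theta> * Re z}"

lemma integral_halfline_segment_tendsto:
  fixes g :: "real \<Rightarrow> complex"
  assumes "\<And>n. g integrable_on {0..R n}" and dom: "\<And>s. s > 0 \<Longrightarrow> norm (g s) \<le> b s"
    and b: "b integrable_on {0<..}" and R: "filterlim R at_top sequentially"
  shows "(\<lambda>n. integral {0..R n} g) \<longlonglongrightarrow> integral {0<..} g"
proof -
  let ?f = "\<lambda>n s. if s \<in> {0<..R n} then g s else 0"
  have spike: "integral {0<..R n} g = integral {0..R n} g" "g integrable_on {0<..R n}" for n
  proof -
    have neg: "negligible ({0..R n} - {0<..R n} \<union> ({0<..R n} - {0..R n}))"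
      by (rule negligible_subset[of "{0}"]) auto
    show "integral {0<..R n} g = integral {0..R n} g"
      by (rule integral_spike_set) (rule negligible_subset[OF neg]; auto)+
    show "g integrable_on {0<..R n}"
      by (rule integrable_spike_set[OF assms(1)]) (rule negligible_subset[OF neg]; auto)+
  qed
  have "(\<lambda>n. integral {0<..} (?f n)) \<longlonglongrightarrow> integral {0<..} g"
  proof (rule dominated_convergence(2)[OF _ b])
    have "{0<..R n} \<inter> {0<..} = {0<..R n}" for n by auto
    then show "?f n integrable_on {0<..}" for n
      unfolding Henstock_Kurzweil_Integration.integrable_restrict_Int by (simp add: spike)
    show "norm (?f n s) \<le> b s" if "s \<in> {0<..}" for n s
      using dom[of s] norm_ge_zero[of "g s"] that by (auto simp del: norm_ge_zero)
    show "(\<lambda>n. ?f n s) \<longlonglongrightarrow> g s" if "s \<in> {0<..}" for s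
    proof (rule tendsto_eventually)
      have "\<forall>\<^sub>F n in sequentially. s \<le> R n" using R unfolding filterlim_at_top by blast
      then show "\<forall>\<^sub>F n in sequentially. ?f n s = g s" by (rule eventually_mono) (use that in auto)
    qed
  qed
  moreover have "integral {0<..} (?f n) = integral {0..R n} g" for n
  proof -
    have "{0<..R n} \<inter> {0<..} = {0<..R n}" by auto
    then show ?thesis unfolding Henstock_Kurzweil_Integration.integral_restrict_Int by (simp add: spike)
  qed
  ultimately show ?thesis by simp
qed

lemma has_contour_integral_ray:
  assumes "(G has_contour_integral X) (linepath 0 (of_real R * a))" "R > 0"
  shows "((\<lambda>s. G (of_real s * a) * a) has_integral X) {0..R}"
proof -
  have "((\<lambda>x. G (linepath 0 (of_real R * a) x) * (of_real R * a)) has_integral X) {0..1}"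
    using assms(1) by (simp add: has_contour_integral_linepath)
  from has_integral_stretch_real[OF this, of "1 / R"] assms(2)
  have "((\<lambda>x. G (linepath 0 (of_real R * a) (x / R)) * (of_real R * a)) has_integral R *\<^sub>R X) {0..R}"
    by (simp add: image_mult_atLeastAtMost mult.commute[of _ R])
  from has_integral_cmul[OF this, of "1 / R"] assms(2) show ?thesis
    by (simp add: linepath_def scaleR_conv_of_real mult_ac)
qed

text \<open>The contour is the triangle with vertices 0, \<open>R e^(-i \<psi>)\<close> and
  \<open>R e^(i \<psi>)\<close>. The chord has length at most \<open>2 R\<close> and distance
  \<open>R cos \<psi>\<close> from 0, so quadratic decay of \<open>G\<close> makes its contribution
  of order \<open>1 / R\<close>, while the other two sides become the ray integrals. A chord instead
  of an arc keeps the contour made of line segments inside a convex set.\<close>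

lemma sector_contour_limit:
  fixes G :: "complex \<Rightarrow> complex"
  assumes \<psi>: "\<psi> \<in> {0<..<pi/2}"
    and dom: "\<And>s a. s > 0 \<Longrightarrow> a \<in> {cis (- \<psi>), cis \<psi>} \<Longrightarrow> cmod (G (of_real s * a)) \<le> b s"
    and b: "b integrable_on {0<..}"
    and R0: "R0 \<ge> 1" and M: "M \<ge> 0"
    and cont: "\<And>R. R * cos \<psi> \<ge> R0 \<Longrightarrow> continuous_on (path_image (linepath 0 (of_real R * cis (- \<psi>)) +++
        linepath (of_real R * cis (- \<psi>)) (of_real R * cis \<psi>) +++ linepath (of_real R * cis \<psi>) 0)) G"
    and cint: "\<And>R. R * cos \<psi> \<ge> R0 \<Longrightarrow> (G has_contour_integral I) (linepath 0 (of_real R * cis (- \<psi>)) +++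
        linepath (of_real R * cis (- \<psi>)) (of_real R * cis \<psi>) +++ linepath (of_real R * cis \<psi>) 0)"
    and decay: "\<And>w. w \<in> closed_right_sector \<psi> \<Longrightarrow> cmod w \<ge> R0 \<Longrightarrow> cmod (G w) \<le> M / (cmod w)\<^sup>2"
  shows "integral {0<..} (\<lambda>s. G (of_real s * cis (- \<psi>)) * cis (- \<psi>))
    - integral {0<..} (\<lambda>s. G (of_real s * cis \<psi>) * cis \<psi>) = I"
proof -
  have c0: "cos \<psi> > 0" "sin \<psi> > 0" using \<psi> by (auto intro: cos_gt_zero sin_gt_zero)
  \<comment> \<open>The chord is placed on the line \<open>Re w = R0 + n\<close>.\<close>
  define R where "R n = (R0 + real n) / cos \<psi>" for n
  have Rc: "R n * cos \<psi> = R0 + real n" for n using c0 by (simp add: R_def)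
  have Rge: "R n * cos \<psi> \<ge> R0" for n by (simp add: Rc)
  have Rpos: "R n > 0" for n using c0 R0 by (auto simp: R_def intro!: divide_pos_pos)
  have "filterlim (\<lambda>n. R0 + real n) at_top sequentially"
    by (intro filterlim_tendsto_add_at_top[OF tendsto_const] filterlim_real_sequentially)
  then have Rlim: "filterlim R at_top sequentially"
    using c0 filterlim_at_top_mult_tendsto_pos[OF tendsto_const, of "1 / cos \<psi>"] by (simp add: R_def[abs_def])
  define a where "a = cis (- \<psi>)"
  define d where "d = cis \<psi>"
  define X where "X n = contour_integral (linepath 0 (of_real (R n) * a)) G" for n
  define Y where "Y n = contour_integral (linepath (of_real (R n) * a) (of_real (R n) * d)) G" for n
  define Z where "Z n = contour_integral (linepath 0 (of_real (R n) * d)) G" for n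
  have co: "continuous_on (closed_segment 0 (of_real (R n) * a)) G"
    "continuous_on (closed_segment (of_real (R n) * a) (of_real (R n) * d)) G"
    "continuous_on (closed_segment (of_real (R n) * d) 0) G" for n
    by (rule continuous_on_subset[OF cont[OF Rge[of n]]]; auto simp: path_image_join a_def d_def)+
  note ci = contour_integrable_continuous_linepath
  have co3: "continuous_on (closed_segment 0 (of_real (R n) * d)) G" for n
    using co(3)[of n] by (simp add: closed_segment_commute)
  have hX: "(G has_contour_integral X n) (linepath 0 (of_real (R n) * a))" for n
    unfolding X_def by (rule has_contour_integral_integral[OF ci[OF co(1)]])
  have hY: "(G has_contour_integral Y n) (linepath (of_real (R n) * a) (of_real (R n) * d))" for n
    unfolding Y_def by (rule has_contour_integral_integral[OF ci[OF co(2)]])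
  have hZ: "(G has_contour_integral Z n) (linepath 0 (of_real (R n) * d))" for n
    unfolding Z_def by (rule has_contour_integral_integral[OF ci[OF co3]])
  have I: "I = X n + (Y n - Z n)" for n
  proof -
    have "(G has_contour_integral - Z n) (linepath (of_real (R n) * d) 0)"
      using has_contour_integral_reversepath[OF _ hZ[of n]] by simp
    then have "(G has_contour_integral (X n + (Y n + - Z n))) (linepath 0 (of_real (R n) * a) +++
        linepath (of_real (R n) * a) (of_real (R n) * d) +++ linepath (of_real (R n) * d) 0)"
      by (intro has_contour_integral_join hX hY) auto
    then show ?thesis using cint[OF Rge[of n]] unfolding a_def d_def by (simp add: has_contour_integral_unique)
  qed
  have Xi: "((\<lambda>s. G (of_real s * a) * a) has_integral X n) {0..R n}" for n
    by (rule has_contour_integral_ray[OF hX Rpos])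
  have Zi: "((\<lambda>s. G (of_real s * d) * d) has_integral Z n) {0..R n}" for n
    by (rule has_contour_integral_ray[OF hZ Rpos])
  have "(\<lambda>n. integral {0..R n} (\<lambda>s. G (of_real s * a) * a)) \<longlonglongrightarrow> integral {0<..} (\<lambda>s. G (of_real s * a) * a)"
    by (rule integral_halfline_segment_tendsto[OF _ _ b Rlim])
       (use has_integral_integrable[OF Xi] dom[of _ a] in \<open>auto simp: norm_mult a_def simp del: integrable_on_mult_left_iff\<close>)
  then have X: "X \<longlonglongrightarrow> integral {0<..} (\<lambda>s. G (of_real s * a) * a)"
    using integral_unique[OF Xi] by simp
  have "(\<lambda>n. integral {0..R n} (\<lambda>s. G (of_real s * d) * d)) \<longlonglongrightarrow> integral {0<..} (\<lambda>s. G (of_real s * d) * d)"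
    by (rule integral_halfline_segment_tendsto[OF _ _ b Rlim])
       (use has_integral_integrable[OF Zi] dom[of _ d] in \<open>auto simp: norm_mult d_def simp del: integrable_on_mult_left_iff\<close>)
  then have Z: "Z \<longlonglongrightarrow> integral {0<..} (\<lambda>s. G (of_real s * d) * d)"
    using integral_unique[OF Zi] by simp
  have Ybound: "cmod (Y n) \<le> 2 * M / cos \<psi> * (1 / (R0 + real n))" for n
  proof -
    have seg: "w \<in> closed_right_sector \<psi> \<and> R0 + real n \<le> cmod w"
      if w: "w \<in> closed_segment (of_real (R n) * a) (of_real (R n) * d)" for w
    proof -
      obtain u where u: "0 \<le> u" "u \<le> 1" "w = (1 - u) *\<^sub>R (of_real (R n) * a) + u *\<^sub>R (of_real (R n) * d)"
        using w by (auto simp: closed_segment_def)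
      have Re: "Re w = R n * cos \<psi>" by (simp add: u a_def d_def algebra_simps)
      have "Im w = (2 * u - 1) * (R n * sin \<psi>)" by (simp add: u a_def d_def algebra_simps)
      then have "\<bar>Im w\<bar> = \<bar>2 * u - 1\<bar> * (R n * sin \<psi>)" using Rpos[of n] c0 by (simp add: abs_mult)
      also have "\<dots> \<le> 1 * (R n * sin \<psi>)" using u Rpos[of n] c0 by (intro mult_right_mono) auto
      finally have "cos \<psi> * \<bar>Im w\<bar> \<le> cos \<psi> * (R n * sin \<psi>)" using c0 by (intro mult_left_mono) auto
      then have "w \<in> closed_right_sector \<psi>" using Re by (simp add: closed_right_sector_def mult_ac)
      moreover have "R0 + real n \<le> cmod w" using complex_Re_le_cmod[of w] Re Rc[of n] by simp
      ultimately show ?thesis by simp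
    qed
    have "cmod (Y n) \<le> M / (R0 + real n)\<^sup>2 * cmod (of_real (R n) * d - of_real (R n) * a)"
    proof (rule has_contour_integral_bound_linepath[OF hY])
      show "0 \<le> M / (R0 + real n)\<^sup>2" using M by simp
      fix w assume "w \<in> closed_segment (of_real (R n) * a) (of_real (R n) * d)"
      then have w: "w \<in> closed_right_sector \<psi>" "R0 + real n \<le> cmod w" using seg by auto
      have "cmod (G w) \<le> M / (cmod w)\<^sup>2" using decay[OF w(1)] w(2) by simp
      also have "\<dots> \<le> M / (R0 + real n)\<^sup>2"
        using w(2) R0 M by (intro divide_left_mono power_mono mult_pos_pos zero_less_power) auto
      finally show "cmod (G w) \<le> M / (R0 + real n)\<^sup>2" .
    qed
    also have "\<dots> \<le> M / (R0 + real n)\<^sup>2 * (2 * R n)"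
      using norm_triangle_ineq4[of "of_real (R n) * d" "of_real (R n) * a"] Rpos[of n] M
      by (intro mult_left_mono) (auto simp: norm_mult a_def d_def)
    also have "M / (R0 + real n)\<^sup>2 * (2 * R n) = 2 * M / cos \<psi> * (1 / (R0 + real n))"
    proof -
      have "M / p\<^sup>2 * (2 * (p / cos \<psi>)) = 2 * M / cos \<psi> * (1 / p)" for p by (simp add: power2_eq_square mult.commute)
      then show ?thesis unfolding R_def .
    qed
    finally show ?thesis .
  qed
  have "filterlim (\<lambda>n. R0 + real n) at_top sequentially"
    by (intro filterlim_tendsto_add_at_top[OF tendsto_const] filterlim_real_sequentially)
  then have "(\<lambda>n. 2 * M / cos \<psi> * (1 / (R0 + real n))) \<longlonglongrightarrow> 2 * M / cos \<psi> * 0"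
    by (intro tendsto_intros tendsto_divide_0[OF tendsto_const] filterlim_at_top_imp_at_infinity)
  then have Y: "Y \<longlonglongrightarrow> 0"
    by (intro Lim_null_comparison[OF always_eventually[OF allI[OF Ybound]]]) simp
  have "(\<lambda>n. X n + (Y n - Z n)) \<longlonglongrightarrow> integral {0<..} (\<lambda>s. G (of_real s * a) * a) + (0 - integral {0<..} (\<lambda>s. G (of_real s * d) * d))"
    by (intro tendsto_intros X Y Z)
  then have "(\<lambda>n. I) \<longlonglongrightarrow> integral {0<..} (\<lambda>s. G (of_real s * a) * a) - integral {0<..} (\<lambda>s. G (of_real s * d) * d)"
    using I by simp
  from LIMSEQ_unique[OF this tendsto_const] show ?thesis by (simp add: a_def d_def)
qed

lemma closed_right_sector_subset:
  assumes "0 < \<psi>" "\<psi> < \<theta>" "\<theta> < pi / 2" "z \<in> closed_right_sector \<psi>" "z \<noteq> 0"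
  shows "z \<in> right_sector \<theta>"
proof -
  have c: "cos \<psi> > 0" "sin \<psi> > 0" "cos \<theta> > 0" using assms by (auto intro: cos_gt_zero sin_gt_zero)
  have le: "cos \<psi> * \<bar>Im z\<bar> \<le> sin \<psi> * Re z" using assms by (simp add: closed_right_sector_def)
  then have "0 \<le> sin \<psi> * Re z" using c by (meson abs_ge_zero less_imp_le mult_nonneg_nonneg order_trans)
  then have "0 \<le> Re z" using c by (simp add: zero_le_mult_iff)
  moreover have "Re z \<noteq> 0"
  proof
    assume "Re z = 0"
    moreover from this have "Im z = 0" using le c by (simp add: mult_le_0_iff)
    ultimately show False using assms(5) by (simp add: complex_eq_iff)
  qed
  ultimately have pos: "0 < Re z" by simp
  have "0 < sin (\<theta> - \<psi>)" using assms by (intro sin_gt_zero) auto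
  then have s: "cos \<theta> * sin \<psi> < sin \<theta> * cos \<psi>" by (simp add: sin_diff)
  have "cos \<psi> * (cos \<theta> * \<bar>Im z\<bar>) \<le> cos \<theta> * sin \<psi> * Re z"
    using mult_left_mono[OF le, of "cos \<theta>"] c by (simp add: mult_ac)
  also have "\<dots> < sin \<theta> * cos \<psi> * Re z" using s pos by (rule mult_strict_right_mono)
  finally have "cos \<psi> * (cos \<theta> * \<bar>Im z\<bar>) < cos \<psi> * (sin \<theta> * Re z)" by (simp add: mult_ac)
  then show ?thesis using c by (simp add: right_sector_def)
qed

lemma closed_right_sector_props:
  "closed (closed_right_sector \<psi>)"
  "0 < \<psi> \<Longrightarrow> \<psi> < pi / 2 \<Longrightarrow> convex (closed_right_sector \<psi>)"
proof -
  show "closed (closed_right_sector \<psi>)"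
    unfolding closed_right_sector_def by (intro closed_Collect_le continuous_intros)
  assume "0 < \<psi>" "\<psi> < pi / 2"
  then have c: "cos \<psi> > 0" by (auto intro: cos_gt_zero)
  show "convex (closed_right_sector \<psi>)"
    unfolding convex_def closed_right_sector_def
  proof (clarsimp)
    fix x y :: complex and u v :: real
    assume xy: "cos \<psi> * \<bar>Im x\<bar> \<le> sin \<psi> * Re x" "cos \<psi> * \<bar>Im y\<bar> \<le> sin \<psi> * Re y"
      and uv: "0 \<le> u" "0 \<le> v"
    have "cos \<psi> * \<bar>u * Im x + v * Im y\<bar> \<le> cos \<psi> * (u * \<bar>Im x\<bar> + v * \<bar>Im y\<bar>)"
      using c uv abs_triangle_ineq[of "u * Im x" "v * Im y"] by (intro mult_left_mono) (auto simp: abs_mult)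
    also have "\<dots> = u * (cos \<psi> * \<bar>Im x\<bar>) + v * (cos \<psi> * \<bar>Im y\<bar>)" by (simp add: algebra_simps)
    also have "\<dots> \<le> u * (sin \<psi> * Re x) + v * (sin \<psi> * Re y)"
      using xy uv by (intro add_mono mult_left_mono) auto
    finally show "cos \<psi> * \<bar>u * Im x + v * Im y\<bar> \<le> sin \<psi> * (u * Re x + v * Re y)"
      by (simp add: algebra_simps)
  qed
qed

lemma sector_triangle:
  assumes \<psi>: "0 < \<psi>" "\<psi> < pi / 2" and z: "z \<in> right_sector \<psi>" and R: "R > 0" "Re z < R * cos \<psi>"
  shows "z \<in> interior (convex hull {0, of_real R * cis (- \<psi>), of_real R * cis \<psi>})"
    and "winding_number (linepath 0 (of_real R * cis (- \<psi>)) +++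
        linepath (of_real R * cis (- \<psi>)) (of_real R * cis \<psi>) +++ linepath (of_real R * cis \<psi>) 0) z = 1"
proof -
  have c: "cos \<psi> > 0" "sin \<psi> > 0" using \<psi> by (auto intro: cos_gt_zero sin_gt_zero)
  let ?U = "{w. cos \<psi> * \<bar>Im w\<bar> < sin \<psi> * Re w \<and> Re w < R * cos \<psi>}"
  have "open ?U" by (intro open_Collect_conj open_Collect_less continuous_intros)
  moreover have "?U \<subseteq> convex hull {0, of_real R * cis (- \<psi>), of_real R * cis \<psi>}"
  proof
    fix w assume w: "w \<in> ?U"
    \<comment> \<open>The three vertices carry the barycentric weights \<open>1 - p\<close>,
      \<open>(p - q) / 2\<close> and \<open>(p + q) / 2\<close>.\<close>
    define p q where "p = Re w / (R * cos \<psi>)" and "q = Im w / (R * sin \<psi>)"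
    have "\<bar>q\<bar> \<le> p" using w c R by (auto simp: p_def q_def abs_mult abs_divide divide_simps mult_ac)
    moreover have "p \<le> 1" using w c R by (simp add: p_def divide_le_eq)
    moreover have "w = (1 - p) *\<^sub>R 0 + ((p - q) / 2) *\<^sub>R (of_real R * cis (- \<psi>)) + ((p + q) / 2) *\<^sub>R (of_real R * cis \<psi>)"
      using c R by (simp add: complex_eq_iff p_def q_def field_simps)
    moreover have "(1 - p) + (p - q) / 2 + (p + q) / 2 = 1" by (simp add: field_simps)
    ultimately show "w \<in> convex hull {0, of_real R * cis (- \<psi>), of_real R * cis \<psi>}"
      unfolding convex_hull_3 by (intro CollectI exI[of _ "1 - p"] exI[of _ "(p - q) / 2"] exI[of _ "(p + q) / 2"]) auto
  qed
  ultimately have "?U \<subseteq> interior (convex hull {0, of_real R * cis (- \<psi>), of_real R * cis \<psi>})"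
    by (rule interior_maximal[rotated])
  then show int: "z \<in> interior (convex hull {0, of_real R * cis (- \<psi>), of_real R * cis \<psi>})"
    using z R by (auto simp: right_sector_def)
  have "cos \<psi> * - Im z \<le> cos \<psi> * \<bar>Im z\<bar>" using c by (intro mult_left_mono) auto
  then have "0 < sin \<psi> * Re z + cos \<psi> * Im z" using z by (simp add: right_sector_def)
  then have "0 < R * (sin \<psi> * Re z + cos \<psi> * Im z)" using R by simp
  \<comment> \<open>Positivity of this imaginary part is the criterion for counterclockwise
    orientation, hence for winding number 1 and not -1.\<close>
  then have "0 < Im ((of_real R * cis (- \<psi>) - 0) * cnj (of_real R * cis (- \<psi>) - z))"
    by (simp add: algebra_simps)
  then show "winding_number (linepath 0 (of_real R * cis (- \<psi>)) +++
        linepath (of_real R * cis (- \<psi>)) (of_real R * cis \<psi>) +++ linepath (of_real R * cis \<psi>) 0) z = 1"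
    using winding_number_triangle[OF int] by simp
qed

text \<open>\<open>h\<close> is only given on the open sector, and the vertex 0 lies on the contour.
  The decay bound allows a continuous extension by 0, and Cauchy's theorem and formula tolerate a
  single point of non-differentiability. \<open>dist\<close> keeps the rays away from
  \<open>z\<close> proportionally to \<open>s\<close>, so that the integrand is dominated by a
  multiple of \<open>1 / (1 + s\<^sup>2)\<close>.\<close>

lemma sector_Cauchy:
  fixes h :: "complex \<Rightarrow> complex"
  assumes \<psi>: "0 < \<psi>" "\<psi> < \<theta>" "\<theta> < pi / 2"
    and hol: "h holomorphic_on right_sector \<theta>" and C: "C \<ge> 0"
    and bound: "\<And>w. w \<in> right_sector \<theta> \<Longrightarrow> cmod (h w) \<le> C * (cmod w / (1 + (cmod w)\<^sup>2))"
    and dist: "c > 0" "\<And>s a. s > 0 \<Longrightarrow> a \<in> {cis (- \<psi>), cis \<psi>} \<Longrightarrow> c * s \<le> cmod (of_real s * a - z)"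
    and z: "z \<in> right_sector \<psi> \<or> z \<notin> closed_right_sector \<psi>"
  shows "integral {0<..} (\<lambda>s. h (of_real s * cis (- \<psi>)) / (of_real s * cis (- \<psi>) - z) * cis (- \<psi>))
    - integral {0<..} (\<lambda>s. h (of_real s * cis \<psi>) / (of_real s * cis \<psi> - z) * cis \<psi>)
    = (if z \<in> right_sector \<psi> then 2 * pi * \<i> * h z else 0)"
proof -
  have c0: "cos \<psi> > 0" "sin \<psi> > 0" using \<psi> by (auto intro: cos_gt_zero sin_gt_zero)
  define S where "S = closed_right_sector \<psi>"
  define F where "F w = (if w = 0 then 0 else h w)" for w
  define G where "G w = F w / (w - z)" for w
  have Sr: "w \<in> right_sector \<theta>" if "w \<in> S" "w \<noteq> 0" for w
    using closed_right_sector_subset[OF \<psi>] that unfolding S_def by blast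
  have oR: "open (right_sector \<theta>)" unfolding right_sector_def by (intro open_Collect_less continuous_intros)
  have fd: "F field_differentiable at w" if "w \<in> S" "w \<noteq> 0" for w
  proof -
    have "h field_differentiable at w"
      using hol oR Sr[OF that] holomorphic_on_imp_differentiable_at by blast
    then obtain D where "(h has_field_derivative D) (at w)" by (auto simp: field_differentiable_def)
    then have "(F has_field_derivative D) (at w)"
      by (rule has_field_derivative_transform_within_open[of _ _ _ "- {0}"]) (use that in \<open>auto simp: F_def\<close>)
    then show ?thesis by (auto simp: field_differentiable_def)
  qed
  have Fb: "cmod (F w) \<le> C * (cmod w / (1 + (cmod w)\<^sup>2))" if "w \<in> S" for w
    using bound[OF Sr[OF that]] by (auto simp: F_def)
  have le1: "cmod w / (1 + (cmod w)\<^sup>2) \<le> cmod w" for w :: complex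
    by (simp add: divide_le_eq mult_left_mono add_pos_nonneg mult_le_cancel_left1)
  have Fcont: "continuous_on S F"
    unfolding continuous_on_eq_continuous_within
  proof
    fix w assume w: "w \<in> S"
    show "continuous (at w within S) F"
    proof (cases "w = 0")
      case False
      then show ?thesis using fd[OF w] by (simp add: continuous_at_imp_continuous_at_within field_differentiable_imp_continuous_at)
    next
      case True
      have "((\<lambda>w. C * cmod w) \<longlongrightarrow> C * cmod 0) (at 0 within S)" by (intro tendsto_intros)
      then have "((\<lambda>w. C * cmod w) \<longlongrightarrow> 0) (at 0 within S)" by simp
      then have "(F \<longlongrightarrow> 0) (at 0 within S)"
      proof (rule Lim_null_comparison[rotated])
        show "\<forall>\<^sub>F w in at 0 within S. cmod (F w) \<le> C * cmod w"
          unfolding eventually_at_filter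
          by (rule always_eventually) (use Fb le1 C mult_left_mono order_trans in blast)
      qed
      then show ?thesis by (simp add: True continuous_within F_def)
    qed
  qed
  have conv: "convex S" unfolding S_def using closed_right_sector_props(2) \<psi> by simp
  have rs: "right_sector \<psi> \<subseteq> interior S"
    unfolding S_def by (rule interior_maximal)
      (auto simp: right_sector_def closed_right_sector_def intro!: open_Collect_less continuous_intros)
  have z0: "z \<noteq> 0" using dist(2)[of 1 "cis \<psi>"] z c0
    by (auto simp: right_sector_def closed_right_sector_def)
  \<comment> \<open>Beyond this radius \<open>z\<close> lies to the left of the chord and
    \<open>cmod (w - z) \<ge> cmod w / 2\<close>; the latter produces the factor 2 in
    \<open>M = 2 * C\<close>.\<close>
  define R0 where "R0 = max 1 (2 * cmod z + 1)"
  define path where "path R = linepath 0 (of_real R * cis (- \<psi>)) +++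
        linepath (of_real R * cis (- \<psi>)) (of_real R * cis \<psi>) +++ linepath (of_real R * cis \<psi>) 0" for R :: real
  have vp: "valid_path (path R)" "pathfinish (path R) = pathstart (path R)" for R
    by (simp_all add: path_def)
  have pS: "path_image (path R) \<subseteq> S" if "R > 0" for R
  proof -
    have pts: "0 \<in> S" "of_real R * cis (- \<psi>) \<in> S" "of_real R * cis \<psi> \<in> S"
      using that c0 by (auto simp: S_def closed_right_sector_def abs_mult)
    then show ?thesis using conv unfolding convex_contains_segment path_def by (simp add: path_image_join)
  qed
  have pz: "z \<notin> path_image (path R)" if "R > 0" "R * cos \<psi> \<ge> R0" for R
  proof
    assume p: "z \<in> path_image (path R)"
    then have "z \<in> right_sector \<psi>" using pS[OF that(1)] z unfolding S_def by blast
    moreover have "Re z < R * cos \<psi>"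
      using that(2) complex_Re_le_cmod[of z] norm_ge_zero[of z] unfolding R0_def by linarith
    ultimately have "z \<in> interior (convex hull {0, of_real R * cis (- \<psi>), of_real R * cis \<psi>})"
      using sector_triangle(1) \<psi> that(1) by simp
    then show False using p unfolding path_def
      by (simp add: path_image_join interior_of_triangle closed_segment_commute)
  qed
  have Gcont: "continuous_on (S - {z}) G"
    unfolding G_def by (intro continuous_intros continuous_on_subset[OF Fcont]) auto
  define I where "I = (if z \<in> right_sector \<psi> then 2 * pi * \<i> * h z else 0)"
  have cint: "(G has_contour_integral I) (path R)" if R: "R > 0" "R * cos \<psi> \<ge> R0" for R
  proof (cases "z \<in> right_sector \<psi>")
    case True
    have "Re z < R * cos \<psi>"
      using that(2) complex_Re_le_cmod[of z] norm_ge_zero[of z] unfolding R0_def by linarith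
    then have wn: "winding_number (path R) z = 1"
      unfolding path_def using sector_triangle(2) True \<psi> R by simp
    have "((\<lambda>w. F w / (w - z)) has_contour_integral (2 * pi * \<i> * winding_number (path R) z * F z)) (path R)"
      by (rule Cauchy_integral_formula_weak[OF conv, of "{0}"])
         (use Fcont fd rs True z0 vp pS[OF R(1)] pz[OF R] interior_subset[of S] in auto)
    then show ?thesis using True z0 wn by (simp add: G_def[abs_def] I_def F_def)
  next
    case False
    then have zS: "z \<notin> S" using z by (simp add: S_def)
    have "(G has_contour_integral 0) (path R)"
    proof (rule Cauchy_theorem_convex[of S G "{0}"])
      show "continuous_on S G" using Gcont zS by simp
      show "G field_differentiable at x" if "x \<in> interior S - {0}" for x
        unfolding G_def[abs_def] using that interior_subset[of S] zS
        by (intro field_differentiable_divide field_differentiable_diff fd field_differentiable_ident field_differentiable_const) auto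
    qed (use conv vp pS[OF R(1)] in auto)
    then show ?thesis using False by (simp add: I_def)
  qed
  have "integral {0<..} (\<lambda>s. G (of_real s * cis (- \<psi>)) * cis (- \<psi>))
    - integral {0<..} (\<lambda>s. G (of_real s * cis \<psi>) * cis \<psi>) = I"
  proof (rule sector_contour_limit[where b="\<lambda>s. C / c * (1 / (1 + s\<^sup>2))" and ?R0.0=R0 and M="2 * C"])
    show "\<psi> \<in> {0<..<pi / 2}" using \<psi> by auto
    fix s :: real and a assume s: "s > 0" and a: "a \<in> {cis (- \<psi>), cis \<psi>}"
    have na: "cmod a = 1" using a by auto
    have aS: "of_real s * a \<in> S" using a s c0 by (auto simp: S_def closed_right_sector_def abs_mult)
    have "cmod (G (of_real s * a)) = cmod (F (of_real s * a)) / cmod (of_real s * a - z)"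
      by (simp add: G_def norm_divide)
    also have "\<dots> \<le> (C * (s / (1 + s\<^sup>2))) / (c * s)"
      using Fb[OF aS] dist(2)[OF s a] s na C dist(1) by (intro frac_le) (auto simp: norm_mult)
    also have "\<dots> = C / c * (1 / (1 + s\<^sup>2))" using s by simp
    finally show "cmod (G (of_real s * a)) \<le> C / c * (1 / (1 + s\<^sup>2))" .
  next
    show "(\<lambda>s. C / c * (1 / (1 + s\<^sup>2))) integrable_on {0<..}"
      using integrable_cmul[OF integrable_inverse_one_plus_square, of "C / c"] by simp
    fix R assume "R0 \<le> R * cos \<psi>"
    moreover from this have "0 < R * cos \<psi>" unfolding R0_def by linarith
    then have "R > 0" using c0 by (simp add: zero_less_mult_iff)
    ultimately have R: "R > 0" "R * cos \<psi> \<ge> R0" by auto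
    show "(G has_contour_integral I) (linepath 0 (of_real R * cis (- \<psi>)) +++
        linepath (of_real R * cis (- \<psi>)) (of_real R * cis \<psi>) +++ linepath (of_real R * cis \<psi>) 0)"
      using cint[OF R] by (simp add: path_def)
    show "continuous_on (path_image (linepath 0 (of_real R * cis (- \<psi>)) +++
        linepath (of_real R * cis (- \<psi>)) (of_real R * cis \<psi>) +++ linepath (of_real R * cis \<psi>) 0)) G"
      by (rule continuous_on_subset[OF Gcont]) (use pS[OF R(1)] pz[OF R] in \<open>auto simp: path_def\<close>)
  next
    fix w assume w: "w \<in> closed_right_sector \<psi>" "R0 \<le> cmod w"
    have w1: "cmod w \<ge> 1" "cmod w \<ge> 2 * cmod z" using w(2) norm_ge_zero[of z] unfolding R0_def by linarith+
    have "cmod w / 2 \<le> cmod (w - z)" using norm_triangle_ineq2[of w z] w1 by linarith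
    moreover have "cmod (F w) \<le> C * (1 / cmod w)"
    proof -
      have "cmod w / (1 + (cmod w)\<^sup>2) \<le> cmod w / (cmod w)\<^sup>2"
        using w1 by (intro divide_left_mono mult_pos_pos) (auto simp: add_pos_nonneg)
      also have "\<dots> = 1 / cmod w" using w1 by (simp add: power2_eq_square)
      finally show ?thesis using Fb[of w] w(1) C unfolding S_def by (meson mult_left_mono order_trans)
    qed
    ultimately have "cmod (F w) / cmod (w - z) \<le> (C * (1 / cmod w)) / (cmod w / 2)"
      using w1 C by (intro frac_le) auto
    then show "cmod (G w) \<le> 2 * C / (cmod w)\<^sup>2"
      by (simp add: G_def norm_divide power2_eq_square mult_ac)
  qed (use C in \<open>auto simp: R0_def\<close>)
  moreover have "integral {0<..} (\<lambda>s. G (of_real s * a) * a) = integral {0<..} (\<lambda>s. h (of_real s * a) / (of_real s * a - z) * a)"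
    if "a \<noteq> 0" for a
    by (rule integral_cong) (use that in \<open>auto simp: G_def F_def\<close>)
  ultimately show ?thesis unfolding I_def by simp
qed

text \<open>The left sector is the right one after \<open>w \<mapsto> - w\<close>, applied to
  \<open>h (- w)\<close> and \<open>- z\<close>. A point off the boundary is in at most one of the
  two sectors, and a sector not containing it contributes 0.\<close>

lemma bisector_Cauchy:
  fixes h :: "complex \<Rightarrow> complex"
  assumes \<psi>: "0 < \<psi>" "\<psi> < \<theta>" "\<theta> < pi / 2"
    and hol: "h holomorphic_on bisector \<theta>" and C: "C \<ge> 0"
    and bound: "\<And>w. w \<in> bisector \<theta> \<Longrightarrow> cmod (h w) \<le> C * (cmod w / (1 + (cmod w)\<^sup>2))"
    and dist: "c > 0" "\<And>s \<sigma> \<tau>. s > 0 \<Longrightarrow> \<sigma> \<in> {1, -1} \<Longrightarrow> \<tau> \<in> {1, -1} \<Longrightarrow>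
      c * s \<le> cmod (of_real s * ray_dir \<sigma> \<tau> \<psi> - z)"
    and z: "z \<in> bisector \<psi> \<or> z \<in> cobisector \<psi>"
  shows "(\<Sum>\<sigma>\<in>{1,-1}. \<Sum>\<tau>\<in>{1,-1}. of_real \<tau> * integral {0<..} (\<lambda>s.
      h (of_real s * ray_dir \<sigma> \<tau> \<psi>) / (of_real s * ray_dir \<sigma> \<tau> \<psi> - z) * ray_dir \<sigma> \<tau> \<psi>))
    = (if z \<in> bisector \<psi> then 2 * pi * \<i> * h z else 0)"
proof -
  have c0: "cos \<psi> > 0" "sin \<psi> > 0" using \<psi> by (auto intro: cos_gt_zero sin_gt_zero)
  have sub: "right_sector \<theta> \<subseteq> bisector \<theta>" "uminus ` right_sector \<theta> \<subseteq> bisector \<theta>"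
  proof -
    have "sin \<theta> > 0" using \<psi> by (auto intro: sin_gt_zero)
    then have "sin \<theta> * x \<le> sin \<theta> * \<bar>x\<bar>" for x by (intro mult_left_mono) auto
    then show "right_sector \<theta> \<subseteq> bisector \<theta>" "uminus ` right_sector \<theta> \<subseteq> bisector \<theta>"
      by (auto simp: right_sector_def bisector_def intro: less_le_trans)
  qed
  let ?I = "\<lambda>h z a. integral {0<..} (\<lambda>s. h (of_real s * a) / (of_real s * a - z) * a) :: complex"
  have loc: "(z \<in> right_sector \<psi> \<and> - z \<notin> closed_right_sector \<psi> \<and> z \<in> bisector \<psi>)
    \<or> (- z \<in> right_sector \<psi> \<and> z \<notin> closed_right_sector \<psi> \<and> z \<in> bisector \<psi>)
    \<or> (z \<notin> closed_right_sector \<psi> \<and> - z \<notin> closed_right_sector \<psi> \<and> z \<notin> bisector \<psi>)"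
  proof -
    define p q where "p = sin \<psi> * Re z" and "q = cos \<psi> * \<bar>Im z\<bar>"
    have q: "q \<ge> 0" using c0 by (simp add: q_def)
    have p: "sin \<psi> * \<bar>Re z\<bar> = \<bar>p\<bar>" using c0 by (simp add: p_def abs_mult)
    have "q < \<bar>p\<bar> \<or> \<bar>p\<bar> < q" using z unfolding bisector_def cobisector_def mem_Collect_eq p q_def .
    then have "(q < p \<and> \<not> q \<le> - p \<and> q < \<bar>p\<bar>) \<or> (q < - p \<and> \<not> q \<le> p \<and> q < \<bar>p\<bar>)
        \<or> (\<not> q \<le> p \<and> \<not> q \<le> - p \<and> \<not> q < \<bar>p\<bar>)" using q by linarith
    then show ?thesis
      unfolding bisector_def right_sector_def closed_right_sector_def by (simp add: p flip: p_def q_def)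
  qed
  have rc: "right_sector \<psi> \<subseteq> closed_right_sector \<psi>"
    by (auto simp: right_sector_def closed_right_sector_def)
  have R: "?I h z (cis (- \<psi>)) - ?I h z (cis \<psi>) = (if z \<in> right_sector \<psi> then 2 * pi * \<i> * h z else 0)"
  proof (rule sector_Cauchy[OF \<psi> _ C _ dist(1)])
    show "h holomorphic_on right_sector \<theta>" using hol sub(1) by (rule holomorphic_on_subset)
    show "cmod (h w) \<le> C * (cmod w / (1 + (cmod w)\<^sup>2))" if "w \<in> right_sector \<theta>" for w
      using bound sub that by blast
    show "c * s \<le> cmod (of_real s * a - z)" if "0 < s" "a \<in> {cis (- \<psi>), cis \<psi>}" for s a
      using dist(2)[of s 1 1] dist(2)[of s 1 "-1"] that by (auto simp: ray_dir_def)
    show "z \<in> right_sector \<psi> \<or> z \<notin> closed_right_sector \<psi>" using loc rc by blast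
  qed
  have L: "?I (\<lambda>w. h (- w)) (- z) (cis (- \<psi>)) - ?I (\<lambda>w. h (- w)) (- z) (cis \<psi>)
      = (if - z \<in> right_sector \<psi> then 2 * pi * \<i> * h (- (- z)) else 0)"
  proof (rule sector_Cauchy[OF \<psi> _ C _ dist(1)])
    have "(h \<circ> uminus) holomorphic_on right_sector \<theta>"
      by (rule holomorphic_on_compose) (auto intro!: holomorphic_intros holomorphic_on_subset[OF hol sub(2)])
    then show "(\<lambda>w. h (- w)) holomorphic_on right_sector \<theta>" by (simp add: o_def)
    show "cmod (h (- w)) \<le> C * (cmod w / (1 + (cmod w)\<^sup>2))" if "w \<in> right_sector \<theta>" for w
      using bound[of "- w"] sub that by auto
    show "c * s \<le> cmod (of_real s * a - - z)" if "0 < s" "a \<in> {cis (- \<psi>), cis \<psi>}" for s a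
      using dist(2)[of s "-1" 1] dist(2)[of s "-1" "-1"] that norm_minus_cancel[of "of_real s * a + z"]
      by (auto simp: ray_dir_def simp del: norm_minus_cancel)
    show "- z \<in> right_sector \<psi> \<or> - z \<notin> closed_right_sector \<psi>" using loc rc by blast
  qed
  \<comment> \<open>Both \<open>dw\<close> and the denominator change sign under the reflection, so
    no sign remains.\<close>
  have flip: "?I (\<lambda>w. h (- w)) (- z) a = ?I h z (- a)" for a
  proof (rule integral_cong)
    fix s :: real
    have "h (- (of_real s * a)) / (of_real s * a - - z) = - (h (- (of_real s * a)) / (- (of_real s * a + z)))"
      unfolding divide_minus_right by simp
    then show "h (- (of_real s * a)) / (of_real s * a - - z) * a = h (of_real s * - a) / (of_real s * - a - z) * - a"
      by simp
  qed
  have "(\<Sum>\<sigma>\<in>{1,-1}. \<Sum>\<tau>\<in>{1,-1}. of_real \<tau> * ?I h z (ray_dir \<sigma> \<tau> \<psi>))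
      = (?I h z (cis (- \<psi>)) - ?I h z (cis \<psi>)) + (?I h z (- cis (- \<psi>)) - ?I h z (- cis \<psi>))"
    by (simp add: ray_dir_def)
  also have "\<dots> = (if z \<in> bisector \<psi> then 2 * pi * \<i> * h z else 0)"
    using loc rc R L unfolding flip by auto
  finally show ?thesis .
qed

section \<open>Resolvents on bisectors\<close>

abbreviation signs :: "(real \<times> real) set" where "signs \<equiv> {1, -1} \<times> {1, -1}"

abbreviation dir :: "real \<times> real \<Rightarrow> real \<Rightarrow> complex" where "dir p \<phi> \<equiv> ray_dir (fst p) (snd p) \<phi>"

text \<open>Multiplication of an operator by a complex number, with \<open>j\<close> as the
  imaginary unit once \<open>j o\<^sub>L j = - id_blinfun\<close> is assumed. The underlying spaces
  stay real, and \<open>j\<close> is always composed on the left.\<close>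

definition cscale :: "('a::real_normed_vector \<Rightarrow>\<^sub>L 'a) \<Rightarrow> complex \<Rightarrow> ('a \<Rightarrow>\<^sub>L 'a) \<Rightarrow> ('a \<Rightarrow>\<^sub>L 'a)" where
  "cscale j z k = Re z *\<^sub>R k + Im z *\<^sub>R (j o\<^sub>L k)"

definition ray_integral :: "('a::real_normed_vector \<Rightarrow>\<^sub>L 'a) \<Rightarrow> (complex \<Rightarrow> ('a \<Rightarrow>\<^sub>L 'a)) \<Rightarrow>
    (complex \<Rightarrow> complex) \<Rightarrow> real \<times> real \<Rightarrow> real \<Rightarrow> ('a \<Rightarrow>\<^sub>L 'a)" where
  "ray_integral j K h p \<phi> = integral {0<..} (\<lambda>r. cscale j (dir p \<phi> * h (of_real r * dir p \<phi>)) (K (of_real r * dir p \<phi>)))"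

text \<open>The Dunford-Riesz integral of \<open>h(z) K(z) dz / (2 pi i)\<close> over the boundary
  of the bisector. All rays are parametrised outwards with \<open>dz = dir p \<phi> dr\<close>;
  \<open>snd p\<close> restores the orientation, counterclockwise around each of the two
  sectors.\<close>

definition bisector_integral :: "('a::real_normed_vector \<Rightarrow>\<^sub>L 'a) \<Rightarrow> (complex \<Rightarrow> ('a \<Rightarrow>\<^sub>L 'a)) \<Rightarrow>
    (complex \<Rightarrow> complex) \<Rightarrow> real \<Rightarrow> ('a \<Rightarrow>\<^sub>L 'a)" where
  "bisector_integral j K h \<phi> = cscale j (1 / (2 * pi * \<i>)) (\<Sum>p\<in>signs. snd p *\<^sub>R ray_integral j K h p \<phi>)"

definition ray_decay :: "real \<Rightarrow> (complex \<Rightarrow> complex) \<Rightarrow> bool" where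
  "ray_decay \<theta> h \<longleftrightarrow> h holomorphic_on bisector \<theta> \<and> bounded (h ` bisector \<theta>) \<and>
     (\<forall>p\<in>signs. \<forall>\<phi>\<in>{0<..<\<theta>}. (\<lambda>r. cmod (h (of_real r * dir p \<phi>)) / r) integrable_on {0<..})"

text \<open>Linear decay at 0 and at infinity; along a ray, \<open>h / r\<close> is then dominated
  by a multiple of \<open>1 / (1 + r\<^sup>2)\<close>.\<close>

definition strong_decay :: "real \<Rightarrow> real \<Rightarrow> (complex \<Rightarrow> complex) \<Rightarrow> bool" where
  "strong_decay \<theta> A h \<longleftrightarrow> h holomorphic_on bisector \<theta> \<and> A \<ge> 0 \<and>
     (\<forall>z\<in>bisector \<theta>. cmod (h z) \<le> A * (cmod z / (1 + (cmod z)\<^sup>2)))"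

lemma compose_bilinear:
  "(k + k') o\<^sub>L l = (k o\<^sub>L l) + (k' o\<^sub>L l)" "k o\<^sub>L (l + l') = (k o\<^sub>L l) + (k o\<^sub>L l')"
  "(k - k') o\<^sub>L l = (k o\<^sub>L l) - (k' o\<^sub>L l)" "k o\<^sub>L (l - l') = (k o\<^sub>L l) - (k o\<^sub>L l')"
  "(c *\<^sub>R k) o\<^sub>L l = c *\<^sub>R (k o\<^sub>L l)" "k o\<^sub>L (c *\<^sub>R l) = c *\<^sub>R (k o\<^sub>L l)"
  "(- k) o\<^sub>L l = - (k o\<^sub>L l)" "k o\<^sub>L (- l) = - (k o\<^sub>L l)"
  by (auto intro!: blinfun_eqI simp: blinfun.bilinear_simps)

lemma compose_sum: "(sum f S) o\<^sub>L l = (\<Sum>x\<in>S. f x o\<^sub>L l)" "k o\<^sub>L (sum g S) = (\<Sum>x\<in>S. k o\<^sub>L g x)"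
  by (auto intro!: blinfun_eqI simp: blinfun.sum_left blinfun.sum_right)

lemma compose_assoc: "(k o\<^sub>L l) o\<^sub>L m = k o\<^sub>L (l o\<^sub>L m)"
  by (rule blinfun_eqI) simp

lemma compose_id: "id_blinfun o\<^sub>L k = k" "k o\<^sub>L id_blinfun = k"
  by (auto intro!: blinfun_eqI)

text \<open>No operator \<open>T\<close> appears: the calculus only uses a pseudo-resolvent, that
  is, a family with the resolvent identity, on a space with complex structure \<open>j\<close>. One
  constant \<open>C\<close> serves all of \<open>cobisector \<omega>\<close>; a bisectorial operator
  provides such a constant for every angle larger than its own, and the locale is used with such an
  enlarged angle.\<close>

locale resolvent =
  fixes j :: "'a::banach \<Rightarrow>\<^sub>L 'a" and K :: "complex \<Rightarrow> ('a \<Rightarrow>\<^sub>L 'a)" and \<omega> C :: real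
  assumes j_square: "j o\<^sub>L j = - id_blinfun"
    and \<omega>: "\<omega> \<in> {0<..<pi / 2}"
    and K_commute: "z \<in> cobisector \<omega> \<Longrightarrow> j o\<^sub>L K z = K z o\<^sub>L j"
    and resolvent_identity: "z \<in> cobisector \<omega> \<Longrightarrow> w \<in> cobisector \<omega> \<Longrightarrow>
      K z - K w = cscale j (w - z) (K z o\<^sub>L K w)"
    and K_bound: "z \<in> cobisector \<omega> \<Longrightarrow> norm (K z) \<le> C / cmod z"
    and C_nonneg: "C \<ge> 0"
begin

abbreviation cs :: "complex \<Rightarrow> ('a \<Rightarrow>\<^sub>L 'a) \<Rightarrow> ('a \<Rightarrow>\<^sub>L 'a)" where "cs \<equiv> cscale j"

definition B :: real where "B = 1 + norm j"

lemma B_pos: "B > 0" by (simp add: B_def add_pos_nonneg)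

lemma norm_cs: "norm (cs z k) \<le> B * cmod z * norm k"
proof -
  have "norm (cs z k) \<le> \<bar>Re z\<bar> * norm k + \<bar>Im z\<bar> * (norm j * norm k)"
    unfolding cscale_def by (intro norm_triangle_le add_mono) (auto intro!: mult_left_mono norm_blinfun_compose)
  also have "\<dots> \<le> cmod z * norm k + cmod z * (norm j * norm k)"
    by (intro add_mono mult_right_mono abs_Re_le_cmod abs_Im_le_cmod) auto
  finally show ?thesis by (simp add: B_def algebra_simps)
qed

sublocale cs: bounded_bilinear cs
proof
  show "\<exists>K. \<forall>a b. norm (cs a b) \<le> norm a * norm b * K"
    using norm_cs by (intro exI[of _ B]) (simp add: mult_ac)
qed (simp_all add: cscale_def algebra_simps compose_bilinear)

lemma cs_cs: "cs z (cs w k) = cs (z * w) k"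
proof -
  have "j o\<^sub>L (j o\<^sub>L k) = - k" by (simp add: compose_assoc[symmetric] j_square compose_bilinear compose_id)
  then show ?thesis by (simp add: cscale_def compose_bilinear algebra_simps)
qed

lemma cs_of_real: "cs (of_real c) k = c *\<^sub>R k" by (simp add: cscale_def)

lemma cs_compose: "cs z k o\<^sub>L l = cs z (k o\<^sub>L l)"
  by (simp add: cscale_def compose_bilinear compose_assoc)

text \<open>Scalars act by composing with \<open>j\<close> on the left. They come out of the first
  factor of a composition freely, out of the second only past an operator that commutes with
  \<open>j\<close>.\<close>

lemma compose_cs: "j o\<^sub>L k = k o\<^sub>L j \<Longrightarrow> k o\<^sub>L cs z l = cs z (k o\<^sub>L l)"
  by (simp add: cscale_def compose_bilinear flip: compose_assoc)

lemma cs_commute: "j o\<^sub>L k = k o\<^sub>L j \<Longrightarrow> j o\<^sub>L cs z k = cs z k o\<^sub>L j"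
  by (simp add: cscale_def compose_bilinear) (metis compose_assoc)

text \<open>By the resolvent identity and the norm bound, the difference is at most a locally
  bounded factor times \<open>cmod (w - z)\<close>.\<close>

lemma K_continuous: "continuous_on (cobisector \<omega>) K"
  unfolding continuous_on_eq_continuous_within
proof
  fix w assume w: "w \<in> cobisector \<omega>"
  then have w0: "w \<noteq> 0" by (auto simp: cobisector_def)
  have "((\<lambda>z. B * cmod (w - z) * (C / cmod z * (C / cmod w))) \<longlongrightarrow> B * cmod (w - w) * (C / cmod w * (C / cmod w))) (at w within cobisector \<omega>)"
    using w0 by (intro tendsto_intros) auto
  then have lim: "((\<lambda>z. B * cmod (w - z) * (C / cmod z * (C / cmod w))) \<longlongrightarrow> 0) (at w within cobisector \<omega>)"
    by simp
  have "((\<lambda>z. K z - K w) \<longlongrightarrow> 0) (at w within cobisector \<omega>)"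
  proof (rule Lim_null_comparison[OF _ lim])
    show "\<forall>\<^sub>F z in at w within cobisector \<omega>. norm (K z - K w) \<le> B * cmod (w - z) * (C / cmod z * (C / cmod w))"
      unfolding eventually_at_filter
    proof (rule always_eventually, intro allI impI)
      fix z assume z: "z \<noteq> w" "z \<in> cobisector \<omega>"
      have "norm (K z - K w) \<le> B * cmod (w - z) * norm (K z o\<^sub>L K w)"
        unfolding resolvent_identity[OF z(2) w] by (rule norm_cs)
      also have "\<dots> \<le> B * cmod (w - z) * (norm (K z) * norm (K w))"
        using B_pos by (intro mult_left_mono norm_blinfun_compose) auto
      also have "\<dots> \<le> B * cmod (w - z) * (C / cmod z * (C / cmod w))"
        using B_pos C_nonneg by (intro mult_left_mono mult_mono K_bound z w) auto
      finally show "norm (K z - K w) \<le> B * cmod (w - z) * (C / cmod z * (C / cmod w))" .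
    qed
  qed
  then show "continuous (at w within cobisector \<omega>) K"
    unfolding continuous_within using Lim_null by blast
qed

text \<open>\<open>K' = - K\<^sup>2\<close>: applying the resolvent identity twice, the remainder is
  \<open>- (z - w) (K z - K w) K w\<close>, and the inner difference tends to 0 by
  continuity.\<close>

lemma K_derivative:
  assumes w: "w \<in> cobisector \<omega>"
  shows "(K has_derivative (\<lambda>d. - cs d (K w o\<^sub>L K w))) (at w)"
proof -
  obtain e where e: "e > 0" "ball w e \<subseteq> cobisector \<omega>"
    using open_cobisector w openE by blast
  have "isCont K w" using K_continuous open_cobisector w continuous_on_eq_continuous_at by blast
  then have lim: "((\<lambda>z. B * (norm (K z - K w) * norm (K w))) \<longlongrightarrow> B * (norm (K w - K w) * norm (K w))) (at w)"
    by (intro tendsto_intros) (simp add: isCont_def)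
  show ?thesis
  proof (rule has_derivativeI_sandwich[of e, OF e(1)])
    show "bounded_linear (\<lambda>d. - cs d (K w o\<^sub>L K w))"
      by (intro bounded_linear_minus cs.bounded_linear_left)
    show "((\<lambda>z. B * (norm (K z - K w) * norm (K w))) \<longlongrightarrow> 0) (at w)" using lim by simp
    fix z assume "z \<in> UNIV" "z \<noteq> w" "dist z w < e"
    then have z: "z \<in> cobisector \<omega>" "z \<noteq> w" using e by (auto simp: dist_commute)
    have "(K z - K w) - - cs (z - w) (K w o\<^sub>L K w) = - cs (z - w) ((K z - K w) o\<^sub>L K w)"
      unfolding resolvent_identity[OF z(1) w]
      by (simp add: compose_bilinear cs.diff_right resolvent_identity[OF z(1) w, symmetric])
         (metis cs.minus_left minus_diff_eq resolvent_identity w z(1))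
    then have "norm ((K z - K w) - - cs (z - w) (K w o\<^sub>L K w)) \<le> B * cmod (z - w) * norm ((K z - K w) o\<^sub>L K w)"
      using norm_cs by simp
    also have "\<dots> \<le> B * cmod (z - w) * (norm (K z - K w) * norm (K w))"
      using B_pos by (intro mult_left_mono norm_blinfun_compose) auto
    finally show "norm ((K z - K w) - - cs (z - w) (K w o\<^sub>L K w)) / norm (z - w) \<le> B * (norm (K z - K w) * norm (K w))"
      using z(2) by (simp add: divide_le_eq mult_ac)
  qed
qed

text \<open>For every curve the derivative is \<open>c'\<close> times the same complex derivative
  \<open>q' K - q K\<^sup>2\<close>. Radial and angular derivatives therefore differ by a scalar
  factor only, which is the Cauchy-Riemann relation in the form used for changing the angle.\<close>

lemma cs_K_derivative:
  assumes U: "open U" "q holomorphic_on U" and c: "(c has_vector_derivative c') (at t within S)"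
    and t: "c t \<in> U" "c t \<in> cobisector \<omega>"
  shows "((\<lambda>t. cs (q (c t)) (K (c t))) has_vector_derivative
    cs c' (cs (deriv q (c t)) (K (c t)) - cs (q (c t)) (K (c t) o\<^sub>L K (c t)))) (at t within S)"
proof -
  have q: "(q has_derivative (\<lambda>d. deriv q (c t) * d)) (at (c t))"
    using holomorphic_derivI[OF U(2,1) t(1)] by (simp add: has_field_derivative_def)
  have cd: "(c has_derivative (\<lambda>h. h *\<^sub>R c')) (at t within S)"
    using c by (simp add: has_vector_derivative_def)
  have "((\<lambda>t. cs (q (c t)) (K (c t))) has_derivative
      (\<lambda>h. cs (q (c t)) (- cs (h *\<^sub>R c') (K (c t) o\<^sub>L K (c t))) + cs (deriv q (c t) * (h *\<^sub>R c')) (K (c t)))) (at t within S)"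
    by (rule cs.FDERIV[OF has_derivative_compose[OF cd q] has_derivative_compose[OF cd K_derivative[OF t(2)]]])
  moreover have "cs (q (c t)) (- cs (h *\<^sub>R c') (K (c t) o\<^sub>L K (c t))) + cs (deriv q (c t) * (h *\<^sub>R c')) (K (c t))
      = h *\<^sub>R cs c' (cs (deriv q (c t)) (K (c t)) - cs (q (c t)) (K (c t) o\<^sub>L K (c t)))" for h
    by (simp add: cs.diff_right cs.minus_right cs.scaleR_left cs.scaleR_right cs_cs mult_ac scaleR_diff_right)
  ultimately show ?thesis unfolding has_vector_derivative_def by simp
qed

lemma ray_cobisector: "p \<in> signs \<Longrightarrow> \<phi> \<in> {\<omega><..<pi/2} \<Longrightarrow> r > 0 \<Longrightarrow> of_real r * dir p \<phi> \<in> cobisector \<omega>"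
  using ray_in_cobisector[of "fst p" "snd p" \<phi> r \<omega>] \<omega> by auto

lemma norm_dir: "p \<in> signs \<Longrightarrow> cmod (dir p \<phi>) = 1"
  using norm_ray_dir[of "fst p"] by auto

lemma K_ray_continuous:
  assumes "p \<in> signs" "\<phi> \<in> {\<omega><..<pi/2}"
  shows "continuous_on {0<..} (\<lambda>r. K (of_real r * dir p \<phi>))"
  by (rule continuous_on_compose2[OF K_continuous]) (use ray_cobisector[OF assms] in \<open>auto intro!: continuous_intros\<close>)

lemma K_ray_bound:
  assumes "p \<in> signs" "\<phi> \<in> {\<omega><..<pi/2}" "r > 0"
  shows "norm (K (of_real r * dir p \<phi>)) \<le> C / r"
  using K_bound[OF ray_cobisector[OF assms]] norm_dir[OF assms(1)] assms(3) by (simp add: norm_mult)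

lemma cs_K_ray_bound:
  assumes "p \<in> signs" "\<phi> \<in> {\<omega><..<pi/2}" "r > 0" "cmod q \<le> b"
  shows "norm (cs q (K (of_real r * dir p \<phi>))) \<le> B * C * (b / r)"
proof -
  have "norm (cs q (K (of_real r * dir p \<phi>))) \<le> B * cmod q * norm (K (of_real r * dir p \<phi>))" by (rule norm_cs)
  also have "\<dots> \<le> B * b * (C / r)"
    using B_pos assms(4) order_trans[OF norm_ge_zero assms(4)] by (intro mult_mono K_ray_bound assms) auto
  finally show ?thesis by (simp add: mult_ac)
qed

lemma cs_K_ray_integrable:
  assumes p: "p \<in> signs" "\<phi> \<in> {\<omega><..<pi/2}" and q: "continuous_on {0<..} q" "\<And>r. r > 0 \<Longrightarrow> cmod (q r) \<le> b r"
    and b: "(\<lambda>r. b r / r) integrable_on {0<..}"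
  shows "continuous_on {0<..} (\<lambda>r. cs (q r) (K (of_real r * dir p \<phi>)))"
    and "(\<lambda>r. cs (q r) (K (of_real r * dir p \<phi>))) integrable_on {0<..}"
    and "norm (integral {0<..} (\<lambda>r. cs (q r) (K (of_real r * dir p \<phi>)))) \<le> B * C * integral {0<..} (\<lambda>r. b r / r)"
proof -
  have b': "(\<lambda>r. B * C * (b r / r)) integrable_on {0<..}" using integrable_cmul[OF b, of "B * C"] by simp
  show c: "continuous_on {0<..} (\<lambda>r. cs (q r) (K (of_real r * dir p \<phi>)))"
    by (intro cs.continuous_on q K_ray_continuous p)
  show "(\<lambda>r. cs (q r) (K (of_real r * dir p \<phi>))) integrable_on {0<..}"
    by (rule dominated_integrable_halfline[OF c _ b']) (rule cs_K_ray_bound[OF p _ q(2)])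
  have "norm (integral {0<..} (\<lambda>r. cs (q r) (K (of_real r * dir p \<phi>)))) \<le> integral {0<..} (\<lambda>r. B * C * (b r / r))"
    by (rule integral_halfline_norm_bound[OF c _ b']) (rule cs_K_ray_bound[OF p _ q(2)])
  then show "norm (integral {0<..} (\<lambda>r. cs (q r) (K (of_real r * dir p \<phi>)))) \<le> B * C * integral {0<..} (\<lambda>r. b r / r)"
    by (simp only: integral_mult_right)
qed

end

lemma strong_decay_bound_integrable: "(\<lambda>r::real. A * (r / (1 + r\<^sup>2)) / r) integrable_on {0<..}"
  by (rule integrable_eq[OF integrable_cmul[OF integrable_inverse_one_plus_square, of A]]) auto

lemma dir_bisector: "p \<in> signs \<Longrightarrow> \<phi> \<in> {0<..<\<theta>} \<Longrightarrow> \<theta> < pi / 2 \<Longrightarrow> r > 0 \<Longrightarrow> of_real r * dir p \<phi> \<in> bisector \<theta>"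
  using ray_in_bisector[of "fst p" "snd p" \<phi> r \<theta>] by auto

lemma holomorphic_ray_continuous:
  assumes "h holomorphic_on bisector \<theta>" "p \<in> signs" "\<phi> \<in> {0<..<\<theta>}" "\<theta> < pi / 2"
  shows "continuous_on {0<..} (\<lambda>r. h (of_real r * dir p \<phi>))"
  by (rule continuous_on_compose2[OF holomorphic_on_imp_continuous_on[OF assms(1)]])
     (use dir_bisector[OF assms(2-4)] in \<open>auto intro!: continuous_intros\<close>)

lemma strong_decay_ray:
  assumes "strong_decay \<theta> A h" "p \<in> signs" "\<phi> \<in> {0<..<\<theta>}" "\<theta> < pi / 2" "r > 0"
  shows "cmod (h (of_real r * dir p \<phi>)) \<le> A * (r / (1 + r\<^sup>2))"
proof -
  have "cmod (of_real r * dir p \<phi>) = r"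
    using assms norm_ray_dir[of "fst p" "snd p" \<phi>] by (auto simp: norm_mult)
  then show ?thesis
    using assms(1) dir_bisector[OF assms(2-5)] unfolding strong_decay_def by fastforce
qed

lemma ray_decay_mult:
  assumes g: "ray_decay \<theta> g" and h: "ray_decay \<theta> h" and \<theta>: "\<theta> < pi / 2"
  shows "ray_decay \<theta> (\<lambda>z. g z * h z)"
proof -
  obtain A where A: "\<And>z. z \<in> bisector \<theta> \<Longrightarrow> cmod (g z) \<le> A"
    using g by (auto simp: ray_decay_def bounded_iff)
  obtain A' where A': "\<And>z. z \<in> bisector \<theta> \<Longrightarrow> cmod (h z) \<le> A'"
    using h by (auto simp: ray_decay_def bounded_iff)
  have hol: "g holomorphic_on bisector \<theta>" "h holomorphic_on bisector \<theta>" using g h by (auto simp: ray_decay_def)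
  have "bounded ((\<lambda>z. g z * h z) ` bisector \<theta>)"
    unfolding bounded_iff
  proof (intro exI ballI)
    fix x assume "x \<in> (\<lambda>z. g z * h z) ` bisector \<theta>"
    then obtain z where z: "z \<in> bisector \<theta>" "x = g z * h z" by auto
    show "cmod x \<le> A * A'" unfolding z(2) norm_mult
      by (intro mult_mono A A' z) (use order_trans[OF norm_ge_zero A[OF z(1)]] in auto)
  qed
  moreover have "(\<lambda>r. cmod (g (of_real r * dir p \<phi>) * h (of_real r * dir p \<phi>)) / r) integrable_on {0<..}"
    if p: "p \<in> signs" "\<phi> \<in> {0<..<\<theta>}" for p \<phi>
  proof (rule dominated_integrable_halfline)
    show "continuous_on {0<..} (\<lambda>r. cmod (g (of_real r * dir p \<phi>) * h (of_real r * dir p \<phi>)) / r)"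
      by (intro continuous_intros holomorphic_ray_continuous[OF hol(1) p \<theta>] holomorphic_ray_continuous[OF hol(2) p \<theta>]) auto
    show "norm (cmod (g (of_real r * dir p \<phi>) * h (of_real r * dir p \<phi>)) / r) \<le> A * (cmod (h (of_real r * dir p \<phi>)) / r)"
      if "r > 0" for r
      using A[OF dir_bisector[OF p \<theta> that]] that by (auto simp: norm_mult intro!: divide_right_mono mult_right_mono)
    show "(\<lambda>r. A * (cmod (h (of_real r * dir p \<phi>)) / r)) integrable_on {0<..}"
      using integrable_cmul[of "\<lambda>r. cmod (h (of_real r * dir p \<phi>)) / r" "{0<..}" A] h p unfolding ray_decay_def by force
  qed
  ultimately show ?thesis using hol by (auto simp: ray_decay_def intro!: holomorphic_intros)
qed

text \<open>The bound of \<open>h\<close> times the second bound of the regulariser;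
  \<open>\<bar>A\<bar>\<close> makes the constant nonnegative, as \<open>strong_decay\<close>
  demands.\<close>

lemma ray_decay_regularized:
  assumes h: "ray_decay \<theta> h" and \<theta>: "\<theta> \<in> {0<..<pi/2}"
  shows "\<exists>A. strong_decay \<theta> A (\<lambda>z. h z * regularizer k z)"
proof -
  obtain A where A: "\<And>z. z \<in> bisector \<theta> \<Longrightarrow> cmod (h z) \<le> A"
    using h by (auto simp: ray_decay_def bounded_iff)
  let ?L = "real (Suc k) ^ 4 / (cos \<theta>)\<^sup>2"
  have "strong_decay \<theta> (\<bar>A\<bar> * ?L) (\<lambda>z. h z * regularizer k z)"
    unfolding strong_decay_def
  proof (intro conjI ballI)
    show "(\<lambda>z. h z * regularizer k z) holomorphic_on bisector \<theta>"
      using h regularizer_holomorphic[OF \<theta>] by (auto simp: ray_decay_def intro!: holomorphic_intros)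
    fix z assume z: "z \<in> bisector \<theta>"
    show "cmod (h z * regularizer k z) \<le> \<bar>A\<bar> * ?L * (cmod z / (1 + (cmod z)\<^sup>2))"
      unfolding norm_mult mult.assoc[of "\<bar>A\<bar>"]
      by (intro mult_mono regularizer_bounds(2)[OF \<theta> z]) (use A[OF z] in auto)
  qed auto
  then show ?thesis by blast
qed

lemma signs_Cauchy:
  assumes h: "strong_decay \<theta> A h" and \<psi>: "0 < \<psi>" "\<psi> < \<theta>" "\<theta> < pi / 2"
    and dist: "c > 0" "\<And>s q. s > 0 \<Longrightarrow> q \<in> signs \<Longrightarrow> c * s \<le> cmod (of_real s * dir q \<psi> - z)"
    and z: "z \<in> bisector \<psi> \<or> z \<in> cobisector \<psi>"
  shows "(\<Sum>q\<in>signs. of_real (snd q) * integral {0<..} (\<lambda>s.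
      h (of_real s * dir q \<psi>) / (of_real s * dir q \<psi> - z) * dir q \<psi>))
    = (if z \<in> bisector \<psi> then 2 * pi * \<i> * h z else 0)"
proof -
  have "(\<Sum>\<sigma>\<in>{1,-1}. \<Sum>\<tau>\<in>{1,-1}. of_real \<tau> * integral {0<..} (\<lambda>s.
      h (of_real s * ray_dir \<sigma> \<tau> \<psi>) / (of_real s * ray_dir \<sigma> \<tau> \<psi> - z) * ray_dir \<sigma> \<tau> \<psi>))
    = (if z \<in> bisector \<psi> then 2 * pi * \<i> * h z else 0)"
    by (rule bisector_Cauchy[OF \<psi> _ _ _ dist(1) _ z]) (use h dist(2) in \<open>auto simp: strong_decay_def\<close>)
  then show ?thesis unfolding sum.cartesian_product by (simp add: case_prod_unfold)
qed

section \<open>Independence of the angle and convergence of regularised integrals\<close>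

context resolvent
begin

text \<open>Cauchy's theorem for the operator-valued integrand in polar coordinates. With
  \<open>M = z h K\<close> the integrand is \<open>M / r\<close>, and its derivative in the angle
  equals the derivative of \<open>u M\<close> in the radius. The integral over
  \<open>trunc n\<close> thus changes with the angle only by boundary values of \<open>M\<close>,
  which vanish at 0 and infinity because \<open>h\<close> decays linearly and \<open>z K\<close> is
  bounded.\<close>

lemma strong_decay_independent:
  assumes h: "strong_decay \<theta> A h" and \<phi>: "\<omega> < \<phi>1" "\<phi>1 \<le> \<phi>2" "\<phi>2 < \<theta>" "\<theta> < pi / 2" and p: "p \<in> signs"
  shows "ray_integral j K h p \<phi>1 = ray_integral j K h p \<phi>2"
proof -
  define q where "q z = z * h z" for z
  define M where "M z = cs (q z) (K z)" for z
  define M' where "M' z = cs (deriv q z) (K z) - cs (q z) (K z o\<^sub>L K z)" for z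
  have A: "A \<ge> 0" and hol: "h holomorphic_on bisector \<theta>" using h by (auto simp: strong_decay_def)
  have qhol: "q holomorphic_on bisector \<theta>" unfolding q_def using hol by (intro holomorphic_intros)
  have loc: "of_real r * dir p \<phi> \<in> bisector \<theta>" "of_real r * dir p \<phi> \<in> cobisector \<omega>"
    if "r > 0" "\<phi> \<in> {\<phi>1..\<phi>2}" for r \<phi>
    using that \<phi> \<omega> by (auto intro!: dir_bisector ray_cobisector p)
  define f where "f \<phi> r = (1 / r) *\<^sub>R M (of_real r * dir p \<phi>)" for \<phi> r
  \<comment> \<open>\<open>u\<close> is the logarithmic derivative of \<open>dir p \<phi>\<close>
    with respect to \<open>\<phi>\<close>.\<close>
  define u where "u = - (of_real (snd p) * \<i>)"
  have nu: "cmod u = 1" using p by (auto simp: u_def norm_mult)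
  define f' where "f' \<phi> r = cs (u * dir p \<phi>) (M' (of_real r * dir p \<phi>))" for \<phi> r
  have fK: "f \<phi> r = cs (dir p \<phi> * h (of_real r * dir p \<phi>)) (K (of_real r * dir p \<phi>))" if "r > 0" for \<phi> r
    using that by (simp add: f_def M_def q_def cs.scaleR_left[symmetric] scaleR_conv_of_real)
  have dir_deriv: "((\<lambda>\<phi>. of_real r * dir p \<phi>) has_vector_derivative of_real r * (u * dir p \<phi>)) (at \<phi> within S)" for r \<phi> S
  proof -
    have "((\<lambda>z. of_real r * (of_real (fst p) * exp (- (\<i> * of_real (snd p)) * z))) has_field_derivative
        of_real r * (u * (of_real (fst p) * exp (- (\<i> * of_real (snd p)) * of_real \<phi>)))) (at (of_real \<phi>))"
      unfolding u_def by (auto intro!: derivative_eq_intros)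
    from has_vector_derivative_real_field[OF this, of S] show ?thesis
      by (simp add: ray_dir_def cis_conv_exp mult_ac)
  qed
  have Mcont: "continuous_on (bisector \<theta> \<inter> cobisector \<omega>) M'"
    unfolding M'_def
    by (intro cs.continuous_on continuous_on_diff continuous_on_subset[OF K_continuous]
        continuous_on_subset[OF holomorphic_on_imp_continuous_on[OF holomorphic_deriv[OF qhol open_bisector]]]
        continuous_on_subset[OF holomorphic_on_imp_continuous_on[OF qhol]]
        bounded_bilinear.continuous_on[OF bounded_bilinear_blinfun_compose]) auto
  have f'cont: "continuous_on ({\<phi>1..\<phi>2} \<times> {0<..}) (\<lambda>(\<phi>, r). f' \<phi> r)"
  proof -
    have "continuous_on UNIV (\<lambda>\<phi>. dir p \<phi>)"
      unfolding ray_dir_def cis_conv_exp by (intro continuous_intros)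
    note [continuous_intros] = continuous_on_compose2[OF this _ subset_UNIV]
    show ?thesis
      unfolding f'_def case_prod_unfold
      by (intro cs.continuous_on continuous_on_compose2[OF Mcont] continuous_intros) (auto intro!: loc)
  qed
  have Mb: "norm (M (of_real r * dir p \<phi>)) \<le> A * B * C * (r / (1 + r\<^sup>2))" if r: "r > 0" "\<phi> \<in> {\<phi>1..\<phi>2}" for r \<phi>
  proof -
    have "cmod (q (of_real r * dir p \<phi>)) \<le> r * (A * (r / (1 + r\<^sup>2)))"
      unfolding q_def norm_mult[of _ "h _"]
      by (intro mult_mono strong_decay_ray[OF h p]) (use norm_dir[OF p, of \<phi>] r \<phi> \<omega> in \<open>auto simp: norm_mult\<close>)
    then have "norm (M (of_real r * dir p \<phi>)) \<le> B * C * (r * (A * (r / (1 + r\<^sup>2))) / r)"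
      unfolding M_def using p r \<phi> by (intro cs_K_ray_bound) auto
    then show ?thesis using r by (simp add: mult_ac)
  qed
  define I where "I n \<phi> = integral (trunc n) (f \<phi>)" for n \<phi>
  define D where "D n \<phi> = cs u (M (of_real (Suc n) * dir p \<phi>)) - cs u (M (of_real (1 / Suc n) * dir p \<phi>))" for n \<phi>
  have tr: "1 / real (Suc n) \<le> real (Suc n)" for n by (simp add: field_simps)
  have Ideriv: "(I n has_vector_derivative D n \<phi>) (at \<phi> within {\<phi>1..\<phi>2})" if ph: "\<phi> \<in> {\<phi>1..\<phi>2}" for n \<phi>
  proof -
    have "((\<lambda>\<phi>. integral (cbox (1 / real (Suc n)) (real (Suc n))) (f \<phi>)) has_vector_derivative
        integral (cbox (1 / real (Suc n)) (real (Suc n))) (f' \<phi>)) (at \<phi> within {\<phi>1..\<phi>2})"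
    proof (rule leibniz_rule_vector_derivative)
      fix \<phi> t assume a: "\<phi> \<in> {\<phi>1..\<phi>2}" "t \<in> cbox (1 / real (Suc n)) (real (Suc n))"
      then have t: "t > 0" using trunc_subset[of n] by (auto simp: trunc_def)
      have "((\<lambda>\<phi>. M (of_real t * dir p \<phi>)) has_vector_derivative cs (of_real t * (u * dir p \<phi>)) (M' (of_real t * dir p \<phi>)))
          (at \<phi> within {\<phi>1..\<phi>2})"
        unfolding M_def M'_def
        by (rule cs_K_derivative[OF open_bisector qhol dir_deriv]) (use loc[OF t a(1)] in auto)
      then have "((\<lambda>\<phi>. (1 / t) *\<^sub>R M (of_real t * dir p \<phi>)) has_vector_derivative
          (1 / t) *\<^sub>R cs (of_real t * (u * dir p \<phi>)) (M' (of_real t * dir p \<phi>))) (at \<phi> within {\<phi>1..\<phi>2})"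
        by (rule bounded_linear.has_vector_derivative[OF bounded_linear_scaleR_right])
      moreover have "(1 / t) *\<^sub>R cs (of_real t * (u * dir p \<phi>)) X = cs (u * dir p \<phi>) X" for X
        using t by (simp add: cs.scaleR_left[symmetric] scaleR_conv_of_real)
      ultimately show "((\<lambda>\<phi>. f \<phi> t) has_vector_derivative f' \<phi> t) (at \<phi> within {\<phi>1..\<phi>2})"
        by (simp add: f_def f'_def)
    next
      fix \<phi> assume a: "\<phi> \<in> {\<phi>1..\<phi>2}"
      have "continuous_on {0<..} (\<lambda>r. cs (dir p \<phi> * h (of_real r * dir p \<phi>)) (K (of_real r * dir p \<phi>)))"
        using a \<phi> \<omega> by (intro cs.continuous_on continuous_intros holomorphic_ray_continuous[OF hol p] K_ray_continuous p) auto
      then have "continuous_on {0<..} (f \<phi>)" by (rule continuous_on_eq) (use fK in auto)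
      then show "f \<phi> integrable_on cbox (1 / real (Suc n)) (real (Suc n))"
        using trunc_subset[of n] by (intro integrable_continuous) (auto simp: trunc_def intro: continuous_on_subset)
    next
      show "continuous_on ({\<phi>1..\<phi>2} \<times> cbox (1 / real (Suc n)) (real (Suc n))) (\<lambda>(\<phi>, r). f' \<phi> r)"
        by (rule continuous_on_subset[OF f'cont]) (use trunc_subset[of n] in \<open>auto simp: trunc_def\<close>)
    qed (use ph in auto)
    \<comment> \<open>Read as a function of the radius, the same \<open>f'\<close> is the derivative
      of \<open>cs u M\<close>.\<close>
    moreover have "integral (cbox (1 / real (Suc n)) (real (Suc n))) (f' \<phi>) = D n \<phi>"
    proof (rule integral_unique)
      have "(f' \<phi> has_integral cs u (M (of_real (real (Suc n)) * dir p \<phi>)) - cs u (M (of_real (1 / real (Suc n)) * dir p \<phi>)))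
          {1 / real (Suc n)..real (Suc n)}"
      proof (rule fundamental_theorem_of_calculus[OF tr])
        fix t assume "t \<in> {1 / real (Suc n)..real (Suc n)}"
        then have t: "t > 0" using trunc_subset[of n] by (auto simp: trunc_def)
        have "((\<lambda>t. of_real t * dir p \<phi>) has_vector_derivative dir p \<phi>) (at t within {1 / real (Suc n)..real (Suc n)})"
          by (auto intro!: derivative_eq_intros simp: has_vector_derivative_def scaleR_conv_of_real)
        then have "((\<lambda>t. M (of_real t * dir p \<phi>)) has_vector_derivative cs (dir p \<phi>) (M' (of_real t * dir p \<phi>)))
            (at t within {1 / real (Suc n)..real (Suc n)})"
          unfolding M_def M'_def by (rule cs_K_derivative[OF open_bisector qhol]) (use loc[OF t ph] in auto)
        from bounded_linear.has_vector_derivative[OF cs.bounded_linear_right this, of u]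
        show "((\<lambda>t. cs u (M (of_real t * dir p \<phi>))) has_vector_derivative f' \<phi> t) (at t within {1 / real (Suc n)..real (Suc n)})"
          by (simp add: f'_def cs_cs)
      qed
      then show "(f' \<phi> has_integral D n \<phi>) (cbox (1 / real (Suc n)) (real (Suc n)))" by (simp add: D_def)
    qed
    moreover have "I n = (\<lambda>\<phi>. integral (cbox (1 / real (Suc n)) (real (Suc n))) (f \<phi>))"
      by (rule ext) (simp add: I_def trunc_def)
    ultimately show ?thesis by simp
  qed
  \<comment> \<open>A bound for the boundary terms that is uniform in the angle: each of the two
    values of \<open>M\<close> has norm at most \<open>A * B * C / (n + 1)\<close>, and
    \<open>cs u\<close> costs the factor \<open>B\<close>.\<close>
  define E where "E n = B * (2 * (A * B * C * (1 / real (Suc n))))" for n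
  have Db: "norm (D n \<phi>) \<le> E n" if ph: "\<phi> \<in> {\<phi>1..\<phi>2}" for n \<phi>
  proof -
    define N where "N = real (Suc n)"
    have N: "N \<ge> 1" by (simp add: N_def)
    have "N / (1 + N\<^sup>2) \<le> N / N\<^sup>2" using N by (intro divide_left_mono mult_pos_pos add_pos_nonneg) auto
    then have "N / (1 + N\<^sup>2) \<le> 1 / N" using N by (simp add: power2_eq_square)
    moreover have "(1 / N) / (1 + (1 / N)\<^sup>2) \<le> (1 / N) / 1"
      using N by (intro divide_left_mono mult_pos_pos add_pos_nonneg) auto
    moreover have ABC: "A * B * C \<ge> 0" using A B_pos C_nonneg by simp
    ultimately have "A * B * C * (N / (1 + N\<^sup>2)) \<le> A * B * C * (1 / N)"
      "A * B * C * ((1 / N) / (1 + (1 / N)\<^sup>2)) \<le> A * B * C * (1 / N)"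
      by (intro mult_left_mono; simp)+
    moreover have "0 < N" "0 < 1 / N" using N by auto
    ultimately have "norm (M (of_real N * dir p \<phi>)) \<le> A * B * C * (1 / N)" "norm (M (of_real (1 / N) * dir p \<phi>)) \<le> A * B * C * (1 / N)"
      using order_trans[OF Mb[OF _ ph]] by blast+
    then have "norm (M (of_real N * dir p \<phi>) - M (of_real (1 / N) * dir p \<phi>)) \<le> 2 * (A * B * C * (1 / N))"
      unfolding mult_2 by (intro norm_triangle_le_diff add_mono)
    moreover have "norm (D n \<phi>) \<le> B * cmod u * norm (M (of_real N * dir p \<phi>) - M (of_real (1 / N) * dir p \<phi>))"
      unfolding D_def N_def cs.diff_right[symmetric] by (rule norm_cs)
    ultimately show ?thesis
      unfolding E_def N_def[symmetric] nu using B_pos by (smt (verit) mult_left_mono mult.right_neutral)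
  qed
  have close: "norm (I n \<phi>1 - I n \<phi>2) \<le> E n * norm (\<phi>1 - \<phi>2)" for n
  proof (rule differentiable_bound[of "{\<phi>1..\<phi>2}" "I n" "\<lambda>x h. h *\<^sub>R D n x"])
    show "(I n has_derivative (\<lambda>h. h *\<^sub>R D n x)) (at x within {\<phi>1..\<phi>2})" if "x \<in> {\<phi>1..\<phi>2}" for x
      using Ideriv[OF that] by (simp add: has_vector_derivative_def)
    show "onorm (\<lambda>h. h *\<^sub>R D n x) \<le> E n" if "x \<in> {\<phi>1..\<phi>2}" for x
      by (rule onorm_le) (use Db[OF that, of n] in \<open>simp add: mult.commute[of "E n"] mult_left_mono\<close>)
  qed (use \<phi> in auto)
  have "E \<longlonglongrightarrow> B * (2 * (A * B * C * 0))"
    unfolding E_def by (intro tendsto_intros LIMSEQ_Suc[OF lim_1_over_n])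
  then have "(\<lambda>n. E n * norm (\<phi>1 - \<phi>2)) \<longlonglongrightarrow> 0"
    using tendsto_mult_right[of E 0 sequentially "norm (\<phi>1 - \<phi>2)"] by simp
  then have "(\<lambda>n. I n \<phi>1 - I n \<phi>2) \<longlonglongrightarrow> 0"
    by (intro Lim_null_comparison[OF always_eventually[OF allI[OF close]]])
  moreover have "(\<lambda>n. I n \<phi>) \<longlonglongrightarrow> ray_integral j K h p \<phi>" if ph: "\<phi> \<in> {\<phi>1..\<phi>2}" for \<phi>
  proof -
    have ph': "\<phi> \<in> {0<..<\<theta>}" "\<phi> \<in> {\<omega><..<pi/2}" using ph \<phi> \<omega> by auto
    let ?G = "\<lambda>r. cs (dir p \<phi> * h (of_real r * dir p \<phi>)) (K (of_real r * dir p \<phi>))"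
    have "(\<lambda>n. integral (trunc n) ?G) \<longlonglongrightarrow> integral {0<..} ?G"
    proof (rule integral_halfline_trunc_tendsto)
      show "continuous_on {0<..} ?G"
        using ph' \<phi> by (intro cs.continuous_on continuous_intros holomorphic_ray_continuous[OF hol p] K_ray_continuous p) auto
      show "norm (?G r) \<le> B * C * (A * (r / (1 + r\<^sup>2)) / r)" if "r > 0" for r
        using norm_dir[OF p] strong_decay_ray[OF h p ph'(1) \<phi>(4) that]
        by (intro cs_K_ray_bound[OF p ph'(2) that]) (simp add: norm_mult)
      show "(\<lambda>r. B * C * (A * (r / (1 + r\<^sup>2)) / r)) integrable_on {0<..}"
        using integrable_cmul[OF strong_decay_bound_integrable, of "B * C"] by simp
    qed
    moreover have "I n \<phi> = integral (trunc n) ?G" for n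
      unfolding I_def by (rule integral_cong) (use trunc_subset[of n] fK in auto)
    ultimately show ?thesis by (simp add: ray_integral_def)
  qed
  ultimately have "(\<lambda>n. I n \<phi>1 - I n \<phi>2) \<longlonglongrightarrow> ray_integral j K h p \<phi>1 - ray_integral j K h p \<phi>2"
    using \<phi> by (intro tendsto_diff) auto
  with \<open>(\<lambda>n. I n \<phi>1 - I n \<phi>2) \<longlonglongrightarrow> 0\<close> show ?thesis
    using LIMSEQ_unique by fastforce
qed

text \<open>The difference of the integrals is governed by the real functions
  \<open>cmod h * cmod (m k - 1) / r\<close>, to which dominated convergence applies with
  \<open>cmod (m k - 1) \<le> L + 1\<close>. The multiplier is left general because the square of
  the regulariser occurs as well as the regulariser itself.\<close>

lemma bisector_integral_limit:
  assumes h: "ray_decay \<theta> h" and \<phi>: "\<omega> < \<phi>" "\<phi> < \<theta>" "\<theta> < pi / 2"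
    and m: "\<And>k. m k holomorphic_on bisector \<theta>" "\<And>k z. z \<in> bisector \<theta> \<Longrightarrow> cmod (m k z) \<le> L"
      "\<And>z. z \<in> bisector \<theta> \<Longrightarrow> (\<lambda>k. m k z) \<longlonglongrightarrow> 1"
  shows "(\<lambda>k. bisector_integral j K (\<lambda>z. h z * m k z) \<phi>) \<longlonglongrightarrow> bisector_integral j K h \<phi>"
proof -
  have hol: "h holomorphic_on bisector \<theta>" using h by (simp add: ray_decay_def)
  have ray: "(\<lambda>k. ray_integral j K (\<lambda>z. h z * m k z) p \<phi>) \<longlonglongrightarrow> ray_integral j K h p \<phi>" if p: "p \<in> signs" for p
  proof -
    define H where "H r = h (of_real r * dir p \<phi>)" for r
    define N where "N k r = m k (of_real r * dir p \<phi>)" for k r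
    have ph: "\<phi> \<in> {0<..<\<theta>}" "\<phi> \<in> {\<omega><..<pi/2}" using \<phi> \<omega> by auto
    note bi = dir_bisector[OF p ph(1) \<phi>(3)]
    have Hc: "continuous_on {0<..} H" unfolding H_def by (rule holomorphic_ray_continuous[OF hol p ph(1) \<phi>(3)])
    have Nc: "continuous_on {0<..} (N k)" for k unfolding N_def by (rule holomorphic_ray_continuous[OF m(1) p ph(1) \<phi>(3)])
    have Hi: "(\<lambda>r. cmod (H r) / r) integrable_on {0<..}" using h p ph unfolding ray_decay_def H_def by blast
    have nd: "cmod (dir p \<phi>) = 1" using norm_dir[OF p] .
    have L0: "0 \<le> L" using order_trans[OF norm_ge_zero m(2)[OF bi[of 1]]] by simp
    have dom: "(\<lambda>r. (L + 1) * (cmod (H r) / r)) integrable_on {0<..}"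
      using integrable_cmul[OF Hi, of "L + 1"] by simp
    have NL: "cmod (N k r) \<le> L" if "r > 0" for k r unfolding N_def by (rule m(2)[OF bi[OF that]])
    have N1: "cmod (N k r - 1) \<le> L + 1" if "r > 0" for k r
      using norm_triangle_ineq4[of "N k r" 1] NL[OF that] by (smt (verit) norm_one)
    have i1: "(\<lambda>r. cs (dir p \<phi> * H r) (K (of_real r * dir p \<phi>))) integrable_on {0<..}"
      by (rule cs_K_ray_integrable(2)[OF p ph(2) _ _ Hi])
         (auto simp: norm_mult nd intro!: continuous_intros Hc)
    have bk: "(\<lambda>r. cmod (H r) * cmod (N k r - 1) / r) integrable_on {0<..}" for k
    proof (rule dominated_integrable_halfline[OF _ _ dom])
      show "norm (cmod (H r) * cmod (N k r - 1) / r) \<le> (L + 1) * (cmod (H r) / r)" if "r > 0" for r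
        using mult_left_mono[OF N1[OF that, of k], of "cmod (H r)"] that
        by (simp add: abs_mult divide_right_mono mult.commute)
    qed (auto intro!: continuous_intros Hc Nc)
    have i2: "(\<lambda>r. cs (dir p \<phi> * H r * (N k r - 1)) (K (of_real r * dir p \<phi>))) integrable_on {0<..}"
      and n2: "norm (integral {0<..} (\<lambda>r. cs (dir p \<phi> * H r * (N k r - 1)) (K (of_real r * dir p \<phi>))))
        \<le> B * C * integral {0<..} (\<lambda>r. cmod (H r) * cmod (N k r - 1) / r)" for k
      by (rule cs_K_ray_integrable(2,3)[OF p ph(2) _ _ bk];
          auto simp: norm_mult nd intro!: continuous_intros Hc Nc)+
    have "ray_integral j K (\<lambda>z. h z * m k z) p \<phi> - ray_integral j K h p \<phi>
        = integral {0<..} (\<lambda>r. cs (dir p \<phi> * H r * (N k r - 1)) (K (of_real r * dir p \<phi>)))" for k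
    proof -
      have "ray_integral j K (\<lambda>z. h z * m k z) p \<phi> = integral {0<..} (\<lambda>r.
          cs (dir p \<phi> * H r * (N k r - 1)) (K (of_real r * dir p \<phi>)) + cs (dir p \<phi> * H r) (K (of_real r * dir p \<phi>)))"
        unfolding ray_integral_def H_def N_def cs.add_left[symmetric] by (simp add: algebra_simps)
      also have "\<dots> = integral {0<..} (\<lambda>r. cs (dir p \<phi> * H r * (N k r - 1)) (K (of_real r * dir p \<phi>)))
          + ray_integral j K h p \<phi>"
        unfolding ray_integral_def H_def[symmetric] by (rule integral_add[OF i2 i1])
      finally show ?thesis by simp
    qed
    then have le: "norm (ray_integral j K (\<lambda>z. h z * m k z) p \<phi> - ray_integral j K h p \<phi>)
        \<le> B * C * integral {0<..} (\<lambda>r. cmod (H r) * cmod (N k r - 1) / r)" for k using n2 by simp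
    have "(\<lambda>k. integral {0<..} (\<lambda>r. cmod (H r) * cmod (N k r - 1) / r)) \<longlonglongrightarrow> integral {0<..} (\<lambda>r::real. 0::real)"
    proof (rule dominated_convergence(2)[OF bk dom])
      show "norm (cmod (H r) * cmod (N k r - 1) / r) \<le> (L + 1) * (cmod (H r) / r)" if "r \<in> {0<..}" for k r
        using mult_left_mono[OF N1[of r k], of "cmod (H r)"] that
        by (simp add: abs_mult divide_right_mono mult.commute)
      show "(\<lambda>k. cmod (H r) * cmod (N k r - 1) / r) \<longlonglongrightarrow> 0" if "r \<in> {0<..}" for r
      proof -
        have "(\<lambda>k. cmod (H r) * cmod (N k r - 1) / r) \<longlonglongrightarrow> cmod (H r) * cmod (1 - 1) / r"
          unfolding N_def using that m(3)[OF bi] by (intro tendsto_intros) auto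
        then show ?thesis by simp
      qed
    qed
    then have "(\<lambda>k. B * C * integral {0<..} (\<lambda>r. cmod (H r) * cmod (N k r - 1) / r)) \<longlonglongrightarrow> B * C * 0"
      by (intro tendsto_intros) simp
    then have "(\<lambda>k. ray_integral j K (\<lambda>z. h z * m k z) p \<phi> - ray_integral j K h p \<phi>) \<longlonglongrightarrow> 0"
      by (intro Lim_null_comparison[OF always_eventually[OF allI[OF le]]]) simp
    then show ?thesis by (rule LIM_zero_cancel)
  qed
  show ?thesis unfolding bisector_integral_def
    by (intro bounded_linear.tendsto[OF cs.bounded_linear_right] tendsto_sum tendsto_scaleR tendsto_const ray)
qed

end

section \<open>The product rule for strongly decaying functions\<close>

lemma scaled_inverse_integrable: "(\<lambda>s::real. c * (1 / (1 + s\<^sup>2))) integrable_on {0<..}"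
  using integrable_cmul[OF integrable_inverse_one_plus_square, of c] by (simp only: real_scaleR_def)

context resolvent
begin

lemmas compose_left_linear = bounded_bilinear.bounded_linear_left[OF bounded_bilinear_blinfun_compose]
lemmas compose_right_linear = bounded_bilinear.bounded_linear_right[OF bounded_bilinear_blinfun_compose]

lemma cs_swap: "cs z (cs w k) = cs w (cs z k)"
  by (simp add: cs_cs mult.commute)

lemma integral_bounded_linear:
  assumes "f integrable_on S" "bounded_linear L"
  shows "L (integral S f) = integral S (\<lambda>x. L (f x))"
  using integral_linear[OF assms] by (simp add: o_def)

text \<open>Commuting with \<open>j\<close> is what allows the complex factors of a second integral
  to be pulled in front of this operator.\<close>

lemma bisector_integral_commute:
  assumes h: "strong_decay \<theta> A h" and \<phi>: "\<omega> < \<phi>" "\<phi> < \<theta>" "\<theta> < pi / 2"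
  shows "j o\<^sub>L bisector_integral j K h \<phi> = bisector_integral j K h \<phi> o\<^sub>L j"
proof -
  have ph: "\<phi> \<in> {0<..<\<theta>}" "\<phi> \<in> {\<omega><..<pi/2}" using \<phi> \<omega> by auto
  have hol: "h holomorphic_on bisector \<theta>" using h by (simp add: strong_decay_def)
  have "j o\<^sub>L ray_integral j K h p \<phi> = ray_integral j K h p \<phi> o\<^sub>L j" if p: "p \<in> signs" for p
  proof -
    have i: "(\<lambda>r. cs (dir p \<phi> * h (of_real r * dir p \<phi>)) (K (of_real r * dir p \<phi>))) integrable_on {0<..}"
      by (rule cs_K_ray_integrable(2)[OF p ph(2) _ _ strong_decay_bound_integrable[of A]])
         (intro continuous_intros holomorphic_ray_continuous[OF hol p ph(1) \<phi>(3)],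
          use strong_decay_ray[OF h p ph(1) \<phi>(3)] in \<open>simp add: norm_mult norm_dir[OF p]\<close>)
    show ?thesis
      unfolding ray_integral_def integral_bounded_linear[OF i compose_left_linear] integral_bounded_linear[OF i compose_right_linear]
      by (rule integral_cong) (auto intro!: cs_commute K_commute ray_cobisector[OF p ph(2)])
  qed
  then show ?thesis
    unfolding bisector_integral_def by (intro cs_commute) (simp add: compose_sum compose_bilinear)
qed

text \<open>For \<open>z\<close> on the contour, \<open>K z K w = (K z - K w) / (w - z)\<close>. The
  part with \<open>K w\<close> has as coefficient the contour integral of
  \<open>g(z) / (w - z)\<close>, which is 0 since \<open>w\<close> lies outside the contour.
  \<open>dist\<close> makes the two parts integrable separately.\<close>

lemma strong_decay_compose_resolvent:
  assumes g: "strong_decay \<theta> A g" and \<phi>: "\<omega> < \<phi>" "\<phi> < \<theta>" "\<theta> < pi / 2"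
    and w: "w \<in> cobisector \<phi>" "w \<in> cobisector \<omega>"
    and dist: "c > 0" "\<And>r p. r > 0 \<Longrightarrow> p \<in> signs \<Longrightarrow> c * r \<le> cmod (of_real r * dir p \<phi> - w)"
  shows "bisector_integral j K g \<phi> o\<^sub>L K w = cs (1 / (2 * pi * \<i>)) (\<Sum>p\<in>signs. snd p *\<^sub>R
    integral {0<..} (\<lambda>r. cs (dir p \<phi> * g (of_real r * dir p \<phi>) / (w - of_real r * dir p \<phi>)) (K (of_real r * dir p \<phi>))))"
proof -
  have ph: "\<phi> \<in> {0<..<\<theta>}" "\<phi> \<in> {\<omega><..<pi/2}" using \<phi> \<omega> by auto
  have hol: "g holomorphic_on bisector \<theta>" using g by (simp add: strong_decay_def)
  define Z where "Z p r = of_real r * dir p \<phi>" for p r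
  define a where "a p r = dir p \<phi> * g (Z p r)" for p r
  have A: "A \<ge> 0" using g by (simp add: strong_decay_def)
  have ne: "Z p r \<noteq> w" "c * r \<le> cmod (w - Z p r)" if "p \<in> signs" "r > 0" for p r
  proof -
    show "c * r \<le> cmod (w - Z p r)" using dist(2)[OF that(2,1)] by (simp add: Z_def norm_minus_commute)
    then show "Z p r \<noteq> w" using mult_pos_pos[OF dist(1) that(2)] by auto
  qed
  have ac: "continuous_on {0<..} (a p)" if p: "p \<in> signs" for p
    unfolding a_def[abs_def] Z_def by (intro continuous_intros holomorphic_ray_continuous[OF hol p ph(1) \<phi>(3)])
  have Zc: "continuous_on {0<..} (Z p)" for p unfolding Z_def[abs_def] by (intro continuous_intros)
  have ab: "cmod (a p r) \<le> A * (r / (1 + r\<^sup>2))" if "p \<in> signs" "r > 0" for p r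
    using strong_decay_ray[OF g that(1) ph(1) \<phi>(3) that(2)] by (simp add: a_def Z_def norm_mult norm_dir[OF that(1)])
  have qc: "continuous_on {0<..} (\<lambda>r. a p r / (w - Z p r))" if p: "p \<in> signs" for p
    by (intro continuous_intros ac[OF p] Zc) (use ne(1)[OF p] in force)
  have qb: "cmod (a p r / (w - Z p r)) \<le> A / c * (1 / (1 + r\<^sup>2))" if p: "p \<in> signs" "r > 0" for p r
  proof -
    have "cmod (a p r) / cmod (w - Z p r) \<le> (A * (r / (1 + r\<^sup>2))) / (c * r)"
      using ab[OF p] ne[OF p] dist(1) p A by (intro frac_le) auto
    then show ?thesis using p by (simp add: norm_divide mult.commute)
  qed
  have Ki: "(\<lambda>r. cs (a p r) (K (Z p r))) integrable_on {0<..}" if p: "p \<in> signs" for p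
    unfolding Z_def
    by (rule cs_K_ray_integrable(2)[OF p ph(2) ac[OF p] ab[OF p] strong_decay_bound_integrable])
  have qi: "(\<lambda>r. a p r / (w - Z p r)) integrable_on {0<..}" if p: "p \<in> signs" for p
    by (rule dominated_integrable_halfline[OF qc[OF p] qb[OF p] scaled_inverse_integrable])
  have step: "ray_integral j K g p \<phi> o\<^sub>L K w
      = integral {0<..} (\<lambda>r. cs (a p r / (w - Z p r)) (K (Z p r))) - cs (integral {0<..} (\<lambda>r. a p r / (w - Z p r))) (K w)"
    if p: "p \<in> signs" for p
  proof -
    have pt: "cs (a p r) (K (Z p r)) o\<^sub>L K w = cs (a p r / (w - Z p r)) (K (Z p r)) - cs (a p r / (w - Z p r)) (K w)"
      if "r > 0" for r
    proof -
      have "K (Z p r) - K w = cs (w - Z p r) (K (Z p r) o\<^sub>L K w)"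
        by (rule resolvent_identity) (use ray_cobisector[OF p ph(2) that] w in \<open>auto simp: Z_def\<close>)
      then have "cs (a p r / (w - Z p r)) (K (Z p r) - K w) = cs (a p r) (K (Z p r) o\<^sub>L K w)"
        using ne(1)[OF p that] by (simp add: cs_cs)
      then show ?thesis by (simp add: cs_compose cs.diff_right)
    qed
    have "ray_integral j K g p \<phi> o\<^sub>L K w = integral {0<..} (\<lambda>r. cs (a p r) (K (Z p r)) o\<^sub>L K w)"
      unfolding ray_integral_def
      using integral_bounded_linear[OF Ki[OF p] compose_left_linear] by (simp add: a_def Z_def)
    also have "\<dots> = integral {0<..} (\<lambda>r. cs (a p r / (w - Z p r)) (K (Z p r)) - cs (a p r / (w - Z p r)) (K w))"
      by (rule integral_cong) (use pt in auto)
    also have "\<dots> = integral {0<..} (\<lambda>r. cs (a p r / (w - Z p r)) (K (Z p r))) - integral {0<..} (\<lambda>r. cs (a p r / (w - Z p r)) (K w))"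
    proof (rule integral_diff)
      show "(\<lambda>r. cs (a p r / (w - Z p r)) (K w)) integrable_on {0<..}"
        using integrable_linear[OF qi[OF p] cs.bounded_linear_left] by (simp add: o_def)
      show "(\<lambda>r. cs (a p r / (w - Z p r)) (K (Z p r))) integrable_on {0<..}"
      proof -
        have "(\<lambda>r. cs (a p r / (w - Z p r)) (K (Z p r)) - cs (a p r / (w - Z p r)) (K w)) integrable_on {0<..}"
          by (rule integrable_eq[OF integrable_linear[OF Ki[OF p] compose_left_linear[of "K w"]]]) (use pt in auto)
        from integrable_add[OF this integrable_linear[OF qi[OF p] cs.bounded_linear_left[of "K w"]]]
        show ?thesis by (simp add: o_def)
      qed
    qed
    also have "integral {0<..} (\<lambda>r. cs (a p r / (w - Z p r)) (K w)) = cs (integral {0<..} (\<lambda>r. a p r / (w - Z p r))) (K w)"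
      by (rule integral_bounded_linear[OF qi[OF p] cs.bounded_linear_left, symmetric])
    finally show ?thesis .
  qed
  have "(\<Sum>p\<in>signs. of_real (snd p) * integral {0<..} (\<lambda>r. g (of_real r * dir p \<phi>) / (of_real r * dir p \<phi> - w) * dir p \<phi>)) = 0"
    using signs_Cauchy[OF g _ \<phi>(2,3) dist] w(1) ph(1)
    by (auto simp: bisector_def cobisector_def)
  moreover have "integral {0<..} (\<lambda>r. g (of_real r * dir p \<phi>) / (of_real r * dir p \<phi> - w) * dir p \<phi>)
      = - integral {0<..} (\<lambda>r. a p r / (w - Z p r))" for p
    unfolding integral_neg[symmetric]
  proof (rule integral_cong)
    fix r :: real
    have "- (a p r / (w - Z p r)) = a p r / (- (w - Z p r))" by (simp only: divide_minus_right)
    then show "g (of_real r * dir p \<phi>) / (of_real r * dir p \<phi> - w) * dir p \<phi> = - (a p r / (w - Z p r))"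
      by (simp add: a_def Z_def)
  qed
  ultimately have zero: "(\<Sum>p\<in>signs. of_real (snd p) * integral {0<..} (\<lambda>r. a p r / (w - Z p r))) = 0"
    by (simp only: mult_minus_right sum_negf neg_equal_0_iff_equal)
  have "bisector_integral j K g \<phi> o\<^sub>L K w = cs (1 / (2 * pi * \<i>)) (\<Sum>p\<in>signs. snd p *\<^sub>R (ray_integral j K g p \<phi> o\<^sub>L K w))"
    unfolding bisector_integral_def by (simp add: cs_compose compose_sum compose_bilinear)
  also have "(\<Sum>p\<in>signs. snd p *\<^sub>R (ray_integral j K g p \<phi> o\<^sub>L K w)) =
      (\<Sum>p\<in>signs. snd p *\<^sub>R integral {0<..} (\<lambda>r. cs (a p r / (w - Z p r)) (K (Z p r))))
      - cs (\<Sum>p\<in>signs. of_real (snd p) * integral {0<..} (\<lambda>r. a p r / (w - Z p r))) (K w)"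
    unfolding cs.sum_left sum_subtractf[symmetric] cs_cs[symmetric] cs_of_real
    by (intro sum.cong refl) (simp add: step scaleR_diff_right)
  finally show ?thesis unfolding zero cs.zero_left diff_zero unfolding a_def Z_def .
qed

text \<open>With the contour of \<open>g\<close> inside that of \<open>h\<close>, the preceding
  formula is applied at each point \<open>W\<close> of the outer contour. After interchanging the
  integrals, the inner one is the Cauchy integral of \<open>h\<close> at a point \<open>Z\<close>
  inside its contour and equals \<open>2 pi i h(Z)\<close>; this uses up one of the two factors
  \<open>1 / (2 pi i)\<close>.\<close>

lemma strong_decay_product:
  assumes g: "strong_decay \<theta> A g" and h: "strong_decay \<theta> A' h"
    and \<phi>: "\<omega> < \<phi>" "\<phi> < \<psi>" "\<psi> < \<theta>" "\<theta> < pi / 2"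
  shows "bisector_integral j K g \<phi> o\<^sub>L bisector_integral j K h \<psi> = bisector_integral j K (\<lambda>z. g z * h z) \<phi>"
proof -
  have ph: "\<phi> \<in> {0<..<\<theta>}" "\<phi> \<in> {\<omega><..<pi/2}" "\<psi> \<in> {0<..<\<theta>}" "\<psi> \<in> {\<omega><..<pi/2}" using \<phi> \<omega> by auto
  have holg: "g holomorphic_on bisector \<theta>" and holh: "h holomorphic_on bisector \<theta>" and A: "A \<ge> 0" "A' \<ge> 0"
    using g h by (auto simp: strong_decay_def)
  define P where "P = bisector_integral j K g \<phi>"
  define \<kappa> where "\<kappa> = 1 / (2 * pi * \<i>)"
  define Z where "Z p r = of_real r * dir p \<phi>" for p r
  define W where "W q s = of_real s * dir q \<psi>" for q s
  define a where "a p r = dir p \<phi> * g (Z p r)" for p r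
  define b where "b q s = dir q \<psi> * h (W q s)" for q s
  define k where "k p q r s = cs (b q s * (a p r / (W q s - Z p r))) (K (Z p r))" for p q r s
  \<comment> \<open>Rays of the two angles are at distance at least
    \<open>\<delta> * (r + s)\<close>; the estimates use this in the forms
    \<open>\<delta> * r\<close> and \<open>\<delta> * s\<close>.\<close>
  define \<delta> where "\<delta> = sin ((\<psi> - \<phi>) / 2)"
  have \<delta>: "\<delta> > 0" unfolding \<delta>_def using ph \<phi> by (intro sin_gt_zero) auto
  have dist: "\<delta> * (r + s) \<le> cmod (Z p r - W q s)" if "p \<in> signs" "q \<in> signs" "r > 0" "s > 0" for p q r s
    unfolding \<delta>_def Z_def W_def using that ph by (intro ray_distance) auto
  have dist1: "\<delta> * s \<le> cmod (W q s - Z p r)" "\<delta> * r \<le> cmod (Z p r - W q s)" "W q s \<noteq> Z p r"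
    if "p \<in> signs" "q \<in> signs" "r > 0" "s > 0" for p q r s
  proof -
    have "\<delta> * s \<le> \<delta> * (r + s)" "\<delta> * r \<le> \<delta> * (r + s)" "0 < \<delta> * (r + s)" using that \<delta> by auto
    then show "\<delta> * s \<le> cmod (W q s - Z p r)" "\<delta> * r \<le> cmod (Z p r - W q s)" "W q s \<noteq> Z p r"
      using dist[OF that] by (auto simp: norm_minus_commute)
  qed
  have ac: "continuous_on {0<..} (a p)" if p: "p \<in> signs" for p
    unfolding a_def[abs_def] Z_def by (intro continuous_intros holomorphic_ray_continuous[OF holg p ph(1) \<phi>(4)])
  have bc: "continuous_on {0<..} (b q)" if q: "q \<in> signs" for q
    unfolding b_def[abs_def] W_def by (intro continuous_intros holomorphic_ray_continuous[OF holh q ph(3) \<phi>(4)])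
  have ab: "cmod (a p r) \<le> A * (r / (1 + r\<^sup>2))" if "p \<in> signs" "r > 0" for p r
    using strong_decay_ray[OF g that(1) ph(1) \<phi>(4) that(2)] by (simp add: a_def Z_def norm_mult norm_dir[OF that(1)])
  have bb: "cmod (b q s) \<le> A' * (s / (1 + s\<^sup>2))" if "q \<in> signs" "s > 0" for q s
    using strong_decay_ray[OF h that(1) ph(3) \<phi>(4) that(2)] by (simp add: b_def W_def norm_mult norm_dir[OF that(1)])
  have jP: "j o\<^sub>L P = P o\<^sub>L j"
    unfolding P_def by (rule bisector_integral_commute[OF g]) (use \<phi> in auto)
  have bKi: "(\<lambda>s. cs (b q s) (K (W q s))) integrable_on {0<..}" if q: "q \<in> signs" for q
    unfolding W_def by (rule cs_K_ray_integrable(2)[OF q ph(4) bc[OF q] bb[OF q] strong_decay_bound_integrable])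
  have W_loc: "W q s \<in> cobisector \<phi>" "W q s \<in> cobisector \<omega>" if "q \<in> signs" "s > 0" for q s
  proof -
    show "W q s \<in> cobisector \<omega>" unfolding W_def using ph that by (intro ray_cobisector) auto
    show "W q s \<in> cobisector \<phi>" unfolding W_def using ph that \<phi> by (intro ray_in_cobisector) auto
  qed
  have Kc: "continuous_on {0<..} (\<lambda>r. K (Z p r))" if p: "p \<in> signs" for p
    unfolding Z_def by (rule K_ray_continuous[OF p ph(2)])
  have kcont: "continuous_on ({0<..} \<times> {0<..}) (\<lambda>(r, s). k p q r s)" if p: "p \<in> signs" "q \<in> signs" for p q
    unfolding k_def case_prod_unfold
    by (intro cs.continuous_on continuous_on_mult continuous_on_divide continuous_on_diff
        continuous_on_compose2[OF ac[OF p(1)]] continuous_on_compose2[OF bc[OF p(2)]]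
        continuous_on_compose2[OF Kc[OF p(1)]])
       (use dist1(3)[OF p] in \<open>auto simp: W_def Z_def intro!: continuous_intros\<close>)
  \<comment> \<open>The factor \<open>s\<close> of the denominator is absorbed by the decay of
    \<open>h\<close>, the factor \<open>1 / r\<close> from \<open>K\<close> by that of
    \<open>g\<close>. What remains is a product of functions of one variable, as the interchange
    requires.\<close>
  have kdom: "norm (k p q r s) \<le> (B * C * A * (1 / (1 + r\<^sup>2))) * (A' / \<delta> * (1 / (1 + s\<^sup>2)))"
    if p: "p \<in> signs" "q \<in> signs" "r > 0" "s > 0" for p q r s
  proof -
    have "cmod (a p r) / cmod (W q s - Z p r) \<le> (A * (r / (1 + r\<^sup>2))) / (\<delta> * s)"
      using ab[OF p(1,3)] dist1[OF p] \<delta> p A by (intro frac_le) auto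
    then have "cmod (b q s * (a p r / (W q s - Z p r))) \<le> A' * (s / (1 + s\<^sup>2)) * ((A * (r / (1 + r\<^sup>2))) / (\<delta> * s))"
      unfolding norm_mult norm_divide using bb[OF p(2,4)] A p by (intro mult_mono) auto
    also have "\<dots> = A * (r / (1 + r\<^sup>2)) * (A' / \<delta> * (1 / (1 + s\<^sup>2)))" using p by (simp add: mult_ac)
    finally have "norm (k p q r s) \<le> B * C * (A * (r / (1 + r\<^sup>2)) * (A' / \<delta> * (1 / (1 + s\<^sup>2))) / r)"
      unfolding k_def Z_def by (rule cs_K_ray_bound[OF p(1) ph(2) p(3)])
    then show ?thesis using p by simp
  qed
  have bnd: "(\<lambda>r::real. c * (1 / (1 + r\<^sup>2))) integrable_on {0<..}" "continuous_on {0<..} (\<lambda>r::real. c * (1 / (1 + r\<^sup>2)))" for c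
    by (rule scaled_inverse_integrable) (intro continuous_intros; simp add: add_nonneg_eq_0_iff)
  have nonneg: "0 \<le> B * C * A * (1 / (1 + r\<^sup>2))" "0 \<le> A' / \<delta> * (1 / (1 + s\<^sup>2))" for r s
    using B_pos C_nonneg A \<delta> by (auto intro!: mult_nonneg_nonneg divide_nonneg_nonneg)
  have swap: "integral {0<..} (\<lambda>r. integral {0<..} (k p q r)) = integral {0<..} (\<lambda>s. integral {0<..} (\<lambda>r. k p q r s))"
    "(\<lambda>r. integral {0<..} (k p q r)) integrable_on {0<..}"
    "(\<lambda>s. integral {0<..} (\<lambda>r. k p q r s)) integrable_on {0<..}"
    if p: "p \<in> signs" "q \<in> signs" for p q
    by (rule integral_halfline_swap[OF kcont[OF p] kdom[OF p] bnd nonneg(1) bnd nonneg(2)]; assumption)+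
  have kslice: "k p q r integrable_on {0<..}" "(\<lambda>r. k p q r s) integrable_on {0<..}"
    if p: "p \<in> signs" "q \<in> signs" "r > 0" "s > 0" for p q r s
  proof -
    have "(\<lambda>s. (B * C * A * (1 / (1 + r\<^sup>2))) * (A' / \<delta> * (1 / (1 + s\<^sup>2)))) integrable_on {0<..}"
      using bnd(1)[of "(B * C * A * (1 / (1 + r\<^sup>2))) * (A' / \<delta>)"] by (simp only: mult.assoc)
    moreover have "continuous_on {0<..} (\<lambda>s. (\<lambda>(r, s). k p q r s) (r, s))"
      by (rule continuous_on_compose2[OF kcont[OF p(1,2)]]) (use p(3) in \<open>auto intro!: continuous_intros\<close>)
    ultimately show "k p q r integrable_on {0<..}"
      by (intro dominated_integrable_halfline[OF _ kdom[OF p(1,2,3)]]) simp_all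
    have "(\<lambda>r. (B * C * A * (1 / (1 + r\<^sup>2))) * (A' / \<delta> * (1 / (1 + s\<^sup>2)))) integrable_on {0<..}"
      using bnd(1)[of "(B * C * A) * (A' / \<delta> * (1 / (1 + s\<^sup>2)))"] by (simp only: mult_ac)
    moreover have "continuous_on {0<..} (\<lambda>r. (\<lambda>(r, s). k p q r s) (r, s))"
      by (rule continuous_on_compose2[OF kcont[OF p(1,2)]]) (use p(4) in \<open>auto intro!: continuous_intros\<close>)
    ultimately show "(\<lambda>r. k p q r s) integrable_on {0<..}"
      by (intro dominated_integrable_halfline[OF _ kdom[OF p(1,2) _ p(4)]]) simp_all
  qed
  have left: "P o\<^sub>L ray_integral j K h q \<psi> = cs \<kappa> (\<Sum>p\<in>signs. snd p *\<^sub>R integral {0<..} (\<lambda>s. integral {0<..} (\<lambda>r. k p q r s)))"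
    if q: "q \<in> signs" for q
  proof -
    have pt: "P o\<^sub>L cs (b q s) (K (W q s)) = cs \<kappa> (\<Sum>p\<in>signs. snd p *\<^sub>R integral {0<..} (\<lambda>r. k p q r s))" if s: "s > 0" for s
    proof -
      have PK: "P o\<^sub>L K (W q s) = cs \<kappa> (\<Sum>p\<in>signs. snd p *\<^sub>R
          integral {0<..} (\<lambda>r. cs (a p r / (W q s - Z p r)) (K (Z p r))))"
        unfolding P_def \<kappa>_def a_def Z_def
        by (rule strong_decay_compose_resolvent[OF g _ _ \<phi>(4) W_loc[OF q s] \<delta>])
           (use \<phi> dist1(2)[OF _ q _ s] in \<open>auto simp: Z_def\<close>)
      have "cs (b q s) (integral {0<..} (\<lambda>r. cs (a p r / (W q s - Z p r)) (K (Z p r)))) = integral {0<..} (\<lambda>r. k p q r s)"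
        if p: "p \<in> signs" for p
      \<comment> \<open>Integrability of the integrand without \<open>b q s\<close> is read off from
        that of \<open>k\<close> by dividing, which is legitimate unless \<open>b q s = 0\<close>;
        in that case both sides vanish.\<close>
      proof (cases "b q s = 0")
        case True
        then show ?thesis by (simp add: k_def cs.zero_left)
      next
        case False
        have "(\<lambda>r. cs (1 / b q s) (k p q r s)) integrable_on {0<..}"
          using integrable_linear[OF kslice(2)[OF p q zero_less_one s] cs.bounded_linear_right] by (simp add: o_def)
        then have "(\<lambda>r. cs (a p r / (W q s - Z p r)) (K (Z p r))) integrable_on {0<..}"
          using False by (simp add: k_def cs_cs)
        from integral_bounded_linear[OF this cs.bounded_linear_right[of "b q s"]] show ?thesis
          by (simp add: k_def cs_cs)
      qed
      then have "cs (b q s) (\<Sum>p\<in>signs. snd p *\<^sub>R integral {0<..} (\<lambda>r. cs (a p r / (W q s - Z p r)) (K (Z p r))))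
          = (\<Sum>p\<in>signs. snd p *\<^sub>R integral {0<..} (\<lambda>r. k p q r s))"
        unfolding cs.sum_right cs.scaleR_right by (intro sum.cong refl) simp
      then show ?thesis
        unfolding compose_cs[OF jP] PK cs_swap[of "b q s" \<kappa>] by (simp only:)
    qed
    have i: "(\<lambda>s. snd p *\<^sub>R integral {0<..} (\<lambda>r. k p q r s)) integrable_on {0<..}" if p: "p \<in> signs" for p
      using swap(3)[OF p q] by (intro integrable_cmul) auto
    have "P o\<^sub>L ray_integral j K h q \<psi> = integral {0<..} (\<lambda>s. P o\<^sub>L cs (b q s) (K (W q s)))"
      using integral_bounded_linear[OF bKi[OF q] compose_right_linear] by (simp add: ray_integral_def b_def W_def)
    also have "\<dots> = integral {0<..} (\<lambda>s. cs \<kappa> (\<Sum>p\<in>signs. snd p *\<^sub>R integral {0<..} (\<lambda>r. k p q r s)))"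
      by (rule integral_cong) (use pt in auto)
    also have "\<dots> = cs \<kappa> (integral {0<..} (\<lambda>s. \<Sum>p\<in>signs. snd p *\<^sub>R integral {0<..} (\<lambda>r. k p q r s)))"
      by (rule integral_bounded_linear[OF _ cs.bounded_linear_right, symmetric]) (intro integrable_sum i; simp)
    also have "integral {0<..} (\<lambda>s. \<Sum>p\<in>signs. snd p *\<^sub>R integral {0<..} (\<lambda>r. k p q r s))
        = (\<Sum>p\<in>signs. snd p *\<^sub>R integral {0<..} (\<lambda>s. integral {0<..} (\<lambda>r. k p q r s)))"
      by (subst integral_sum) (use i in auto)
    finally show ?thesis .
  qed
  have right: "(\<Sum>q\<in>signs. snd q *\<^sub>R integral {0<..} (\<lambda>r. integral {0<..} (k p q r))) = cs (2 * pi * \<i>) (ray_integral j K (\<lambda>z. g z * h z) p \<phi>)"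
    if p: "p \<in> signs" for p
  proof -
    have ghi: "(\<lambda>r. cs (dir p \<phi> * (g (Z p r) * h (Z p r))) (K (Z p r))) integrable_on {0<..}"
    proof -
      have "(\<lambda>r. A' * (A * (r / (1 + r\<^sup>2))) / r) integrable_on {0<..}"
        using strong_decay_bound_integrable[of "A' * A"] by (simp only: mult.assoc)
      then show ?thesis unfolding Z_def
      proof (rule cs_K_ray_integrable(2)[OF p ph(2), rotated 2])
        show "continuous_on {0<..} (\<lambda>r. dir p \<phi> * (g (of_real r * dir p \<phi>) * h (of_real r * dir p \<phi>)))"
          by (intro continuous_intros holomorphic_ray_continuous[OF holg p ph(1) \<phi>(4)] holomorphic_ray_continuous[OF holh p ph(1) \<phi>(4)])
        fix r :: real assume r: "r > 0"
        have "A' * (r / (1 + r\<^sup>2)) \<le> A' * 1"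
        proof (rule mult_left_mono[OF _ A(2)])
          have "0 \<le> (r - 1)\<^sup>2" by simp
          then have "r \<le> 1 + r\<^sup>2" using r unfolding power2_diff by simp
          then show "r / (1 + r\<^sup>2) \<le> 1" by (simp add: divide_le_eq_1 add_pos_nonneg)
        qed
        then have "cmod (h (of_real r * dir p \<phi>)) \<le> A'" using strong_decay_ray[OF h p ph(1) \<phi>(4) r] by simp
        then have "cmod (h (of_real r * dir p \<phi>)) * cmod (g (of_real r * dir p \<phi>)) \<le> A' * (A * (r / (1 + r\<^sup>2)))"
          using strong_decay_ray[OF g p ph(1) \<phi>(4) r] A by (intro mult_mono) auto
        then show "cmod (dir p \<phi> * (g (of_real r * dir p \<phi>) * h (of_real r * dir p \<phi>))) \<le> A' * (A * (r / (1 + r\<^sup>2)))"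
          by (simp add: norm_mult norm_dir[OF p] mult.commute)
      qed
    qed
    have pt: "(\<Sum>q\<in>signs. snd q *\<^sub>R integral {0<..} (k p q r)) = cs (2 * pi * \<i>) (cs (dir p \<phi> * (g (Z p r) * h (Z p r))) (K (Z p r)))"
      if r: "r > 0" for r
    proof -
      have qi: "(\<lambda>s. b q s / (W q s - Z p r)) integrable_on {0<..}" if q: "q \<in> signs" for q
      proof (rule dominated_integrable_halfline[OF _ _ bnd(1)[of "A' / \<delta>"]])
        show "continuous_on {0<..} (\<lambda>s. b q s / (W q s - Z p r))"
          using dist1(3)[OF p q r] by (intro continuous_intros bc[OF q]) (auto simp: W_def intro!: continuous_intros)
        show "cmod (b q s / (W q s - Z p r)) \<le> A' / \<delta> * (1 / (1 + s\<^sup>2))" if s: "s > 0" for s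
        proof -
          have "cmod (b q s) / cmod (W q s - Z p r) \<le> (A' * (s / (1 + s\<^sup>2))) / (\<delta> * s)"
            using bb[OF q s] dist1[OF p q r s] \<delta> s A by (intro frac_le) auto
          then show ?thesis using s by (simp add: norm_divide mult.commute)
        qed
      qed
      have "integral {0<..} (k p q r) = cs (a p r) (cs (integral {0<..} (\<lambda>s. b q s / (W q s - Z p r))) (K (Z p r)))"
        if q: "q \<in> signs" for q
      proof -
        have "bounded_linear (\<lambda>c. cs (a p r) (cs c (K (Z p r))))"
          by (rule bounded_linear_compose[OF cs.bounded_linear_right cs.bounded_linear_left])
        from integral_bounded_linear[OF qi[OF q] this] show ?thesis
          by (simp add: k_def[abs_def] cs_cs mult_ac)
      qed
      then have "(\<Sum>q\<in>signs. snd q *\<^sub>R integral {0<..} (k p q r))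
          = cs (a p r) (cs (\<Sum>q\<in>signs. of_real (snd q) * integral {0<..} (\<lambda>s. b q s / (W q s - Z p r))) (K (Z p r)))"
        unfolding cs.sum_left cs.sum_right cs_cs[of "of_real _", symmetric] cs_of_real cs.scaleR_right
        by (intro sum.cong refl) simp
      also have "(\<Sum>q\<in>signs. of_real (snd q) * integral {0<..} (\<lambda>s. b q s / (W q s - Z p r)))
          = (\<Sum>q\<in>signs. of_real (snd q) * integral {0<..} (\<lambda>s. h (of_real s * dir q \<psi>) / (of_real s * dir q \<psi> - Z p r) * dir q \<psi>))"
        by (simp add: b_def W_def mult.commute)
      also have "\<dots> = 2 * pi * \<i> * h (Z p r)"
      proof -
        have "Z p r \<in> bisector \<psi>" unfolding Z_def using ph \<phi> r p by (intro dir_bisector) auto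
        then show ?thesis
          using signs_Cauchy[OF h _ \<phi>(3,4) \<delta>, of "Z p r"] dist1(1)[OF p _ r] ph by (simp add: W_def)
      qed
      finally show ?thesis by (simp add: cs_cs a_def mult_ac)
    qed
    have "(\<Sum>q\<in>signs. snd q *\<^sub>R integral {0<..} (\<lambda>r. integral {0<..} (k p q r)))
        = integral {0<..} (\<lambda>r. \<Sum>q\<in>signs. snd q *\<^sub>R integral {0<..} (k p q r))"
      by (subst integral_sum) (use swap(2)[OF p] in \<open>auto intro!: integrable_cmul\<close>)
    also have "\<dots> = integral {0<..} (\<lambda>r. cs (2 * pi * \<i>) (cs (dir p \<phi> * (g (Z p r) * h (Z p r))) (K (Z p r))))"
      by (rule integral_cong) (use pt in auto)
    also have "\<dots> = cs (2 * pi * \<i>) (ray_integral j K (\<lambda>z. g z * h z) p \<phi>)"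
      using integral_bounded_linear[OF ghi cs.bounded_linear_right, of "2 * pi * \<i>"]
      by (simp add: ray_integral_def Z_def)
    finally show ?thesis .
  qed
  have "P o\<^sub>L bisector_integral j K h \<psi> = cs \<kappa> (\<Sum>q\<in>signs. snd q *\<^sub>R (P o\<^sub>L ray_integral j K h q \<psi>))"
    unfolding bisector_integral_def \<kappa>_def[symmetric] by (simp add: compose_cs[OF jP] compose_sum compose_bilinear)
  also have "(\<Sum>q\<in>signs. snd q *\<^sub>R (P o\<^sub>L ray_integral j K h q \<psi>))
      = cs \<kappa> (\<Sum>q\<in>signs. \<Sum>p\<in>signs. (snd q * snd p) *\<^sub>R integral {0<..} (\<lambda>s. integral {0<..} (\<lambda>r. k p q r s)))"
    by (simp only: left cs.scaleR_right[symmetric] cs.sum_right[symmetric] scaleR_sum_right scaleR_scaleR cong: sum.cong)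
  also have "(\<Sum>q\<in>signs. \<Sum>p\<in>signs. (snd q * snd p) *\<^sub>R integral {0<..} (\<lambda>s. integral {0<..} (\<lambda>r. k p q r s)))
      = (\<Sum>q\<in>signs. \<Sum>p\<in>signs. (snd q * snd p) *\<^sub>R integral {0<..} (\<lambda>r. integral {0<..} (k p q r)))"
    by (intro sum.cong refl) (simp only: swap(1))
  also have "\<dots> = (\<Sum>p\<in>signs. snd p *\<^sub>R (\<Sum>q\<in>signs. snd q *\<^sub>R integral {0<..} (\<lambda>r. integral {0<..} (k p q r))))"
    unfolding scaleR_sum_right scaleR_scaleR by (subst sum.swap) (simp only: mult.commute)
  also have "\<dots> = (\<Sum>p\<in>signs. snd p *\<^sub>R cs (2 * pi * \<i>) (ray_integral j K (\<lambda>z. g z * h z) p \<phi>))"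
    by (intro sum.cong refl) (simp only: right)
  also have "\<dots> = cs (2 * pi * \<i>) (\<Sum>p\<in>signs. snd p *\<^sub>R ray_integral j K (\<lambda>z. g z * h z) p \<phi>)"
    by (simp only: cs.sum_right cs.scaleR_right)
  finally show ?thesis
    unfolding P_def bisector_integral_def \<kappa>_def cs_cs by simp
qed

section \<open>From strong decay to integrability along rays\<close>

lemma bisector_integral_independent_aux:
  assumes h: "ray_decay \<theta> h" and \<phi>: "\<omega> < \<phi>1" "\<phi>1 \<le> \<phi>2" "\<phi>2 < \<theta>" "\<theta> < pi / 2"
  shows "bisector_integral j K h \<phi>1 = bisector_integral j K h \<phi>2"
proof -
  have \<theta>: "\<theta> \<in> {0<..<pi/2}" using \<phi> \<omega> by auto
  have "ray_integral j K (\<lambda>z. h z * regularizer k z) p \<phi>1 = ray_integral j K (\<lambda>z. h z * regularizer k z) p \<phi>2"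
    if "p \<in> signs" for k p
    using ray_decay_regularized[OF h \<theta>, of k] strong_decay_independent[OF _ \<phi> that] by blast
  then have eq: "bisector_integral j K (\<lambda>z. h z * regularizer k z) \<phi>1 = bisector_integral j K (\<lambda>z. h z * regularizer k z) \<phi>2" for k
    unfolding bisector_integral_def by (simp cong: sum.cong)
  have lim: "(\<lambda>k. bisector_integral j K (\<lambda>z. h z * regularizer k z) \<phi>) \<longlonglongrightarrow> bisector_integral j K h \<phi>"
    if "\<omega> < \<phi>" "\<phi> < \<theta>" for \<phi>
    by (rule bisector_integral_limit[OF h that \<phi>(4) regularizer_holomorphic[OF \<theta>] regularizer_bounds(1)[OF \<theta>]])
       (auto intro!: regularizer_tendsto simp: bisector_def)
  show ?thesis
    using LIMSEQ_unique[OF lim[of \<phi>1] lim[of \<phi>2, folded eq]] \<phi> by simp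
qed

lemma bisector_integral_independent:
  assumes h: "ray_decay \<theta> h" and \<phi>: "\<omega> < \<phi>1" "\<phi>1 < \<theta>" "\<omega> < \<phi>2" "\<phi>2 < \<theta>" "\<theta> < pi / 2"
  shows "bisector_integral j K h \<phi>1 = bisector_integral j K h \<phi>2"
proof (cases "\<phi>1 \<le> \<phi>2")
  case True
  then show ?thesis using bisector_integral_independent_aux[OF h \<phi>(1) _ \<phi>(4,5)] by blast
next
  case False
  then have "\<phi>2 \<le> \<phi>1" by simp
  from bisector_integral_independent_aux[OF h \<phi>(3) this \<phi>(2,5)] show ?thesis by (rule sym)
qed

text \<open>The rule for strongly decaying functions takes two angles, so \<open>h\<close> is
  integrated at \<open>\<psi> > \<phi>\<close> and moved back to \<open>\<phi>\<close> at the end by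
  independence. Regularising both factors multiplies the product by the square of the regulariser,
  which also tends to 1 and has the squared bound.\<close>

lemma bisector_integral_product:
  assumes g: "ray_decay \<theta> g" and h: "ray_decay \<theta> h" and \<phi>: "\<omega> < \<phi>" "\<phi> < \<theta>" "\<theta> < pi / 2"
  shows "bisector_integral j K g \<phi> o\<^sub>L bisector_integral j K h \<phi> = bisector_integral j K (\<lambda>z. g z * h z) \<phi>"
proof -
  have \<theta>: "\<theta> \<in> {0<..<pi/2}" using \<phi> \<omega> by auto
  define \<psi> where "\<psi> = (\<phi> + \<theta>) / 2"
  have \<psi>: "\<phi> < \<psi>" "\<psi> < \<theta>" "\<omega> < \<psi>" using \<phi> by (auto simp: \<psi>_def)
  define e where "e = regularizer"
  note e = regularizer_holomorphic[OF \<theta>, folded e_def] regularizer_bounds(1)[OF \<theta>, folded e_def]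
  have e1: "(\<lambda>k. e k z) \<longlonglongrightarrow> 1" if "z \<in> bisector \<theta>" for z
    unfolding e_def using that by (intro regularizer_tendsto) (auto simp: bisector_def)
  have lg: "(\<lambda>k. bisector_integral j K (\<lambda>z. g z * e k z) \<phi>) \<longlonglongrightarrow> bisector_integral j K g \<phi>"
    by (rule bisector_integral_limit[OF g \<phi> e e1])
  have lh: "(\<lambda>k. bisector_integral j K (\<lambda>z. h z * e k z) \<psi>) \<longlonglongrightarrow> bisector_integral j K h \<psi>"
    by (rule bisector_integral_limit[OF h \<psi>(3,2) \<phi>(3) e e1])
  have "(\<lambda>k. bisector_integral j K (\<lambda>z. g z * h z * (e k z * e k z)) \<phi>) \<longlonglongrightarrow> bisector_integral j K (\<lambda>z. g z * h z) \<phi>"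
  proof (rule bisector_integral_limit[OF ray_decay_mult[OF g h \<phi>(3)] \<phi>])
    show "(\<lambda>z. e k z * e k z) holomorphic_on bisector \<theta>" for k by (intro holomorphic_intros e)
    show "cmod (e k z * e k z) \<le> 1 / (cos \<theta>)\<^sup>2 * (1 / (cos \<theta>)\<^sup>2)" if "z \<in> bisector \<theta>" for k z
      unfolding norm_mult by (intro mult_mono e that) auto
    show "(\<lambda>k. e k z * e k z) \<longlonglongrightarrow> 1" if "z \<in> bisector \<theta>" for z
      using tendsto_mult[OF e1[OF that] e1[OF that]] by simp
  qed
  moreover have "bisector_integral j K (\<lambda>z. g z * e k z) \<phi> o\<^sub>L bisector_integral j K (\<lambda>z. h z * e k z) \<psi>
      = bisector_integral j K (\<lambda>z. g z * h z * (e k z * e k z)) \<phi>" for k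
  proof -
    obtain A A' where "strong_decay \<theta> A (\<lambda>z. g z * e k z)" "strong_decay \<theta> A' (\<lambda>z. h z * e k z)"
      using ray_decay_regularized[OF g \<theta>, of k] ray_decay_regularized[OF h \<theta>, of k] unfolding e_def by blast
    from strong_decay_product[OF this \<phi>(1) \<psi>(1,2) \<phi>(3)] show ?thesis by (simp add: mult_ac)
  qed
  ultimately have "bisector_integral j K g \<phi> o\<^sub>L bisector_integral j K h \<psi> = bisector_integral j K (\<lambda>z. g z * h z) \<phi>"
    using bounded_bilinear.tendsto[OF bounded_bilinear_blinfun_compose lg lh] LIMSEQ_unique by fastforce
  then show ?thesis using bisector_integral_independent[OF h \<psi>(3,2) \<phi>] by simp
qed

end

section \<open>Clifford algebra and Clifford modules\<close>

lemma sym_diff_eq_iff: "C = sym_diff A B \<longleftrightarrow> B = sym_diff A C" "C = sym_diff A B \<longleftrightarrow> A = sym_diff C B"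
  by blast+

lemma lmult_nth:
  fixes v :: "('v::real_vector, 'n::{finite,linorder}) cmodule"
  shows "lmult a v $ C = (\<Sum>A\<in>UNIV. (csign A (sym_diff A C) * a $ A) *\<^sub>R v $ (sym_diff A C))"
proof -
  have "(\<Sum>B\<in>UNIV. axis (sym_diff A B) ((csign A B * a $ A) *\<^sub>R v $ B) $ C)
      = (csign A (sym_diff A C) * a $ A) *\<^sub>R v $ (sym_diff A C)" for A
    by (simp only: axis_def vec_lambda_beta sym_diff_eq_iff(1)[of C] sum.delta finite UNIV_I if_True)
  then show ?thesis unfolding lmult_def by (simp only: sum_component)
qed

lemma rmult_nth:
  fixes v :: "('v::real_vector, 'n::{finite,linorder}) cmodule"
  shows "rmult v a $ C = (\<Sum>A\<in>UNIV. (csign (sym_diff C A) A * a $ A) *\<^sub>R v $ (sym_diff C A))"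
proof -
  have "(\<Sum>B\<in>UNIV. axis (sym_diff B A) ((csign B A * a $ A) *\<^sub>R v $ B) $ C)
      = (csign (sym_diff C A) A * a $ A) *\<^sub>R v $ (sym_diff C A)" for A
    by (simp only: axis_def vec_lambda_beta sym_diff_eq_iff(2)[of C] sum.delta finite UNIV_I if_True)
  then show ?thesis unfolding rmult_def by (subst sum.swap) (simp only: sum_component)
qed

lemma abs_csign: "\<bar>csign A B\<bar> = 1"
proof -
  have "(csign A B)\<^sup>2 = 1" by (simp add: power2_eq_square csign_square)
  then show ?thesis using abs_square_eq_1 by blast
qed

lemma norm_le_sum_nth: "norm (v :: ('v::real_normed_vector, 'm::finite) vec) \<le> (\<Sum>i\<in>UNIV. norm (v $ i))"
  unfolding norm_vec_def by (rule L2_set_le_sum) simp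

lemma bounded_bilinear_lmult:
  "bounded_bilinear (lmult :: 'n clifford \<Rightarrow> ('v::real_normed_vector, 'n::{finite,linorder}) cmodule \<Rightarrow> _)"
proof
  fix a a' :: "'n clifford" and v v' :: "('v, 'n) cmodule" and r :: real
  show "lmult (a + a') v = lmult a v + lmult a' v"
    by (simp add: vec_eq_iff lmult_nth algebra_simps sum.distrib)
  show "lmult a (v + v') = lmult a v + lmult a v'"
    by (simp add: vec_eq_iff lmult_nth algebra_simps sum.distrib)
  show "lmult (r *\<^sub>R a) v = r *\<^sub>R lmult a v"
    by (simp add: vec_eq_iff lmult_nth scaleR_sum_right mult_ac)
  show "lmult a (r *\<^sub>R v) = r *\<^sub>R lmult a v"
    by (simp add: vec_eq_iff lmult_nth scaleR_sum_right mult_ac)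
  have "norm (lmult a v) \<le> norm a * norm v * (real CARD('n set) * real CARD('n set))"
    for a :: "'n clifford" and v :: "('v, 'n) cmodule"
  proof -
    have nth: "norm (lmult a v $ C) \<le> (\<Sum>A\<in>(UNIV::'n set set). norm a * norm v)" for C
      unfolding lmult_nth
      by (rule sum_norm_le) (auto simp: abs_mult abs_csign intro!: mult_mono component_le_norm_cart Finite_Cartesian_Product.norm_nth_le)
    have "norm (lmult a v) \<le> (\<Sum>C\<in>UNIV. norm (lmult a v $ C))" by (rule norm_le_sum_nth)
    also have "\<dots> \<le> (\<Sum>C\<in>(UNIV::'n set set). \<Sum>A\<in>(UNIV::'n set set). norm a * norm v)"
      by (rule sum_mono[OF nth])
    finally show ?thesis by (simp add: mult_ac)
  qed
  then show "\<exists>K. \<forall>a v. norm (lmult a v :: ('v, 'n) cmodule) \<le> norm a * norm v * K" by blast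
qed

lemma bounded_linear_rmult:
  "bounded_linear (\<lambda>v :: ('v::real_normed_vector, 'n::{finite,linorder}) cmodule. rmult v a)"
proof (rule bounded_linear_intro)
  fix v v' :: "('v, 'n) cmodule" and r :: real
  show "rmult (v + v') a = rmult v a + rmult v' a"
    by (simp add: vec_eq_iff rmult_nth algebra_simps sum.distrib)
  show "rmult (r *\<^sub>R v) a = r *\<^sub>R rmult v a"
    by (simp add: vec_eq_iff rmult_nth scaleR_sum_right mult_ac)
  have nth: "norm (rmult v a $ C) \<le> (\<Sum>A\<in>(UNIV::'n set set). norm a * norm v)" for C
    unfolding rmult_nth
    by (rule sum_norm_le) (auto simp: abs_mult abs_csign intro!: mult_mono component_le_norm_cart Finite_Cartesian_Product.norm_nth_le)
  have "norm (rmult v a) \<le> (\<Sum>C\<in>UNIV. norm (rmult v a $ C))" by (rule norm_le_sum_nth)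
  also have "\<dots> \<le> (\<Sum>C\<in>(UNIV::'n set set). \<Sum>A\<in>(UNIV::'n set set). norm a * norm v)"
    by (rule sum_mono[OF nth])
  finally show "norm (rmult v a) \<le> norm v * (norm a * real CARD('n set) * real CARD('n set))"
    by (simp add: mult_ac)
qed

interpretation lmult: bounded_bilinear
  "lmult :: 'n clifford \<Rightarrow> ('v::real_normed_vector, 'n::{finite,linorder}) cmodule \<Rightarrow> ('v, 'n) cmodule"
  by (rule bounded_bilinear_lmult)

text \<open>The algebra is its own Clifford module with real coefficients, where
  \<open>lmult\<close> is the product; associativity is later inherited from the module in the same
  way.\<close>

interpretation cmult: bounded_bilinear "(\<odot>) :: 'n::{finite,linorder} clifford \<Rightarrow> _"
  using bounded_bilinear_lmult[where 'v=real and 'n='n] unfolding lmult_real[abs_def] .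

lemma clifford_expand: "(a :: 'n::finite clifford) = (\<Sum>A\<in>UNIV. a $ A *\<^sub>R basis_elt A)"
  by (simp add: vec_eq_iff basis_elt_def axis_def if_distrib cong: if_cong)

lemma lmult_basis_nth:
  fixes v :: "('v::real_vector, 'n::{finite,linorder}) cmodule"
  shows "lmult (basis_elt A) v $ C = csign A (sym_diff A C) *\<^sub>R v $ (sym_diff A C)"
proof -
  have "(csign B (sym_diff B C) * basis_elt A $ B) *\<^sub>R v $ (sym_diff B C)
      = (if B = A then csign A (sym_diff A C) *\<^sub>R v $ (sym_diff A C) else 0)" for B
    by (simp add: basis_elt_def axis_def)
  then show ?thesis unfolding lmult_nth by (simp only: sum.delta finite UNIV_I if_True)
qed

lemma rmult_basis_nth:
  fixes v :: "('v::real_vector, 'n::{finite,linorder}) cmodule"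
  shows "rmult v (basis_elt A) $ C = csign (sym_diff C A) A *\<^sub>R v $ (sym_diff C A)"
proof -
  have "(csign (sym_diff C B) B * basis_elt A $ B) *\<^sub>R v $ (sym_diff C B)
      = (if B = A then csign (sym_diff C A) A *\<^sub>R v $ (sym_diff C A) else 0)" for B
    by (simp add: basis_elt_def axis_def)
  then show ?thesis unfolding rmult_nth by (simp only: sum.delta finite UNIV_I if_True)
qed

text \<open>\<open>csign\<close> is multiplicative for symmetric differences in each argument, and
  such a sign satisfies the cocycle identity that associativity demands; the equations
  \<open>e\<close> identify the index sets.\<close>

lemma lmult_basis_basis:
  fixes v :: "('v::real_normed_vector, 'n::{finite,linorder}) cmodule"
  shows "lmult (basis_elt A) (lmult (basis_elt B) v) = lmult (basis_elt A \<odot> basis_elt B) v"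
proof -
  have e: "sym_diff B (sym_diff A C) = sym_diff (sym_diff A B) C"
    "sym_diff A C = sym_diff B (sym_diff (sym_diff A B) C)" for C by blast+
  have "csign A (sym_diff A C) * csign B (sym_diff B (sym_diff A C))
      = csign A B * csign (sym_diff A B) (sym_diff (sym_diff A B) C)" for C
    unfolding csign_sym_diff_left[of A B] e(1)
    by (subst e(2), subst csign_sym_diff_right) simp
  then show ?thesis
    unfolding basis_elt_mult lmult.scaleR_left vec_eq_iff vector_scaleR_component lmult_basis_nth scaleR_scaleR e(1)
    by simp
qed

lemma lmult_lmult:
  fixes v :: "('v::real_normed_vector, 'n::{finite,linorder}) cmodule"
  shows "lmult a (lmult b v) = lmult (a \<odot> b) v"
proof -
  have "lmult a (lmult b v) = (\<Sum>A\<in>UNIV. \<Sum>B\<in>UNIV. (a $ A * b $ B) *\<^sub>R lmult (basis_elt A) (lmult (basis_elt B) v))"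
    by (subst sum.swap, subst (1) clifford_expand[of a], subst (1) clifford_expand[of b])
       (simp only: lmult.sum_left lmult.sum_right lmult.scaleR_left lmult.scaleR_right scaleR_sum_right scaleR_scaleR mult.commute)
  also have "\<dots> = lmult (a \<odot> b) v"
    unfolding lmult_basis_basis
    by (subst (2) clifford_expand[of a], subst (2) clifford_expand[of b], subst sum.swap)
       (simp only: lmult.sum_left cmult.sum_left cmult.sum_right cmult.scaleR_left cmult.scaleR_right lmult.scaleR_left scaleR_sum_right scaleR_scaleR mult.commute)
  finally show ?thesis .
qed

lemma cmult_assoc: "(a \<odot> b) \<odot> c = a \<odot> (b \<odot> c)"
  using lmult_lmult[where 'v=real, of a b c] by (simp add: lmult_real)

lemma csign_empty: "csign {} A = 1" "csign A {} = 1"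
  by (simp_all add: csign_def)

lemma lmult_one: "lmult (basis_elt {}) v = v" and rmult_one: "rmult v (basis_elt {}) = v"
  by (simp_all add: vec_eq_iff lmult_basis_nth rmult_basis_nth csign_empty)

lemma cmult_one: "basis_elt {} \<odot> a = a" "a \<odot> basis_elt {} = a"
  using lmult_one[of a] rmult_one[of a] by (simp_all add: lmult_real rmult_real)

lemma lmult_creal: "lmult (creal c) v = c *\<^sub>R (v :: ('v::real_normed_vector, 'n::{finite,linorder}) cmodule)"
  by (simp add: creal_def lmult.scaleR_left lmult_one)

lemma rmult_creal: "rmult v (creal c) = c *\<^sub>R (v :: ('v::real_normed_vector, 'n::{finite,linorder}) cmodule)"
proof -
  have "rmult v (creal c) = c *\<^sub>R rmult v (basis_elt {})"
    by (simp add: vec_eq_iff rmult_nth creal_def scaleR_sum_right mult.left_commute)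
  then show ?thesis by (simp add: rmult_one)
qed

lemma cmult_creal: "creal c \<odot> a = c *\<^sub>R a" "a \<odot> creal c = c *\<^sub>R a"
  by (simp_all add: creal_def cmult.scaleR_left cmult.scaleR_right cmult_one)

lemma rmult_generator_square:
  "rmult (rmult v (basis_elt {i})) (basis_elt {i}) = - (v :: ('v::real_normed_vector, 'n::{finite,linorder}) cmodule)"
proof -
  have "csign (sym_diff C {i}) {i} * csign C {i} = - 1" for C :: "'n set"
    unfolding csign_sym_diff_left by (simp add: csign_square csign_def[of "{i}"] mult_ac)
  moreover have "sym_diff (sym_diff C {i}) {i} = C" for C by blast
  ultimately show ?thesis unfolding vec_eq_iff rmult_basis_nth by simp
qed

text \<open>Doubling the square symmetrises the double sum: for two distinct generators the terms
  cancel by anticommutation, and a single one gives \<open>- 2 (J $ A)\<^sup>2\<close>. The squares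
  add up to the square of \<open>norm J\<close>, that is to 1.\<close>

lemma imag_sphere_square:
  assumes "J \<in> imag_sphere"
  shows "J \<odot> J = - basis_elt {}"
proof -
  define F where "F A B = (J $ A * J $ B) *\<^sub>R (basis_elt A \<odot> basis_elt B)" for A B
  \<comment> \<open>Paravectors have components only at sets of at most one element; together with
    \<open>J0\<close> this leaves the generators.\<close>
  have card: "A = {} \<or> (\<exists>i. A = {i})" if "J $ A \<noteq> 0" for A
    using assms that unfolding imag_sphere_def paravectors_def
    by (metis (mono_tags, lifting) card_1_singletonE card_gt_0_iff finite le_Suc_eq le_zero_eq mem_Collect_eq One_nat_def card_0_eq)
  have J0: "J $ {} = 0" and n1: "norm J = 1" using assms by (auto simp: imag_sphere_def)
  have JJ: "J \<odot> J = (\<Sum>A\<in>UNIV. \<Sum>B\<in>UNIV. F A B)"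
    unfolding F_def
    by (subst sum.swap, subst (1) clifford_expand[of J], subst (2) clifford_expand[of J])
       (simp only: cmult.sum_left cmult.sum_right cmult.scaleR_left cmult.scaleR_right scaleR_sum_right scaleR_scaleR mult.commute)
  have FF: "F A B + F B A = (if B = A then - (2 * (J $ A)\<^sup>2) *\<^sub>R basis_elt {} else 0)" for A B
  proof (cases "J $ A = 0 \<or> J $ B = 0")
    case True
    then show ?thesis by (auto simp: F_def)
  next
    case False
    then obtain i k where ik: "A = {i}" "B = {k}" using card J0 by metis
    show ?thesis
    proof (cases "i = k")
      case True
      then have "F A B + F B A = 2 *\<^sub>R F A A" by (simp only: ik scaleR_2)
      also have "F A A = - (J $ A)\<^sup>2 *\<^sub>R basis_elt {}" by (simp add: F_def ik generator_square power2_eq_square)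
      finally show ?thesis using True ik by simp
    next
      case False
      then show ?thesis using generators_anticommute[OF False] by (simp add: F_def ik mult.commute)
    qed
  qed
  have "J \<odot> J + J \<odot> J = (\<Sum>A\<in>UNIV. \<Sum>B\<in>UNIV. F A B + F B A)"
    unfolding sum.distrib JJ by (subst (4) sum.swap) simp
  also have "\<dots> = (\<Sum>A\<in>UNIV. - (2 * (J $ A)\<^sup>2) *\<^sub>R basis_elt {})"
    unfolding FF by (simp only: sum.delta finite UNIV_I if_True)
  also have "\<dots> = - (2 * (\<Sum>A\<in>UNIV. (J $ A)\<^sup>2)) *\<^sub>R basis_elt {}"
    by (simp add: sum_distrib_left sum_negf scaleR_sum_left)
  also have "(\<Sum>A\<in>UNIV. (J $ A)\<^sup>2) = 1"
    using n1 by (simp add: norm_vec_def L2_set_def)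
  finally have "2 *\<^sub>R (J \<odot> J) = 2 *\<^sub>R (- basis_elt {})" by (simp add: scaleR_2)
  then show ?thesis by (simp only: scaleR_cancel_left) simp
qed

lemma generator_in_imag_sphere: "basis_elt {i} \<in> imag_sphere"
proof -
  have "norm (basis_elt {i}) = 1" unfolding basis_elt_def by (simp add: norm_eq_1 inner_axis_axis)
  then show ?thesis by (auto simp: imag_sphere_def paravectors_def basis_elt_def axis_def)
qed

lemma imag_sphere_nonempty: "\<exists>J :: 'n::finite clifford. J \<in> imag_sphere"
  using generator_in_imag_sphere by blast

lemma slice_point_scalar: "J \<in> imag_sphere \<Longrightarrow> slice_point J x y $ {} = x"
  by (simp add: slice_point_def creal_def basis_elt_def imag_sphere_def)

lemma slice_point_paravector: "J \<in> imag_sphere \<Longrightarrow> slice_point J x y \<in> paravectors"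
  by (auto simp: slice_point_def creal_def basis_elt_def imag_sphere_def paravectors_def axis_def split: if_splits)

lemma norm_slice_point:
  assumes "J \<in> imag_sphere"
  shows "(norm (slice_point J x y))\<^sup>2 = x\<^sup>2 + y\<^sup>2"
proof -
  have J: "J $ {} = 0" "J \<bullet> J = 1" using assms by (auto simp: imag_sphere_def dot_square_norm)
  have b: "basis_elt {} \<bullet> J = 0" unfolding basis_elt_def by (simp add: inner_axis' J)
  then have "J \<bullet> basis_elt {} = 0" by (simp only: inner_commute)
  note b this
  moreover have "basis_elt {} \<bullet> (basis_elt {} :: 'a clifford) = 1" unfolding basis_elt_def by (simp add: inner_axis_axis)
  ultimately show ?thesis
    unfolding power2_norm_eq_inner slice_point_def creal_def
    by (simp add: inner_add_left inner_add_right J power2_eq_square)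
qed

lemma norm_slice_point_cmod: "J \<in> imag_sphere \<Longrightarrow> norm (slice_point J (Re z) (Im z)) = cmod z"
  using norm_slice_point[of J "Re z" "Im z"] by (simp add: cmod_def real_sqrt_unique)

lemma pconj_slice_point:
  assumes "J \<in> imag_sphere"
  shows "pconj (slice_point J x y) = slice_point J x (- y)"
  using assms by (auto simp: vec_eq_iff pconj_def slice_point_def creal_def basis_elt_def axis_def imag_sphere_def)

section \<open>Complex structure and the S-resolvent\<close>

lemma angles_sin_cos:
  assumes "\<omega> \<in> {0<..<pi/2}" "\<phi> \<in> angles \<omega>"
  shows "cos \<omega> * \<bar>sin \<phi>\<bar> < sin \<omega> * \<bar>cos \<phi>\<bar>"
proof -
  have *: "cos \<omega> * \<bar>sin \<phi>\<bar> < sin \<omega> * \<bar>cos \<phi>\<bar>" if "\<bar>\<phi>\<bar> < \<omega>" for \<phi>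
  proof -
    have "0 < sin (\<omega> - \<bar>\<phi>\<bar>)" using assms that by (intro sin_gt_zero) auto
    moreover have "sin \<bar>\<phi>\<bar> = \<bar>sin \<phi>\<bar>"
    proof (cases "\<phi> \<ge> 0")
      case True
      then show ?thesis using assms(1) that sin_ge_zero[of \<phi>] by simp
    next
      case False
      then show ?thesis using assms(1) that sin_gt_zero[of "- \<phi>"] by simp
    qed
    moreover have "0 < cos \<bar>\<phi>\<bar>" using assms(1) that by (intro cos_gt_zero_pi) auto
    ultimately show ?thesis by (simp add: sin_diff mult.commute)
  qed
  show ?thesis
  proof (cases "\<bar>\<phi>\<bar> < \<omega>")
    case True
    then show ?thesis by (rule *)
  next
    case False
    then have "\<bar>\<phi> - pi\<bar> < \<omega>" using assms(2) by (auto simp: angles_def)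
    from *[OF this] show ?thesis by simp
  qed
qed

lemma sector_polar:
  assumes \<theta>: "\<theta> \<in> {0<..<pi/2}" and xy: "cos \<theta> * \<bar>y\<bar> < sin \<theta> * x"
  shows "\<exists>r \<phi>. r > 0 \<and> \<bar>\<phi>\<bar> < \<theta> \<and> x = r * cos \<phi> \<and> y = r * sin \<phi>"
proof -
  define z where "z = Complex x y"
  have c: "cos \<theta> > 0" "sin \<theta> > 0" using \<theta> by (auto intro: cos_gt_zero sin_gt_zero)
  have "0 \<le> cos \<theta> * \<bar>y\<bar>" using c by simp
  then have "0 < sin \<theta> * x" using xy by linarith
  then have x: "x > 0" using c by (simp add: zero_less_mult_iff)
  then have z0: "z \<noteq> 0" by (auto simp: z_def complex_eq_iff)
  have zz: "x = cmod z * cos (Arg z)" "y = cmod z * sin (Arg z)"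
    using arg_cong[OF rcis_cmod_Arg[of z], of Re] arg_cong[OF rcis_cmod_Arg[of z], of Im] by (simp_all add: z_def)
  have ar: "\<bar>Arg z\<bar> < pi / 2" using Arg_Re_pos[of z] x by (simp add: z_def)
  have r: "cmod z > 0" using z0 by simp
  have "sin \<bar>Arg z\<bar> = \<bar>sin (Arg z)\<bar>"
  proof (cases "Arg z \<ge> 0")
    case True
    then show ?thesis using ar sin_ge_zero[of "Arg z"] by simp
  next
    case False
    then show ?thesis using ar sin_gt_zero[of "- Arg z"] by simp
  qed
  then have "\<bar>y\<bar> = cmod z * sin \<bar>Arg z\<bar>" using zz(2) r by (metis abs_mult abs_norm_cancel)
  moreover have "x = cmod z * cos \<bar>Arg z\<bar>" using zz(1) by simp
  ultimately have "cmod z * (cos \<theta> * sin \<bar>Arg z\<bar>) < cmod z * (sin \<theta> * cos \<bar>Arg z\<bar>)"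
    using xy by (metis mult.left_commute)
  then have "0 < sin (\<theta> - \<bar>Arg z\<bar>)" using r by (simp add: sin_diff mult.commute)
  then have "\<bar>Arg z\<bar> < \<theta>"
    using ar \<theta> sin_ge_zero[of "\<bar>Arg z\<bar> - \<theta>"] sin_minus[of "\<theta> - \<bar>Arg z\<bar>"] by fastforce
  then show ?thesis using zz r by blast
qed

text \<open>The scalar part and the norm of the rest determine \<open>x\<close> and
  \<open>\<bar>y\<bar>\<close>, so a representation with another unit \<open>I\<close> gives the
  same inequality. Conversely, polar coordinates provide the angle, near 0 if \<open>x\<close> is
  nonnegative and near \<open>pi\<close>, after changing both signs, otherwise.\<close>

lemma slice_point_in_double_sector_iff:
  assumes \<theta>: "\<theta> \<in> {0<..<pi/2}" and J: "J \<in> imag_sphere"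
  shows "slice_point J x y \<in> double_sector \<theta> \<longleftrightarrow> cos \<theta> * \<bar>y\<bar> < sin \<theta> * \<bar>x\<bar>"
proof
  assume "slice_point J x y \<in> double_sector \<theta>"
  then obtain r I \<phi> where r: "r > 0" "I \<in> imag_sphere" "\<phi> \<in> angles \<theta>"
    and eq: "slice_point J x y = r *\<^sub>R slice_point I (cos \<phi>) (sin \<phi>)"
    unfolding double_sector_def cexp_def by blast
  have eq': "slice_point J x y = slice_point I (r * cos \<phi>) (r * sin \<phi>)"
    unfolding eq by (simp add: slice_point_def creal_def algebra_simps)
  have x: "x = r * cos \<phi>" using arg_cong[OF eq', of "\<lambda>s. s $ {}"] J r by (simp add: slice_point_scalar)
  then have "y *\<^sub>R J = (r * sin \<phi>) *\<^sub>R I" using eq' by (simp add: slice_point_def)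
  then have "norm (y *\<^sub>R J) = norm ((r * sin \<phi>) *\<^sub>R I)" by simp
  then have y: "\<bar>y\<bar> = r * \<bar>sin \<phi>\<bar>" using J r by (simp add: imag_sphere_def abs_mult)
  have "r * (cos \<theta> * \<bar>sin \<phi>\<bar>) < r * (sin \<theta> * \<bar>cos \<phi>\<bar>)"
    using angles_sin_cos[OF \<theta> r(3)] r(1) by simp
  then show "cos \<theta> * \<bar>y\<bar> < sin \<theta> * \<bar>x\<bar>" unfolding x y using r(1) by (simp add: abs_mult mult_ac)
next
  assume a: "cos \<theta> * \<bar>y\<bar> < sin \<theta> * \<bar>x\<bar>"
  have "\<exists>r \<phi>. r > 0 \<and> \<phi> \<in> angles \<theta> \<and> x = r * cos \<phi> \<and> y = r * sin \<phi>"
  proof (cases "x \<ge> 0")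
    case True
    then obtain r \<phi> where "r > 0 \<and> \<bar>\<phi>\<bar> < \<theta> \<and> x = r * cos \<phi> \<and> y = r * sin \<phi>"
      using sector_polar[OF \<theta>, of y x] a by auto
    then show ?thesis by (intro exI[of _ r] exI[of _ \<phi>]) (auto simp: angles_def)
  next
    case False
    then obtain r \<phi> where "r > 0 \<and> \<bar>\<phi>\<bar> < \<theta> \<and> - x = r * cos \<phi> \<and> - y = r * sin \<phi>"
      using sector_polar[OF \<theta>, of "- y" "- x"] a by auto
    then show ?thesis by (intro exI[of _ r] exI[of _ "\<phi> + pi"]) (auto simp: angles_def)
  qed
  then obtain r \<phi> where r: "r > 0" "\<phi> \<in> angles \<theta>" "x = r * cos \<phi>" "y = r * sin \<phi>" by blast
  then have "slice_point J x y = r *\<^sub>R cexp J \<phi>"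
    by (simp add: slice_point_def cexp_def creal_def algebra_simps)
  then show "slice_point J x y \<in> double_sector \<theta>" unfolding double_sector_def using r J by blast
qed

text \<open>Written with the scalar part and the norm of the remainder, the non-strict form of the
  sector inequality makes sense on the whole algebra and defines a closed set there. It contains the
  sector and not the point.\<close>

lemma slice_point_not_in_closure:
  assumes \<omega>: "\<omega> \<in> {0<..<pi/2}" and J: "J \<in> imag_sphere" and z: "sin \<omega> * \<bar>x\<bar> < cos \<omega> * \<bar>y\<bar>"
  shows "slice_point J x y \<notin> closure (double_sector \<omega>)"
proof -
  define S :: "'a clifford set" where "S = {s. cos \<omega> * norm (s - creal (s $ {})) \<le> sin \<omega> * \<bar>s $ {}\<bar>}"
  have sp: "norm (slice_point I a b - creal a) = \<bar>b\<bar>" "slice_point I a b $ {} = a"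
    if "I \<in> imag_sphere" for I :: "'a clifford" and a b
    using that by (simp_all add: slice_point_scalar) (simp add: slice_point_def imag_sphere_def)
  have "closed S" unfolding S_def creal_def
    by (intro closed_Collect_le continuous_intros)
  moreover have "double_sector \<omega> \<subseteq> S"
  proof
    fix s :: "'a clifford" assume s: "s \<in> double_sector \<omega>"
    then obtain r I \<phi> where r: "I \<in> imag_sphere" "s = r *\<^sub>R slice_point I (cos \<phi>) (sin \<phi>)"
      unfolding double_sector_def cexp_def by blast
    then have s': "s = slice_point I (r * cos \<phi>) (r * sin \<phi>)" by (simp add: slice_point_def creal_def algebra_simps)
    show "s \<in> S" using s unfolding s' S_def slice_point_in_double_sector_iff[OF \<omega> r(1)] mem_Collect_eq sp[OF r(1)] by simp
  qed
  ultimately have "closure (double_sector \<omega>) \<subseteq> S" by (rule closure_minimal[rotated])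
  moreover have "slice_point J x y \<notin> S" unfolding S_def mem_Collect_eq sp[OF J] using z by simp
  ultimately show ?thesis by blast
qed

lemma Q_op_eq_Some_iff:
  "Q_op T s v = Some w \<longleftrightarrow> (\<exists>u t. T v = Some u \<and> T u = Some t \<and> w = t - (2 * s $ {}) *\<^sub>R u + (norm s)\<^sup>2 *\<^sub>R v)"
  unfolding Q_op_def by (auto simp: map_comp_def dom_def split: option.splits)

text \<open>\<open>Q_s[T]\<close> involves only \<open>s_0 = x\<close> and
  \<open>\<bar>s\<bar>\<^sup>2 = x\<^sup>2 + y\<^sup>2\<close>, hence neither the unit nor the sign
  of \<open>y\<close>. One generator can thus represent all slices.\<close>

lemma Q_inv_slice_point:
  assumes "J \<in> imag_sphere" "I \<in> imag_sphere" "\<bar>y\<bar> = \<bar>y'\<bar>"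
  shows "Q_inv T (slice_point J x y) = Q_inv T (slice_point I x y')"
proof -
  have "y\<^sup>2 = y'\<^sup>2" using assms(3) by (metis power2_abs)
  then have "Q_op T (slice_point J x y) = Q_op T (slice_point I x y')"
    unfolding Q_op_def[abs_def] slice_point_scalar[OF assms(1)] slice_point_scalar[OF assms(2)]
      norm_slice_point[OF assms(1)] norm_slice_point[OF assms(2)] by (simp only:)
  then show ?thesis by (simp add: Q_inv_def[abs_def])
qed

lemma S_resolvent_setD:
  assumes "s \<in> S_resolvent_set T"
  shows "Q_op T s (Q_inv T s w) = Some w" "Q_op T s v = Some w \<Longrightarrow> Q_inv T s w = v"
    "bounded_linear (Q_inv T s)" "Q_inv T s (rmult w a) = rmult (Q_inv T s w) a"
proof -
  have inj: "v = v'" if "Q_op T s v = Some w" "Q_op T s v' = Some w" for v v' w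
    using assms that unfolding S_resolvent_set_def by (auto dest!: inj_onD[of _ _ v v'])
  show Q: "Q_inv T s w = v" if "Q_op T s v = Some w" for v w
    unfolding Q_inv_def using inj that by blast
  have "w \<in> ran (Q_op T s)" using assms by (simp add: S_resolvent_set_def)
  then obtain v where "Q_op T s v = Some w" by (auto simp: ran_def)
  then show "Q_op T s (Q_inv T s w) = Some w" using Q by simp
  show "bounded_linear (Q_inv T s)" "Q_inv T s (rmult w a) = rmult (Q_inv T s w) a"
    using assms by (auto simp: S_resolvent_set_def bounded_right_linear_def)
qed

definition right_unit :: "'n \<Rightarrow> ('v::real_normed_vector, 'n::{finite,linorder}) cmodule \<Rightarrow>\<^sub>L ('v, 'n) cmodule" where
  "right_unit i = Blinfun (\<lambda>v. rmult v (basis_elt {i}))"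

definition slice_inv :: "'n \<Rightarrow> (('v::real_normed_vector, 'n) cmodule \<rightharpoonup> ('v, 'n) cmodule) \<Rightarrow> complex
    \<Rightarrow> ('v, 'n::{finite,linorder}) cmodule \<Rightarrow> ('v, 'n) cmodule" where
  "slice_inv i T z = Q_inv T (slice_point (basis_elt {i}) (Re z) (Im z))"

text \<open>Right multiplication by a generator commutes with \<open>T\<close> and makes the module a complex space;
  \<open>Q_s(T) = (T - z) (T - cnj z)\<close> for \<open>s = x + J y\<close> and \<open>z = x + i y\<close> then shows that this is the
  resolvent \<open>(z - T)^(-1)\<close> of the complex-linear operator \<open>T\<close>.\<close>

definition complex_resolvent :: "'n \<Rightarrow> (('v::real_normed_vector, 'n) cmodule \<rightharpoonup> ('v, 'n) cmodule) \<Rightarrow> complex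
    \<Rightarrow> ('v, 'n::{finite,linorder}) cmodule \<Rightarrow>\<^sub>L ('v, 'n) cmodule" where
  "complex_resolvent i T z = Blinfun (\<lambda>v. Re z *\<^sub>R slice_inv i T z v
     - Im z *\<^sub>R rmult (slice_inv i T z v) (basis_elt {i}) - the (T (slice_inv i T z v)))"

lemma right_unit_apply: "blinfun_apply (right_unit i) v = rmult v (basis_elt {i})"
  unfolding right_unit_def by (simp add: bounded_linear_Blinfun_apply bounded_linear_rmult)

lemma right_unit_square: "right_unit i o\<^sub>L right_unit i = - id_blinfun"
  by (rule blinfun_eqI) (simp add: right_unit_apply rmult_generator_square blinfun.minus_left)

section \<open>The complex resolvent of a bisectorial operator\<close>

locale bisectorial_operator =
  fixes T :: "('v::banach, 'n::{finite,linorder}) cmodule \<rightharpoonup> ('v, 'n) cmodule" and \<omega> :: real and i :: 'n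
  assumes bis: "bisectorial \<omega> T" and \<omega>: "\<omega> \<in> {0<..<pi / 2}"
begin

abbreviation E where "E v \<equiv> rmult v (basis_elt {i}) :: ('v, 'n) cmodule"
abbreviation R where "R z v \<equiv> slice_inv i T z v"

lemma E_linear: "E (u + v) = E u + E v" "E (u - v) = E u - E v" "E (c *\<^sub>R u) = c *\<^sub>R E u" "E (- u) = - E u"
proof -
  have l: "linear E" by (rule bounded_linear.linear[OF bounded_linear_rmult])
  show "E (u + v) = E u + E v" "E (u - v) = E u - E v" "E (c *\<^sub>R u) = c *\<^sub>R E u" "E (- u) = - E u"
    by (rule linear_add[OF l] linear_diff[OF l] linear_scale[OF l] linear_neg[OF l])+
qed

lemma T_linear:
  shows "T u = Some u' \<Longrightarrow> T v = Some v' \<Longrightarrow> T (u + v) = Some (u' + v')"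
    "T v = Some v' \<Longrightarrow> T (rmult v a) = Some (rmult v' a)"
    "T v = Some v' \<Longrightarrow> T (c *\<^sub>R v) = Some (c *\<^sub>R v')"
    "T u = Some u' \<Longrightarrow> T v = Some v' \<Longrightarrow> T (u - v) = Some (u' - v')"
proof -
  have cl: "closed_right_linear T" using bis by (simp add: bisectorial_def)
  show add: "T (u + v) = Some (u' + v')" if "T u = Some u'" "T v = Some v'" for u v u' v'
    using cl that unfolding closed_right_linear_def by blast
  show rm: "T (rmult v a) = Some (rmult v' a)" if "T v = Some v'" for v v' a
    using cl that unfolding closed_right_linear_def by blast
  show sc: "T (c *\<^sub>R v) = Some (c *\<^sub>R v')" if "T v = Some v'" for v v' c
    using rm[OF that, of "creal c"] by (simp add: rmult_creal)
  show "T (u - v) = Some (u' - v')" if "T u = Some u'" "T v = Some v'" for u v u' v'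
    using add[OF that(1) sc[OF that(2), of "- 1"]] by simp
qed

lemma slice_point_resolvent:
  assumes "z \<in> cobisector \<omega>" "J \<in> imag_sphere"
  shows "slice_point J (Re z) (Im z) \<in> S_resolvent_set T"
proof -
  have "slice_point J (Re z) (Im z) \<notin> closure (double_sector \<omega>)"
    using assms by (intro slice_point_not_in_closure[OF \<omega>]) (auto simp: cobisector_def)
  then show ?thesis
    using bis slice_point_paravector[OF assms(2)] unfolding bisectorial_def S_spectrum_def by blast
qed

lemma R_props:
  assumes z: "z \<in> cobisector \<omega>"
  shows "bounded_linear (R z)" "R z (rmult v a) = rmult (R z v) a"
    "\<exists>u1 u2. T (R z v) = Some u1 \<and> T u1 = Some u2 \<and> v = u2 - (2 * Re z) *\<^sub>R u1 + ((Re z)\<^sup>2 + (Im z)\<^sup>2) *\<^sub>R R z v"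
    "T u = Some u1 \<Longrightarrow> T u1 = Some u2 \<Longrightarrow> v = u2 - (2 * Re z) *\<^sub>R u1 + ((Re z)\<^sup>2 + (Im z)\<^sup>2) *\<^sub>R u \<Longrightarrow> R z v = u"
proof -
  let ?e = "basis_elt {i} :: 'n clifford"
  note res = S_resolvent_setD[OF slice_point_resolvent[OF z generator_in_imag_sphere[of i]], folded slice_inv_def]
  have Q: "Q_op T (slice_point ?e (Re z) (Im z)) v = Some w \<longleftrightarrow>
    (\<exists>u1 u2. T v = Some u1 \<and> T u1 = Some u2 \<and> w = u2 - (2 * Re z) *\<^sub>R u1 + ((Re z)\<^sup>2 + (Im z)\<^sup>2) *\<^sub>R v)" for v w
    unfolding Q_op_eq_Some_iff norm_slice_point[OF generator_in_imag_sphere] slice_point_scalar[OF generator_in_imag_sphere] ..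
  show "bounded_linear (R z)" "R z (rmult v a) = rmult (R z v) a" by (fact res(3), fact res(4))
  show "\<exists>u1 u2. T (R z v) = Some u1 \<and> T u1 = Some u2 \<and> v = u2 - (2 * Re z) *\<^sub>R u1 + ((Re z)\<^sup>2 + (Im z)\<^sup>2) *\<^sub>R R z v"
    using res(1)[of v] unfolding Q .
  show "R z v = u" if "T u = Some u1" "T u1 = Some u2" "v = u2 - (2 * Re z) *\<^sub>R u1 + ((Re z)\<^sup>2 + (Im z)\<^sup>2) *\<^sub>R u"
    by (rule res(2)) (unfold Q, use that in blast)
qed

lemma R_linear:
  assumes z: "z \<in> cobisector \<omega>"
  shows "R z (u + v) = R z u + R z v" "R z (u - v) = R z u - R z v" "R z (c *\<^sub>R u) = c *\<^sub>R R z u" "R z (- u) = - R z u"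
proof -
  have l: "linear (R z)" by (rule bounded_linear.linear[OF R_props(1)[OF z]])
  show "R z (u + v) = R z u + R z v" "R z (u - v) = R z u - R z v" "R z (c *\<^sub>R u) = c *\<^sub>R R z u" "R z (- u) = - R z u"
    by (rule linear_add[OF l] linear_diff[OF l] linear_scale[OF l] linear_neg[OF l])+
qed

text \<open>\<open>Q_s[T]\<close> is a polynomial in \<open>T\<close>, so \<open>T (R z v)\<close>
  solves the equation \<open>Q u = T v\<close>, and solutions are unique.\<close>

lemma T_R_commute:
  assumes z: "z \<in> cobisector \<omega>" and v: "T v = Some v'"
  shows "T (R z v) = Some (R z v')"
proof -
  obtain u1 u2 where u: "T (R z v) = Some u1" "T u1 = Some u2"
    and eq: "v = u2 - (2 * Re z) *\<^sub>R u1 + ((Re z)\<^sup>2 + (Im z)\<^sup>2) *\<^sub>R R z v"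
    using R_props(3)[OF z, of v] by blast
  \<comment> \<open>Solved for \<open>u2\<close>, the equation exhibits it as a combination of
    elements of the domain of \<open>T\<close>; this puts \<open>u1\<close> into the domain of
    \<open>T\<^sup>2\<close>.\<close>
  have "u2 = v + (2 * Re z) *\<^sub>R u1 - ((Re z)\<^sup>2 + (Im z)\<^sup>2) *\<^sub>R R z v"
    using eq by (metis (no_types, lifting) add_diff_cancel diff_add_cancel diff_diff_eq2 add.commute)
  then have "T u2 = Some (v' + (2 * Re z) *\<^sub>R u2 - ((Re z)\<^sup>2 + (Im z)\<^sup>2) *\<^sub>R u1)"
    using T_linear(4)[OF T_linear(1)[OF v T_linear(3)[OF u(2)]] T_linear(3)[OF u(1)]] by simp
  then have "R z v' = u1" by (rule R_props(4)[OF z u(2)]) simp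
  then show ?thesis using u by simp
qed

lemma SL_resolvent_slice:
  assumes z: "z \<in> cobisector \<omega>" and J: "J \<in> imag_sphere"
  shows "SL_resolvent T (slice_point J (Re z) (Im z)) v = Re z *\<^sub>R R z v - Im z *\<^sub>R R z (lmult J v) - the (T (R z v))"
proof -
  have "Q_inv T (slice_point J (Re z) (Im z)) = R z"
    unfolding slice_inv_def by (rule Q_inv_slice_point[OF J generator_in_imag_sphere]) simp
  moreover have "lmult (slice_point J (Re z) (- Im z)) v = Re z *\<^sub>R v - Im z *\<^sub>R lmult J v"
    by (simp add: slice_point_def lmult.add_left lmult.diff_left lmult.scaleR_left lmult_creal)
  ultimately show ?thesis
    unfolding SL_resolvent_def pconj_slice_point[OF J] by (simp add: R_linear[OF z])
qed

lemma slice_point_bound: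
  assumes \<phi>: "\<phi> \<in> {\<omega><..<pi/2}"
  obtains C where "C \<ge> 0" "\<And>z J. z \<in> cobisector \<phi> \<Longrightarrow> J \<in> imag_sphere \<Longrightarrow>
    bounded_linear (SL_resolvent T (slice_point J (Re z) (Im z))) \<and>
    (\<forall>v. norm (SL_resolvent T (slice_point J (Re z) (Im z)) v) \<le> C / cmod z * norm v)"
proof -
  obtain C where C: "C \<ge> 0" "\<forall>s\<in>paravectors - (double_sector \<phi> \<union> {0}).
      bounded_linear (SL_resolvent T s) \<and> onorm (SL_resolvent T s) \<le> C / norm s"
    using bis \<phi> unfolding bisectorial_def by blast
  show ?thesis
  proof (rule that[OF C(1)])
    fix z and J :: "'n clifford" assume z: "z \<in> cobisector \<phi>" and J: "J \<in> imag_sphere"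
    let ?s = "slice_point J (Re z) (Im z)"
    have "\<phi> \<in> {0<..<pi/2}" using \<phi> \<omega> by auto
    then have "?s \<notin> double_sector \<phi>" using slice_point_in_double_sector_iff[OF _ J] z by (auto simp: cobisector_def)
    moreover have "?s \<noteq> 0" using norm_slice_point_cmod[OF J, of z] z by (auto simp: cobisector_def)
    ultimately have "?s \<in> paravectors - (double_sector \<phi> \<union> {0})" using slice_point_paravector[OF J] by blast
    then have s: "bounded_linear (SL_resolvent T ?s)" "onorm (SL_resolvent T ?s) \<le> C / cmod z"
      using C(2) unfolding norm_slice_point_cmod[OF J, of z, symmetric] by blast+
    then show "bounded_linear (SL_resolvent T ?s) \<and> (\<forall>v. norm (SL_resolvent T ?s v) \<le> C / cmod z * norm v)"
      by (meson mult_right_mono norm_ge_zero onorm order_trans)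
  qed
qed

lemma cobisector_mono: "\<phi> \<in> {\<omega><..<pi/2} \<Longrightarrow> z \<in> cobisector \<phi> \<Longrightarrow> z \<in> cobisector \<omega>"
proof -
  assume \<phi>: "\<phi> \<in> {\<omega><..<pi/2}" and z: "z \<in> cobisector \<phi>"
  have c: "cos \<phi> > 0" "cos \<omega> > 0" using \<phi> \<omega> by (auto intro!: cos_gt_zero)
  have "0 < sin (\<phi> - \<omega>)" using \<phi> \<omega> by (intro sin_gt_zero) auto
  then have s: "cos \<phi> * sin \<omega> \<le> cos \<omega> * sin \<phi>" by (simp add: sin_diff mult.commute)
  have "cos \<phi> * (sin \<omega> * \<bar>Re z\<bar>) \<le> cos \<omega> * (sin \<phi> * \<bar>Re z\<bar>)"
    using mult_right_mono[OF s, of "\<bar>Re z\<bar>"] by (simp add: mult_ac)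
  also have "\<dots> < cos \<omega> * (cos \<phi> * \<bar>Im z\<bar>)" using z c by (simp add: cobisector_def)
  finally have "cos \<phi> * (sin \<omega> * \<bar>Re z\<bar>) < cos \<phi> * (cos \<omega> * \<bar>Im z\<bar>)" by (simp add: mult_ac)
  then show "z \<in> cobisector \<omega>" using c by (simp add: cobisector_def)
qed

text \<open>\<open>Blinfun\<close> has the intended value only for a bounded map, and the critical
  term is \<open>T (R z v)\<close>. Its boundedness is extracted from the resolvent estimate, by
  subtracting the S-resolvent from terms already known to be bounded.\<close>

lemma complex_resolvent_apply:
  assumes z: "z \<in> cobisector \<omega>"
  shows "blinfun_apply (complex_resolvent i T z) v = Re z *\<^sub>R R z v - Im z *\<^sub>R E (R z v) - the (T (R z v))"
proof -
  have "\<exists>\<phi>. \<phi> \<in> {\<omega><..<pi/2} \<and> z \<in> cobisector \<phi>"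
  proof -
    \<comment> \<open>The estimate is available for angles above \<open>\<omega>\<close>; the strict
      inequality defining \<open>cobisector \<omega>\<close> persists for angles slightly larger
      than \<open>\<omega>\<close>.\<close>
    have "((\<lambda>\<phi>. cos \<phi> * \<bar>Im z\<bar> - sin \<phi> * \<bar>Re z\<bar>) \<longlongrightarrow> cos \<omega> * \<bar>Im z\<bar> - sin \<omega> * \<bar>Re z\<bar>) (at_right \<omega>)"
      by (intro tendsto_intros)
    then have "\<forall>\<^sub>F \<phi> in at_right \<omega>. 0 < cos \<phi> * \<bar>Im z\<bar> - sin \<phi> * \<bar>Re z\<bar>"
      using z by (intro order_tendstoD) (auto simp: cobisector_def)
    moreover have "\<forall>\<^sub>F \<phi> in at_right \<omega>. \<phi> \<in> {\<omega><..<pi/2}"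
      using \<omega> by (intro eventually_at_right_real) auto
    ultimately have "\<forall>\<^sub>F \<phi> in at_right \<omega>. \<phi> \<in> {\<omega><..<pi/2} \<and> z \<in> cobisector \<phi>"
      by eventually_elim (auto simp: cobisector_def)
    then show ?thesis by (intro eventually_happens'[of "at_right \<omega>"]) simp_all
  qed
  then obtain \<phi> where \<phi>: "\<phi> \<in> {\<omega><..<pi/2}" "z \<in> cobisector \<phi>" by blast
  obtain C where "bounded_linear (SL_resolvent T (slice_point (basis_elt {i}) (Re z) (Im z)))"
    using slice_point_bound[OF \<phi>(1)] \<phi>(2) generator_in_imag_sphere by metis
  then have SL: "bounded_linear (\<lambda>v. Re z *\<^sub>R R z v - Im z *\<^sub>R R z (lmult (basis_elt {i}) v) - the (T (R z v)))"
    unfolding SL_resolvent_slice[OF z generator_in_imag_sphere, abs_def] .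
  have "bounded_linear (\<lambda>v. R z (lmult (basis_elt {i}) v))"
    by (rule bounded_linear_compose[OF R_props(1)[OF z] lmult.bounded_linear_right])
  then have "bounded_linear (\<lambda>v. Re z *\<^sub>R R z v - Im z *\<^sub>R R z (lmult (basis_elt {i}) v))"
    by (intro bounded_linear_sub bounded_linear_compose[OF bounded_linear_scaleR_right] R_props(1)[OF z])
  from bounded_linear_sub[OF this SL] have TR: "bounded_linear (\<lambda>v. the (T (R z v)))" by simp
  have "bounded_linear (\<lambda>v. E (R z v))"
    by (rule bounded_linear_compose[OF bounded_linear_rmult R_props(1)[OF z]])
  then have "bounded_linear (\<lambda>v. Re z *\<^sub>R R z v - Im z *\<^sub>R E (R z v) - the (T (R z v)))"
    by (intro bounded_linear_sub bounded_linear_compose[OF bounded_linear_scaleR_right] R_props(1)[OF z] TR)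
  then show ?thesis unfolding complex_resolvent_def by (simp add: bounded_linear_Blinfun_apply)
qed

abbreviation K where "K \<equiv> complex_resolvent i T"

text \<open>\<open>(z - T) K(z) = 1\<close>: with \<open>E\<close> as imaginary unit, \<open>(x + y
  E - T) (x - y E - T) = T\<^sup>2 - 2 x T + x\<^sup>2 + y\<^sup>2\<close>, because \<open>E\<close>
  squares to -1 and commutes with \<open>T\<close>.\<close>

lemma K_right_inverse:
  assumes z: "z \<in> cobisector \<omega>"
  shows "\<exists>p'. T (K z v) = Some p' \<and> Re z *\<^sub>R K z v + Im z *\<^sub>R E (K z v) - p' = v"
proof -
  obtain u1 u2 where u: "T (R z v) = Some u1" "T u1 = Some u2"
    and eq: "v = u2 - (2 * Re z) *\<^sub>R u1 + ((Re z)\<^sup>2 + (Im z)\<^sup>2) *\<^sub>R R z v"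
    using R_props(3)[OF z, of v] by blast
  have Kv: "K z v = Re z *\<^sub>R R z v - Im z *\<^sub>R E (R z v) - u1"
    unfolding complex_resolvent_apply[OF z] by (simp add: u)
  have "T (K z v) = Some (Re z *\<^sub>R u1 - Im z *\<^sub>R E u1 - u2)"
    unfolding Kv by (intro T_linear u)
  moreover have "Re z *\<^sub>R K z v + Im z *\<^sub>R E (K z v) - (Re z *\<^sub>R u1 - Im z *\<^sub>R E u1 - u2) = v"
  proof -
    have two: "(Re z * 2) *\<^sub>R u1 = Re z *\<^sub>R u1 + Re z *\<^sub>R u1" by (simp only: mult_2_right scaleR_left_distrib)
    show ?thesis
      by (subst (3) eq) (simp add: Kv two E_linear rmult_generator_square power2_eq_square algebra_simps)
  qed
  ultimately show ?thesis by blast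
qed

text \<open>The same factorisation in the opposite order, \<open>K(z) (z - T) = 1\<close> on the
  domain of \<open>T\<close>; here \<open>R\<close> has to be moved past \<open>T\<close>.\<close>

lemma K_left_inverse:
  assumes z: "z \<in> cobisector \<omega>" and v: "T v = Some v'"
  shows "K z (Re z *\<^sub>R v + Im z *\<^sub>R E v - v') = v"
proof -
  obtain u1 u2 where u: "T (R z v) = Some u1" "T u1 = Some u2"
    and eq: "v = u2 - (2 * Re z) *\<^sub>R u1 + ((Re z)\<^sup>2 + (Im z)\<^sup>2) *\<^sub>R R z v"
    using R_props(3)[OF z, of v] by blast
  have "R z v' = u1" using T_R_commute[OF z v] u by simp
  then have q: "R z (Re z *\<^sub>R v + Im z *\<^sub>R E v - v') = Re z *\<^sub>R R z v + Im z *\<^sub>R E (R z v) - u1"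
    by (simp add: R_linear[OF z] R_props(2)[OF z])
  have "T (Re z *\<^sub>R R z v + Im z *\<^sub>R E (R z v) - u1) = Some (Re z *\<^sub>R u1 + Im z *\<^sub>R E u1 - u2)"
    by (intro T_linear u)
  moreover have two: "(Re z * 2) *\<^sub>R u1 = Re z *\<^sub>R u1 + Re z *\<^sub>R u1" by (simp only: mult_2_right scaleR_left_distrib)
  ultimately show ?thesis
    unfolding complex_resolvent_apply[OF z] q
    by (subst (5) eq) (simp add: two E_linear rmult_generator_square power2_eq_square algebra_simps)
qed

lemma K_commute_E:
  assumes z: "z \<in> cobisector \<omega>"
  shows "K z (E v) = E (K z v)"
proof -
  obtain u1 where u: "T (R z v) = Some u1" using R_props(3)[OF z, of v] by blast
  then have "T (E (R z v)) = Some (E u1)" by (rule T_linear)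
  then show ?thesis unfolding complex_resolvent_apply[OF z] R_props(2)[OF z] by (simp add: u E_linear)
qed

text \<open>With \<open>p = K w v\<close> one has
  \<open>v = (w - T) p = (z - T) p + (w - z) p\<close>; applying \<open>K z\<close> gives
  \<open>p + (w - z) K z p\<close>.\<close>

lemma K_resolvent_identity:
  assumes z: "z \<in> cobisector \<omega>" and w: "w \<in> cobisector \<omega>"
  shows "K z - K w = cscale (right_unit i) (w - z) (K z o\<^sub>L K w)"
proof (rule blinfun_eqI)
  fix v
  define p where "p = K w v"
  obtain p' where p': "T p = Some p'" "Re w *\<^sub>R p + Im w *\<^sub>R E p - p' = v"
    using K_right_inverse[OF w, of v] unfolding p_def by blast
  have "v = (Re z *\<^sub>R p + Im z *\<^sub>R E p - p') + ((Re w - Re z) *\<^sub>R p + (Im w - Im z) *\<^sub>R E p)"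
    by (subst p'(2)[symmetric]) (simp add: algebra_simps)
  then have "K z v = K z (Re z *\<^sub>R p + Im z *\<^sub>R E p - p') + K z ((Re w - Re z) *\<^sub>R p + (Im w - Im z) *\<^sub>R E p)"
    by (metis blinfun.add_right)
  also have "K z (Re z *\<^sub>R p + Im z *\<^sub>R E p - p') = p" by (rule K_left_inverse[OF z p'(1)])
  also have "K z ((Re w - Re z) *\<^sub>R p + (Im w - Im z) *\<^sub>R E p) = (Re w - Re z) *\<^sub>R K z p + (Im w - Im z) *\<^sub>R E (K z p)"
    by (simp add: blinfun.add_right blinfun.scaleR_right K_commute_E[OF z])
  finally show "(K z - K w) v = cscale (right_unit i) (w - z) (K z o\<^sub>L K w) v"
    by (simp add: cscale_def blinfun.diff_left blinfun.add_left blinfun.scaleR_left right_unit_apply p_def)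
qed

lemma cnj_cobisector: "cnj z \<in> cobisector \<omega> \<longleftrightarrow> z \<in> cobisector \<omega>"
  by (simp add: cobisector_def)

lemma R_cnj: "R (cnj z) = R z"
  using Q_inv_slice_point[OF generator_in_imag_sphere[of i] generator_in_imag_sphere[of i],
      where x="Re z" and y="- Im z" and y'="Im z" and T=T]
  by (simp add: slice_inv_def)

section \<open>Even and odd parts of the resolvent under conjugation\<close>

definition slice_even :: "complex \<Rightarrow> ('v, 'n) cmodule \<Rightarrow>\<^sub>L ('v, 'n) cmodule" where
  "slice_even z = (1 / 2) *\<^sub>R (K z + K (cnj z))"

definition slice_odd :: "complex \<Rightarrow> ('v, 'n) cmodule \<Rightarrow>\<^sub>L ('v, 'n) cmodule" where
  "slice_odd z = (1 / 2) *\<^sub>R (right_unit i o\<^sub>L (K z - K (cnj z)))"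

text \<open>The unit \<open>E\<close> has disappeared: the two parts are \<open>(x - T) R\<close>
  and \<open>y R\<close>. That is why they also build the S-resolvent, with left multiplication by
  any \<open>J\<close> in the place of \<open>E\<close>.\<close>

lemma slice_even_odd_apply:
  assumes z: "z \<in> cobisector \<omega>"
  shows "slice_even z v = Re z *\<^sub>R R z v - the (T (R z v))" "slice_odd z v = Im z *\<^sub>R R z v"
proof -
  have K: "K (cnj z) v = Re z *\<^sub>R R z v + Im z *\<^sub>R E (R z v) - the (T (R z v))"
    using complex_resolvent_apply[of "cnj z"] z by (simp add: cnj_cobisector R_cnj)
  show "slice_even z v = Re z *\<^sub>R R z v - the (T (R z v))"
    unfolding slice_even_def
    by (simp add: blinfun.add_left blinfun.scaleR_left K complex_resolvent_apply[OF z] algebra_simps scaleR_left.add[symmetric])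
  show "slice_odd z v = Im z *\<^sub>R R z v"
    unfolding slice_odd_def
    by (simp add: blinfun.diff_left blinfun.scaleR_left K complex_resolvent_apply[OF z] right_unit_apply
        E_linear rmult_generator_square)
qed

lemma K_slice:
  assumes z: "z \<in> cobisector \<omega>"
  shows "K z = slice_even z - (right_unit i o\<^sub>L slice_odd z)"
  by (rule blinfun_eqI) (simp add: blinfun.diff_left right_unit_apply slice_even_odd_apply[OF z]
      complex_resolvent_apply[OF z] E_linear)

lemma slice_even_odd_cnj: "slice_even (cnj z) = slice_even z" "slice_odd (cnj z) = - slice_odd z"
  unfolding slice_even_def slice_odd_def
  by (simp_all add: add.commute compose_bilinear scaleR_minus_right[symmetric] del: scaleR_minus_right)

text \<open>The counterpart of \<open>K_slice\<close>. There the unit multiplies from the right and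
  may be applied last; \<open>J\<close> multiplies from the left, does not commute with
  \<open>T\<close> in general, and has to be applied before \<open>slice_odd\<close>.\<close>

lemma SL_resolvent_even_odd:
  assumes z: "z \<in> cobisector \<omega>" and J: "J \<in> imag_sphere"
  shows "SL_resolvent T (slice_point J (Re z) (Im z)) v = slice_even z v - slice_odd z (lmult J v)"
  unfolding SL_resolvent_slice[OF z J] slice_even_odd_apply[OF z] by (simp add: algebra_simps)

text \<open>Bounds are given for the S-resolvent at \<open>z\<close> and at \<open>cnj z\<close>.
  Half their sum is \<open>slice_even z\<close>; half their difference is, up to sign,
  \<open>slice_odd z\<close> after left multiplication by the generator, which is undone since the
  generator squares to -1. The constants \<open>ce\<close> and \<open>cE\<close> bound left and
  right multiplication by it.\<close>

lemma K_norm_bound: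
  assumes \<phi>: "\<phi> \<in> {\<omega><..<pi/2}"
  shows "\<exists>C\<ge>0. \<forall>z\<in>cobisector \<phi>. norm (K z) \<le> C / cmod z"
proof -
  obtain C where C: "C \<ge> 0" "\<And>z J. z \<in> cobisector \<phi> \<Longrightarrow> J \<in> imag_sphere \<Longrightarrow>
    bounded_linear (SL_resolvent T (slice_point J (Re z) (Im z))) \<and>
    (\<forall>v. norm (SL_resolvent T (slice_point J (Re z) (Im z)) v) \<le> C / cmod z * norm v)"
    using slice_point_bound[OF \<phi>] by blast
  let ?e = "basis_elt {i} :: 'n clifford"
  obtain ce where ce: "ce > 0" "\<And>v :: ('v, 'n) cmodule. norm (lmult ?e v) \<le> norm v * ce"
    using bounded_linear.pos_bounded[OF lmult.bounded_linear_right] by blast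
  obtain cE where cE: "cE > 0" "\<And>v. norm (E v) \<le> norm v * cE"
    using bounded_linear.pos_bounded[OF bounded_linear_rmult] by blast
  show ?thesis
  proof (intro exI[of _ "C + C * ce * cE"] conjI ballI)
    show "0 \<le> C + C * ce * cE" using C(1) ce(1) cE(1) by simp
    fix z assume z: "z \<in> cobisector \<phi>"
    then have zw: "z \<in> cobisector \<omega>" by (rule cobisector_mono[OF \<phi>])
    have cz: "cnj z \<in> cobisector \<phi>" "cnj z \<in> cobisector \<omega>" using z zw by (auto simp: cobisector_def)
    let ?S = "\<lambda>z v. SL_resolvent T (slice_point ?e (Re z) (Im z)) v"
    have S: "norm (?S z v) \<le> C / cmod z * norm v" "norm (?S (cnj z) v) \<le> C / cmod z * norm v" for v
      using C(2)[OF z generator_in_imag_sphere[of i]] C(2)[OF cz(1) generator_in_imag_sphere[of i]] by (auto simp del: cnj.simps)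
    have half: "norm ((1 / 2) *\<^sub>R (a + b)) \<le> q" and half': "norm ((1 / 2) *\<^sub>R (a - b)) \<le> q"
      if "norm a \<le> q" "norm b \<le> q" for a b :: "('v, 'n) cmodule" and q
      using norm_triangle_ineq[of a b] norm_triangle_ineq4[of a b] that by auto
    have even: "slice_even z v = (1 / 2) *\<^sub>R (?S z v + ?S (cnj z) v)" for v
      unfolding SL_resolvent_even_odd[OF zw generator_in_imag_sphere] SL_resolvent_even_odd[OF cz(2) generator_in_imag_sphere]
        slice_even_odd_cnj by (simp add: blinfun.minus_left scaleR_left.add[symmetric] algebra_simps)
    have "slice_odd z (lmult ?e v) = (1 / 2) *\<^sub>R (?S (cnj z) v - ?S z v)" for v
      unfolding SL_resolvent_even_odd[OF zw generator_in_imag_sphere] SL_resolvent_even_odd[OF cz(2) generator_in_imag_sphere]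
        slice_even_odd_cnj by (simp add: blinfun.minus_left scaleR_left.add[symmetric] algebra_simps)
    from this[of "- lmult ?e v" for v]
    have odd: "slice_odd z v = (1 / 2) *\<^sub>R (?S (cnj z) (- lmult ?e v) - ?S z (- lmult ?e v))" for v
      by (simp add: lmult.minus_right lmult_lmult generator_square lmult.minus_left lmult_one)
    have ne: "norm (slice_even z v) \<le> C / cmod z * norm v" for v
      unfolding even by (rule half[OF S])
    have no: "norm (slice_odd z v) \<le> C / cmod z * (norm v * ce)" for v
    proof -
      have "norm (slice_odd z v) \<le> C / cmod z * norm (- lmult ?e v)"
        unfolding odd by (rule half'[OF S(2,1)])
      also have "\<dots> \<le> C / cmod z * (norm v * ce)"
        using ce(2)[of v] C(1) by (intro mult_left_mono) auto
      finally show ?thesis .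
    qed
    show "norm (K z) \<le> (C + C * ce * cE) / cmod z"
    proof (rule norm_blinfun_bound)
      show "0 \<le> (C + C * ce * cE) / cmod z" using C(1) ce(1) cE(1) by simp
      fix v
      have "norm (K z v) \<le> norm (slice_even z v) + norm (E (slice_odd z v))"
        unfolding K_slice[OF zw] by (simp add: blinfun.diff_left right_unit_apply norm_triangle_ineq4)
      also have "\<dots> \<le> C / cmod z * norm v + C / cmod z * (norm v * ce) * cE"
        using ne[of v] order_trans[OF cE(2) mult_right_mono[OF no]] cE(1) by (intro add_mono) auto
      also have "\<dots> = (C + C * ce * cE) / cmod z * norm v" by (simp add: field_simps add_divide_distrib)
      finally show "norm (K z v) \<le> (C + C * ce * cE) / cmod z * norm v" .
    qed
  qed
qed

lemma resolvent_locale: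
  assumes \<phi>: "\<phi> \<in> {\<omega><..<pi/2}"
  shows "\<exists>C. resolvent (right_unit i) K \<phi> C"
proof -
  obtain C where C: "C \<ge> 0" "\<forall>z\<in>cobisector \<phi>. norm (K z) \<le> C / cmod z"
    using K_norm_bound[OF \<phi>] by blast
  note mono = cobisector_mono[OF \<phi>]
  have "resolvent (right_unit i) K \<phi> C"
  proof
    show "right_unit i o\<^sub>L K z = K z o\<^sub>L right_unit i" if "z \<in> cobisector \<phi>" for z
      by (rule blinfun_eqI) (simp add: right_unit_apply K_commute_E[OF mono[OF that]])
    show "K z - K w = cscale (right_unit i) (w - z) (K z o\<^sub>L K w)" if "z \<in> cobisector \<phi>" "w \<in> cobisector \<phi>" for z w
      by (rule K_resolvent_identity[OF mono[OF that(1)] mono[OF that(2)]])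
  qed (use C \<phi> \<omega> right_unit_square in auto)
  then show ?thesis ..
qed

end

section \<open>Components of slice hyperholomorphic functions\<close>

lemma slice_domain_double_sector:
  assumes "\<theta> \<in> {0<..<pi/2}"
  shows "slice_domain (double_sector \<theta> :: 'n::finite clifford set) = {(x, y). cos \<theta> * \<bar>y\<bar> < sin \<theta> * \<bar>x\<bar>}"
  using imag_sphere_nonempty[where 'n='n] slice_point_in_double_sector_iff[OF assms, where 'a='n]
  unfolding slice_domain_def by blast

lemma mem_slice_domain_iff:
  assumes "\<theta> \<in> {0<..<pi/2}"
  shows "(Re z, Im z) \<in> slice_domain (double_sector \<theta> :: 'n::finite clifford set) \<longleftrightarrow> z \<in> bisector \<theta>"
  unfolding slice_domain_double_sector[OF assms] by (simp add: bisector_def)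

lemma partial_derivatives:
  assumes "(h has_derivative h') (at p)"
  shows "partial_x h p = h' (1, 0)" "partial_y h p = h' (0, 1)"
proof -
  have lin: "linear h'" using assms has_derivative_linear by blast
  have p: "p = (fst p, snd p)" by simp
  have "((\<lambda>x. (x, snd p)) has_derivative (\<lambda>d. (d, 0))) (at (fst p))"
    by (auto intro!: derivative_eq_intros)
  from has_derivative_compose[OF this, of h h'] assms
  have "((\<lambda>x. h (x, snd p)) has_derivative (\<lambda>d. h' (d, 0))) (at (fst p))" by simp
  moreover have "(\<lambda>d. h' (d, 0)) = (\<lambda>d. d *\<^sub>R h' (1, 0))"
  proof
    fix d
    have e: "(d, 0) = d *\<^sub>R (1::real, 0::real)" by simp
    show "h' (d, 0) = d *\<^sub>R h' (1, 0)" unfolding e by (rule linear_scale[OF lin])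
  qed
  ultimately show "partial_x h p = h' (1, 0)"
    unfolding partial_x_def by (intro vector_derivative_at) (simp only: has_vector_derivative_def)
  have "((\<lambda>y. (fst p, y)) has_derivative (\<lambda>d. (0, d))) (at (snd p))"
    by (auto intro!: derivative_eq_intros)
  from has_derivative_compose[OF this, of h h'] assms
  have "((\<lambda>y. h (fst p, y)) has_derivative (\<lambda>d. h' (0, d))) (at (snd p))" by simp
  moreover have "(\<lambda>d. h' (0, d)) = (\<lambda>d. d *\<^sub>R h' (0, 1))"
  proof
    fix d
    have e: "(0, d) = d *\<^sub>R (0::real, 1::real)" by simp
    show "h' (0, d) = d *\<^sub>R h' (0, 1)" unfolding e by (rule linear_scale[OF lin])
  qed
  ultimately show "partial_y h p = h' (0, 1)"
    unfolding partial_y_def by (intro vector_derivative_at) (simp only: has_vector_derivative_def)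
qed

definition slice_coeff :: "(real \<times> real \<Rightarrow> 'n clifford) \<Rightarrow> (real \<times> real \<Rightarrow> 'n clifford) \<Rightarrow> 'n::finite set \<Rightarrow> complex \<Rightarrow> complex" where
  "slice_coeff f0 f1 A z = Complex (f0 (Re z, Im z) $ A) (f1 (Re z, Im z) $ A)"

context
  fixes \<theta> :: real and f :: "'n::{finite,linorder} clifford \<Rightarrow> 'n clifford" and f0 f1
  assumes \<theta>: "\<theta> \<in> {0<..<pi/2}" and sc: "slice_components (double_sector \<theta>) f f0 f1"
begin

lemma slice_components_D:
  assumes "z \<in> bisector \<theta>"
  shows "J \<in> imag_sphere \<Longrightarrow> f (slice_point J (Re z) (Im z)) = f0 (Re z, Im z) + J \<odot> f1 (Re z, Im z)"
    "f0 (Re z, - Im z) = f0 (Re z, Im z)" "f1 (Re z, - Im z) = - f1 (Re z, Im z)"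
    "partial_x f0 (Re z, Im z) = partial_y f1 (Re z, Im z)" "partial_y f0 (Re z, Im z) = - partial_x f1 (Re z, Im z)"
  using sc mem_slice_domain_iff[OF \<theta>, of z] assms unfolding slice_components_def by blast+

text \<open>The conditions on \<open>f0\<close> and \<open>f1\<close> are the Cauchy-Riemann
  equations in each component: if \<open>a\<close> and \<open>b\<close> are the partial derivatives
  of \<open>f0\<close> in \<open>x\<close> and \<open>y\<close>, the derivative is multiplication by
  \<open>a - i b\<close>, componentwise.\<close>

lemma slice_coeff_holomorphic: "slice_coeff f0 f1 A holomorphic_on bisector \<theta>"
  unfolding holomorphic_on_def
proof
  fix z assume z: "z \<in> bisector \<theta>"
  let ?p = "(Re z, Im z)"
  have "?p \<in> slice_domain (double_sector \<theta> :: 'n clifford set)" using z mem_slice_domain_iff[OF \<theta>] by blast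
  then obtain h0 h1 where h: "(f0 has_derivative blinfun_apply h0) (at ?p)" "(f1 has_derivative blinfun_apply h1) (at ?p)"
    using sc unfolding slice_components_def C1_on_def by blast
  define a b where "a = h0 (1, 0)" and "b = h0 (0, 1)"
  have h1: "h1 (0, 1) = a" "h1 (1, 0) = - b"
    using slice_components_D(4,5)[OF z] partial_derivatives[OF h(1)] partial_derivatives[OF h(2)] by (simp_all add: a_def b_def)
  have lin: "blinfun_apply k (x, y) = x *\<^sub>R k (1, 0) + y *\<^sub>R k (0, 1)" for k :: "(real \<times> real) \<Rightarrow>\<^sub>L 'n clifford" and x y
    by (simp add: blinfun.scaleR_right[symmetric] blinfun.add_right[symmetric])
  have c: "((\<lambda>z. (Re z, Im z)) has_derivative (\<lambda>d. (Re d, Im d))) (at z)"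
    by (auto intro!: derivative_eq_intros)
  have d: "((\<lambda>z. f0 (Re z, Im z) $ A) has_derivative (\<lambda>d. h0 (Re d, Im d) $ A)) (at z)"
    "((\<lambda>z. f1 (Re z, Im z) $ A) has_derivative (\<lambda>d. h1 (Re d, Im d) $ A)) (at z)"
    using has_derivative_compose[OF c h(1)] has_derivative_compose[OF c h(2)]
    by (auto intro: bounded_linear.has_derivative[OF bounded_linear_vec_nth])
  have "((\<lambda>z. of_real (f0 (Re z, Im z) $ A) + \<i> * of_real (f1 (Re z, Im z) $ A)) has_derivative
      (\<lambda>d. of_real (h0 (Re d, Im d) $ A) + \<i> * of_real (h1 (Re d, Im d) $ A))) (at z)"
    by (intro has_derivative_add has_derivative_mult_right has_derivative_of_real d)
  moreover have "of_real (h0 (Re d, Im d) $ A) + \<i> * of_real (h1 (Re d, Im d) $ A) = Complex (a $ A) (- (b $ A)) * d" for d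
    unfolding lin[of h0 "Re d" "Im d"] lin[of h1 "Re d" "Im d"] h1 a_def[symmetric] b_def[symmetric]
    by (simp add: complex_eq_iff algebra_simps)
  moreover have "(\<lambda>z. of_real (f0 (Re z, Im z) $ A) + \<i> * of_real (f1 (Re z, Im z) $ A)) = slice_coeff f0 f1 A"
    by (simp add: slice_coeff_def complex_eq_iff fun_eq_iff)
  ultimately have "(slice_coeff f0 f1 A has_field_derivative Complex (a $ A) (- (b $ A))) (at z)"
    by (simp add: has_field_derivative_def)
  then show "slice_coeff f0 f1 A field_differentiable at z within bisector \<theta>"
    using field_differentiable_at_within field_differentiable_def by blast
qed

lemma slice_coeff_cnj: "z \<in> bisector \<theta> \<Longrightarrow> slice_coeff f0 f1 A (cnj z) = cnj (slice_coeff f0 f1 A z)"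
  using slice_components_D(2,3) by (simp add: slice_coeff_def complex_eq_iff)

lemma slice_components_continuous:
  "continuous_on (slice_domain (double_sector \<theta> :: 'n clifford set)) f0"
  "continuous_on (slice_domain (double_sector \<theta> :: 'n clifford set)) f1"
proof -
  have "continuous_on S h" if c1: "C1_on S h" for S and h :: "real \<times> real \<Rightarrow> 'n clifford"
  proof -
    obtain h' where "\<forall>p\<in>S. (h has_derivative blinfun_apply (h' p)) (at p)" using c1 unfolding C1_on_def by blast
    then show ?thesis
      by (intro continuous_at_imp_continuous_on ballI) (blast intro: has_derivative_continuous)
  qed
  then show "continuous_on (slice_domain (double_sector \<theta> :: 'n clifford set)) f0"
    "continuous_on (slice_domain (double_sector \<theta> :: 'n clifford set)) f1"
    using sc unfolding slice_components_def by blast+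
qed

lemma scaled_cexp: "r *\<^sub>R cexp J \<phi> = slice_point J (Re (of_real r * cis \<phi>)) (Im (of_real r * cis \<phi>))"
  by (simp add: cexp_def slice_point_def creal_def algebra_simps)

lemma angle_in_bisector:
  assumes "\<phi> \<in> angles \<theta>" "r > 0"
  shows "of_real r * cis \<phi> \<in> bisector \<theta>"
proof -
  have "r * (cos \<theta> * \<bar>sin \<phi>\<bar>) < r * (sin \<theta> * \<bar>cos \<phi>\<bar>)" using angles_sin_cos[OF \<theta> assms(1)] assms(2) by simp
  then show ?thesis using assms(2) by (simp add: bisector_def abs_mult mult_ac)
qed

lemma ray_continuous:
  assumes J: "J \<in> imag_sphere" and \<phi>: "\<phi> \<in> angles \<theta>"
  shows "continuous_on {0<..} (\<lambda>r. f (r *\<^sub>R cexp J \<phi>))"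
proof -
  define c :: "real \<Rightarrow> real \<times> real" where "c r = (Re (of_real r * cis \<phi>), Im (of_real r * cis \<phi>))" for r
  have cont: "continuous_on {0<..} c" unfolding c_def by (intro continuous_intros)
  have loc: "c ` {0<..} \<subseteq> slice_domain (double_sector \<theta> :: 'n clifford set)"
    unfolding c_def using angle_in_bisector[OF \<phi>] mem_slice_domain_iff[OF \<theta>] by blast
  have "continuous_on {0<..} (\<lambda>r. f0 (c r) + J \<odot> f1 (c r))"
    by (intro continuous_intros cmult.continuous_on continuous_on_compose2[OF slice_components_continuous(1) cont loc]
        continuous_on_compose2[OF slice_components_continuous(2) cont loc])
  then show ?thesis
    by (rule continuous_on_eq) (use slice_components_D(1)[OF angle_in_bisector[OF \<phi>] J] in \<open>simp add: scaled_cexp c_def\<close>)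
qed

text \<open>The values of \<open>f\<close> at \<open>x + J y\<close> and \<open>x - J y\<close> are
  \<open>f0 + J f1\<close> and \<open>f0 - J f1\<close>; half sum and half difference give
  \<open>f0\<close> and \<open>J f1\<close>, and multiplication by \<open>J\<close> recovers
  \<open>- f1\<close>. Two conjugate points enter, so decay of a component along one ray uses decay
  of \<open>f\<close> along two.\<close>

lemma slice_coeff_bound:
  obtains c where "c > 0" "\<And>z J A. z \<in> bisector \<theta> \<Longrightarrow> J \<in> imag_sphere \<Longrightarrow>
    cmod (slice_coeff f0 f1 A z) \<le> c * (norm (f (slice_point J (Re z) (Im z))) + norm (f (slice_point J (Re z) (- Im z))))"
proof -
  obtain b where b: "b > 0" "\<And>x y :: 'n clifford. norm (x \<odot> y) \<le> norm x * norm y * b"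
    using cmult.pos_bounded by blast
  show ?thesis
  proof (rule that[of "1 + b"])
    fix z and J :: "'n clifford" and A assume z: "z \<in> bisector \<theta>" and J: "J \<in> imag_sphere"
    let ?s = "f (slice_point J (Re z) (Im z))" and ?t = "f (slice_point J (Re z) (- Im z))"
    let ?f0 = "f0 (Re z, Im z)" and ?f1 = "f1 (Re z, Im z)"
    have "cnj z \<in> bisector \<theta>" using z by (simp add: bisector_def)
    from slice_components_D(1)[OF this J] slice_components_D(1)[OF z J] slice_components_D(2,3)[OF z]
    have st: "?s = ?f0 + J \<odot> ?f1" "?t = ?f0 - J \<odot> ?f1" by (simp_all add: cmult.minus_right)
    have nJ: "norm J = 1" using J by (simp add: imag_sphere_def)
    have e0: "?f0 = (1 / 2) *\<^sub>R (?s + ?t)" unfolding st by (simp add: scaleR_2[symmetric])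
    have "norm (?s + ?t) \<le> norm ?s + norm ?t" "norm (?s - ?t) \<le> norm ?s + norm ?t"
      by (rule norm_triangle_ineq norm_triangle_ineq4)+
    then have n: "norm ((1 / 2) *\<^sub>R (?s + ?t)) \<le> norm ?s + norm ?t" "norm ((1 / 2) *\<^sub>R (?s - ?t)) \<le> norm ?s + norm ?t"
      using norm_ge_zero[of "?s + ?t"] norm_ge_zero[of "?s - ?t"] by (simp_all del: norm_ge_zero)
    have "(1 / 2) *\<^sub>R (?s - ?t) = J \<odot> ?f1" unfolding st by (simp add: scaleR_2[symmetric])
    then have "J \<odot> ((1 / 2) *\<^sub>R (?s - ?t)) = - ?f1"
      by (simp only: cmult_assoc[symmetric] imag_sphere_square[OF J] cmult.minus_left cmult_one)
    then have "norm ?f1 = norm (J \<odot> ((1 / 2) *\<^sub>R (?s - ?t)))" by (simp only: norm_minus_cancel)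
    also have "\<dots> \<le> 1 * norm ((1 / 2) *\<^sub>R (?s - ?t)) * b" using b(2)[of J] nJ by metis
    also have "\<dots> \<le> b * (norm ?s + norm ?t)" using n(2) b(1) by (simp add: mult.commute)
    finally have "norm ?f1 \<le> b * (norm ?s + norm ?t)" .
    moreover have "norm ?f0 \<le> norm ?s + norm ?t" using n(1) e0 by simp
    moreover have "cmod (slice_coeff f0 f1 A z) \<le> \<bar>?f0 $ A\<bar> + \<bar>?f1 $ A\<bar>"
      using cmod_le[of "slice_coeff f0 f1 A z"] by (simp add: slice_coeff_def)
    moreover have "\<bar>?f0 $ A\<bar> \<le> norm ?f0" "\<bar>?f1 $ A\<bar> \<le> norm ?f1" by (rule component_le_norm_cart)+
    ultimately show "cmod (slice_coeff f0 f1 A z) \<le> (1 + b) * (norm ?s + norm ?t)" by (simp add: algebra_simps)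
  qed (use b(1) in simp)
qed

text \<open>The passage from a finite Lebesgue integral to Henstock-Kurzweil integrability;
  continuity along the ray supplies measurability.\<close>

lemma omega_decay_integrable:
  assumes dec: "omega_decay \<theta> f" and J: "J \<in> imag_sphere" and \<phi>: "\<phi> \<in> angles \<theta>"
  shows "(\<lambda>r. norm (f (r *\<^sub>R cexp J \<phi>)) / r) integrable_on {0<..}"
proof -
  let ?g = "\<lambda>r. norm (f (r *\<^sub>R cexp J \<phi>)) / r"
  have fin: "(\<integral>\<^sup>+t\<in>{0<..}. ennreal (?g t) \<partial>lborel) < \<infinity>" using dec J \<phi> unfolding omega_decay_def by blast
  have meas: "(\<lambda>r. indicator {0<..} r *\<^sub>R ?g r) \<in> borel_measurable borel"
    by (rule borel_measurable_continuous_on_indicator) (auto intro!: continuous_intros ray_continuous J \<phi>)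
  have "(\<lambda>r. indicator {0<..} r *\<^sub>R ?g r) integrable_on UNIV"
  proof (rule nn_integral_integrable_on[OF meas])
    show "0 \<le> indicator {0<..} r *\<^sub>R ?g r" for r by (simp add: indicator_def)
    have "(\<integral>\<^sup>+r. ennreal (indicator {0<..} r *\<^sub>R ?g r) \<partial>lborel) = (\<integral>\<^sup>+t\<in>{0<..}. ennreal (?g t) \<partial>lborel)"
      by (rule nn_integral_cong) (simp add: indicator_def)
    then show "(\<integral>\<^sup>+r. ennreal (indicator {0<..} r *\<^sub>R ?g r) \<partial>lborel) < \<infinity>" using fin by simp
  qed
  moreover have "(\<lambda>r. indicator {0<..} r *\<^sub>R ?g r) = (\<lambda>r. if r \<in> {0<..} then ?g r else 0)"
    by (auto simp: indicator_def)
  ultimately show ?thesis by (simp only: Henstock_Kurzweil_Integration.integrable_restrict_UNIV)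
qed

lemma slice_coeff_ray_decay:
  assumes dec: "omega_decay \<theta> f"
  shows "ray_decay \<theta> (slice_coeff f0 f1 A)"
proof -
  obtain c where c: "c > 0" "\<And>z J A. z \<in> bisector \<theta> \<Longrightarrow> J \<in> imag_sphere \<Longrightarrow>
    cmod (slice_coeff f0 f1 A z) \<le> c * (norm (f (slice_point J (Re z) (Im z))) + norm (f (slice_point J (Re z) (- Im z))))"
    using slice_coeff_bound by blast
  obtain J :: "'n clifford" where J: "J \<in> imag_sphere" using imag_sphere_nonempty by blast
  obtain M where M: "\<And>s. s \<in> double_sector \<theta> \<Longrightarrow> norm (f s) \<le> M"
    using dec unfolding omega_decay_def bounded_iff by blast
  have "cmod (slice_coeff f0 f1 A z) \<le> c * (M + M)" if z: "z \<in> bisector \<theta>" for z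
  proof -
    have "slice_point J (Re z) (Im z) \<in> double_sector \<theta>" "slice_point J (Re z) (- Im z) \<in> double_sector \<theta>"
      using z by (simp_all add: slice_point_in_double_sector_iff[OF \<theta> J] bisector_def)
    then have "c * (norm (f (slice_point J (Re z) (Im z))) + norm (f (slice_point J (Re z) (- Im z)))) \<le> c * (M + M)"
      using c(1) by (intro mult_left_mono add_mono M) auto
    with c(2)[OF z J, of A] show ?thesis by linarith
  qed
  then have "bounded (slice_coeff f0 f1 A ` bisector \<theta>)" by (auto simp: bounded_iff)
  moreover have "(\<lambda>r. cmod (slice_coeff f0 f1 A (of_real r * dir p \<phi>)) / r) integrable_on {0<..}"
    if p: "p \<in> signs" and \<phi>: "\<phi> \<in> {0<..<\<theta>}" for p \<phi>
  proof -
    \<comment> \<open>\<open>\<alpha>\<close> is an argument of the ray and \<open>\<beta>\<close>,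
      below, one of the conjugate ray, taken near 0 or near \<open>pi\<close> so that both lie in
      \<open>angles \<theta>\<close>.\<close>
    define \<alpha> where "\<alpha> = (if fst p = 1 then - snd p * \<phi> else pi - snd p * \<phi>)"
    have a: "\<alpha> \<in> angles \<theta>" "- \<alpha> \<in> angles \<theta> \<or> 2 * pi - \<alpha> \<in> angles \<theta>"
      using p \<phi> \<theta> by (auto simp: \<alpha>_def angles_def)
    define \<beta> where "\<beta> = (if fst p = 1 then snd p * \<phi> else pi + snd p * \<phi>)"
    have b: "\<beta> \<in> angles \<theta>" using p \<phi> \<theta> by (auto simp: \<beta>_def angles_def)
    have cis: "cis \<alpha> = dir p \<phi>" "cis \<beta> = cnj (dir p \<phi>)"
      using p by (auto simp: \<alpha>_def \<beta>_def ray_dir_def complex_eq_iff cos_diff sin_diff cos_add sin_add)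
    have le: "cmod (slice_coeff f0 f1 A (of_real r * dir p \<phi>)) / r
        \<le> c * (norm (f (r *\<^sub>R cexp J \<alpha>)) / r + norm (f (r *\<^sub>R cexp J \<beta>)) / r)" if r: "r > 0" for r
    proof -
      have "of_real r * dir p \<phi> \<in> bisector \<theta>" using angle_in_bisector[OF a(1) r] by (simp add: cis)
      from divide_right_mono[OF c(2)[OF this J, of A], of r] r show ?thesis
        unfolding scaled_cexp cis add_divide_distrib[symmetric] times_divide_eq_right by simp
    qed
    have int: "(\<lambda>r. c * (norm (f (r *\<^sub>R cexp J \<alpha>)) / r + norm (f (r *\<^sub>R cexp J \<beta>)) / r)) integrable_on {0<..}"
      using integrable_cmul[OF integrable_add[OF omega_decay_integrable[OF dec J a(1)] omega_decay_integrable[OF dec J b]], of c]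
      by simp
    show ?thesis
    proof (rule dominated_integrable_halfline[OF _ _ int])
      show "continuous_on {0<..} (\<lambda>r. cmod (slice_coeff f0 f1 A (of_real r * dir p \<phi>)) / r)"
        by (intro continuous_intros holomorphic_ray_continuous[OF slice_coeff_holomorphic p \<phi>]) (use \<theta> in auto)
    qed (use le in auto)
  qed
  ultimately show ?thesis using slice_coeff_holomorphic unfolding ray_decay_def by blast
qed

end

section \<open>Products of slice hyperholomorphic functions\<close>

lemma C1_on_bounded_linear:
  assumes "bounded_linear L" "C1_on S h"
  shows "C1_on S (\<lambda>p. L (h p))"
proof -
  obtain h' where h': "\<forall>p\<in>S. (h has_derivative blinfun_apply (h' p)) (at p)" "continuous_on S h'"
    using assms(2) unfolding C1_on_def by blast
  have "\<forall>p\<in>S. ((\<lambda>p. L (h p)) has_derivative blinfun_apply (Blinfun L o\<^sub>L h' p)) (at p)"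
    using h'(1) by (auto simp: bounded_linear_Blinfun_apply[OF assms(1)] blinfun_compose.rep_eq o_def
      intro!: bounded_linear.has_derivative[OF assms(1)])
  moreover have "continuous_on S (\<lambda>p. Blinfun L o\<^sub>L h' p)"
    by (intro bounded_bilinear.continuous_on[OF bounded_bilinear_blinfun_compose] continuous_on_const h')
  ultimately show ?thesis unfolding C1_on_def by (intro exI[of _ "\<lambda>p. Blinfun L o\<^sub>L h' p"] conjI)
qed

lemma C1_on_scaleR:
  fixes a :: "real \<times> real \<Rightarrow> real"
  assumes "C1_on S a" "C1_on S h"
  shows "C1_on S (\<lambda>p. a p *\<^sub>R h p)"
proof -
  obtain a' where a': "\<forall>p\<in>S. (a has_derivative blinfun_apply (a' p)) (at p)" "continuous_on S a'"
    using assms(1) unfolding C1_on_def by blast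
  obtain h' where h': "\<forall>p\<in>S. (h has_derivative blinfun_apply (h' p)) (at p)" "continuous_on S h'"
    using assms(2) unfolding C1_on_def by blast
  \<comment> \<open>The product rule as a bounded linear map depending on \<open>p\<close>, so that
    continuity of the derivative follows from that of its ingredients.\<close>
  define d where "d p = a p *\<^sub>R h' p + (blinfun_scaleR_left (h p) o\<^sub>L a' p)" for p
  have "((\<lambda>p. a p *\<^sub>R h p) has_derivative blinfun_apply (d p)) (at p)" if "p \<in> S" for p
  proof -
    have "((\<lambda>p. a p *\<^sub>R h p) has_derivative (\<lambda>v. a p *\<^sub>R h' p v + a' p v *\<^sub>R h p)) (at p)"
      using a'(1) h'(1) that by (intro has_derivative_scaleR) auto
    then show ?thesis by (simp add: d_def plus_blinfun.rep_eq scaleR_blinfun.rep_eq)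
  qed
  moreover have "continuous_on S a" "continuous_on S h"
    using a'(1) h'(1) by (meson continuous_at_imp_continuous_on has_derivative_continuous)+
  then have "continuous_on S d"
    unfolding d_def
    by (intro continuous_intros a' h' bounded_bilinear.continuous_on[OF bounded_bilinear_blinfun_compose]
        bounded_linear.continuous_on[OF bounded_linear_blinfun_scaleR_left])
  ultimately show ?thesis unfolding C1_on_def by blast
qed

lemma C1_on_add:
  assumes "C1_on S a" "C1_on S h"
  shows "C1_on S (\<lambda>p. a p + h p)"
proof -
  obtain a' where a': "\<forall>p\<in>S. (a has_derivative blinfun_apply (a' p)) (at p)" "continuous_on S a'"
    using assms(1) unfolding C1_on_def by blast
  obtain h' where h': "\<forall>p\<in>S. (h has_derivative blinfun_apply (h' p)) (at p)" "continuous_on S h'"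
    using assms(2) unfolding C1_on_def by blast
  have "\<forall>p\<in>S. ((\<lambda>p. a p + h p) has_derivative blinfun_apply (a' p + h' p)) (at p)"
    using a'(1) h'(1) has_derivative_add[of a _ _ h] by (auto simp: plus_blinfun.rep_eq)
  moreover have "continuous_on S (\<lambda>p. a' p + h' p)" by (intro continuous_intros a' h')
  ultimately show ?thesis unfolding C1_on_def by (intro exI[of _ "\<lambda>p. a' p + h' p"] conjI)
qed

text \<open>Real values of \<open>g0\<close> and \<open>g1\<close> commute with \<open>J\<close>, so
  \<open>(g0 + J g1) (f0 + J f1)\<close> multiplies out as for complex numbers, and the new
  components inherit the Cauchy-Riemann equations by the product rule. \<open>$ {}\<close> extracts
  the real value; the factor \<open>- 1\<close> reduces the difference to sums and scalings.\<close>

lemma slice_components_product: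
  fixes f g :: "'n::{finite,linorder} clifford \<Rightarrow> 'n clifford"
  assumes g: "slice_components U g g0 g1" and f: "slice_components U f f0 f1"
    and real: "\<forall>p\<in>slice_domain U. g0 p \<in> range creal \<and> g1 p \<in> range creal"
  shows "slice_components U (\<lambda>s. g s \<odot> f s)
    (\<lambda>p. g0 p $ {} *\<^sub>R f0 p + (- 1) *\<^sub>R (g1 p $ {} *\<^sub>R f1 p))
    (\<lambda>p. g0 p $ {} *\<^sub>R f1 p + g1 p $ {} *\<^sub>R f0 p)"
proof -
  let ?G0 = "\<lambda>p. g0 p $ {}" and ?G1 = "\<lambda>p. g1 p $ {}"
  let ?F0 = "\<lambda>p. ?G0 p *\<^sub>R f0 p + (- 1) *\<^sub>R (?G1 p *\<^sub>R f1 p)" and ?F1 = "\<lambda>p. ?G0 p *\<^sub>R f1 p + ?G1 p *\<^sub>R f0 p"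
  let ?S = "slice_domain U"
  have C: "C1_on ?S g0" "C1_on ?S g1" "C1_on ?S f0" "C1_on ?S f1"
    using g f by (auto simp: slice_components_def)
  have CG: "C1_on ?S ?G0" "C1_on ?S ?G1"
    by (rule C1_on_bounded_linear[OF bounded_linear_vec_nth] C)+
  have "C1_on ?S (\<lambda>p. (- 1) *\<^sub>R (?G1 p *\<^sub>R f1 p))"
    by (rule C1_on_bounded_linear[OF bounded_linear_scaleR_right C1_on_scaleR[OF CG(2) C(4)]])
  then have CF: "C1_on ?S ?F0" by (rule C1_on_add[OF C1_on_scaleR[OF CG(1) C(3)]])
  have CF': "C1_on ?S ?F1"
    by (rule C1_on_add[OF C1_on_scaleR[OF CG(1) C(4)] C1_on_scaleR[OF CG(2) C(3)]])
  have creal: "creal (a $ {}) = a" if "a \<in> range creal" for a :: "'n clifford"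
    using that by (auto simp: creal_def basis_elt_def)
  have pt: "(\<forall>J\<in>imag_sphere. g (slice_point J x y) \<odot> f (slice_point J x y) = ?F0 (x, y) + J \<odot> ?F1 (x, y)) \<and>
      ?F0 (x, - y) = ?F0 (x, y) \<and> ?F1 (x, - y) = - ?F1 (x, y) \<and>
      partial_x ?F0 (x, y) = partial_y ?F1 (x, y) \<and> partial_y ?F0 (x, y) = - partial_x ?F1 (x, y)"
    if xy: "(x, y) \<in> ?S" for x y
  proof -
    let ?p = "(x, y)"
    have gD: "J \<in> imag_sphere \<Longrightarrow> g (slice_point J x y) = g0 ?p + J \<odot> g1 ?p"
      "g0 (x, - y) = g0 ?p" "g1 (x, - y) = - g1 ?p"
      "partial_x g0 ?p = partial_y g1 ?p" "partial_y g0 ?p = - partial_x g1 ?p" for J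
      using g xy unfolding slice_components_def by blast+
    have fD: "J \<in> imag_sphere \<Longrightarrow> f (slice_point J x y) = f0 ?p + J \<odot> f1 ?p"
      "f0 (x, - y) = f0 ?p" "f1 (x, - y) = - f1 ?p"
      "partial_x f0 ?p = partial_y f1 ?p" "partial_y f0 ?p = - partial_x f1 ?p" for J
      using f xy unfolding slice_components_def by blast+
    have "g (slice_point J x y) \<odot> f (slice_point J x y) = ?F0 ?p + J \<odot> ?F1 ?p" if J: "J \<in> imag_sphere" for J
    proof -
      have "g0 ?p = creal (?G0 ?p)" "g1 ?p = creal (?G1 ?p)" using real xy creal by metis+
      then have "g (slice_point J x y) = creal (?G0 ?p) + J \<odot> creal (?G1 ?p)" using gD(1)[OF J] by simp
      then have gJ: "g (slice_point J x y) = creal (?G0 ?p) + ?G1 ?p *\<^sub>R J" by (simp only: cmult_creal)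
      have JJ: "J \<odot> (J \<odot> v) = - v" for v
        by (simp add: cmult_assoc[symmetric] imag_sphere_square[OF J] cmult.minus_left cmult_one)
      show ?thesis unfolding gJ fD(1)[OF J]
        by (simp add: cmult.add_left cmult.add_right cmult.scaleR_left cmult.scaleR_right cmult_creal JJ algebra_simps)
    qed
    moreover have "?F0 (x, - y) = ?F0 ?p" "?F1 (x, - y) = - ?F1 ?p" by (simp_all add: gD(2,3) fD(2,3))
    moreover have "partial_x ?F0 ?p = partial_y ?F1 ?p \<and> partial_y ?F0 ?p = - partial_x ?F1 ?p"
    proof -
      obtain g0' g1' f0' f1' where
        d: "(g0 has_derivative g0') (at ?p)" "(g1 has_derivative g1') (at ?p)"
          "(f0 has_derivative f0') (at ?p)" "(f1 has_derivative f1') (at ?p)"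
        using C xy unfolding C1_on_def by metis
      have dG: "(?G0 has_derivative (\<lambda>v. g0' v $ {})) (at ?p)" "(?G1 has_derivative (\<lambda>v. g1' v $ {})) (at ?p)"
        by (rule bounded_linear.has_derivative[OF bounded_linear_vec_nth] d)+
      have d0: "(?F0 has_derivative (\<lambda>v. (?G0 ?p *\<^sub>R f0' v + g0' v $ {} *\<^sub>R f0 ?p)
          + (- 1) *\<^sub>R (?G1 ?p *\<^sub>R f1' v + g1' v $ {} *\<^sub>R f1 ?p))) (at ?p)"
        by (intro has_derivative_add has_derivative_scaleR_right has_derivative_scaleR dG d)
      have d1: "(?F1 has_derivative (\<lambda>v. (?G0 ?p *\<^sub>R f1' v + g0' v $ {} *\<^sub>R f1 ?p)
          + (?G1 ?p *\<^sub>R f0' v + g1' v $ {} *\<^sub>R f0 ?p))) (at ?p)"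
        by (intro has_derivative_add has_derivative_scaleR dG d)
      have e: "f1' (0, 1) = f0' (1, 0)" "f1' (1, 0) = - f0' (0, 1)" "g1' (0, 1) = g0' (1, 0)" "g1' (1, 0) = - g0' (0, 1)"
        using fD(4,5) gD(4,5) partial_derivatives[OF d(1)] partial_derivatives[OF d(2)]
          partial_derivatives[OF d(3)] partial_derivatives[OF d(4)] by simp_all
      show ?thesis unfolding partial_derivatives[OF d0] partial_derivatives[OF d1] e by simp
    qed
    ultimately show ?thesis by blast
  qed
  then show ?thesis using CF CF' unfolding slice_components_def by blast
qed

lemma omega_decay_product:
  fixes f g :: "'n::{finite,linorder} clifford \<Rightarrow> 'n clifford"
  assumes \<theta>: "\<theta> \<in> {0<..<pi/2}" and f: "slice_components (double_sector \<theta>) f f0 f1"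
    and dec: "omega_decay \<theta> g" "omega_decay \<theta> f"
  shows "omega_decay \<theta> (\<lambda>s. g s \<odot> f s)"
proof -
  obtain b where b: "b > 0" "\<And>x y :: 'n clifford. norm (x \<odot> y) \<le> norm x * norm y * b"
    using cmult.pos_bounded by blast
  obtain M where M: "\<And>s. s \<in> double_sector \<theta> \<Longrightarrow> norm (g s) \<le> M"
    using dec(1) unfolding omega_decay_def bounded_iff by blast
  obtain N where N: "\<And>s. s \<in> double_sector \<theta> \<Longrightarrow> norm (f s) \<le> N"
    using dec(2) unfolding omega_decay_def bounded_iff by blast
  have le: "norm (g s \<odot> f s) \<le> \<bar>M\<bar> * b * norm (f s)" if "s \<in> double_sector \<theta>" for s
  proof -
    have "norm (g s \<odot> f s) \<le> norm (g s) * norm (f s) * b" by (rule b(2))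
    also have "\<dots> \<le> \<bar>M\<bar> * norm (f s) * b" using M[OF that] b(1) by (intro mult_right_mono) auto
    finally show ?thesis by (simp add: mult_ac)
  qed
  have "norm (g s \<odot> f s) \<le> \<bar>M\<bar> * b * N" if "s \<in> double_sector \<theta>" for s
    using le[OF that] mult_left_mono[OF N[OF that], of "\<bar>M\<bar> * b"] b(1) by simp
  then have "bounded ((\<lambda>s. g s \<odot> f s) ` double_sector \<theta>)" unfolding bounded_iff by blast
  moreover have "(\<integral>\<^sup>+t\<in>{0<..}. ennreal (norm (g (t *\<^sub>R cexp J \<phi>) \<odot> f (t *\<^sub>R cexp J \<phi>)) / t) \<partial>lborel) < \<infinity>"
    if J: "J \<in> imag_sphere" and \<phi>: "\<phi> \<in> angles \<theta>" for J :: "'n clifford" and \<phi>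
  proof -
    let ?h = "\<lambda>t. norm (f (t *\<^sub>R cexp J \<phi>)) / t"
    have meas: "(\<lambda>t. indicator {0<..} t *\<^sub>R ?h t) \<in> borel_measurable borel"
      by (rule borel_measurable_continuous_on_indicator) (auto intro!: continuous_intros ray_continuous[OF \<theta> f] J \<phi>)
    have fin: "(\<integral>\<^sup>+t\<in>{0<..}. ennreal (?h t) \<partial>lborel) < \<infinity>" using dec(2) J \<phi> unfolding omega_decay_def by blast
    have eq: "(\<integral>\<^sup>+t. ennreal (indicator {0<..} t *\<^sub>R ?h t) \<partial>lborel) = (\<integral>\<^sup>+t\<in>{0<..}. ennreal (?h t) \<partial>lborel)"
      by (rule nn_integral_cong) (simp add: indicator_def)
    have "(\<integral>\<^sup>+t\<in>{0<..}. ennreal (norm (g (t *\<^sub>R cexp J \<phi>) \<odot> f (t *\<^sub>R cexp J \<phi>)) / t) \<partial>lborel)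
        \<le> (\<integral>\<^sup>+t. ennreal (\<bar>M\<bar> * b) * ennreal (indicator {0<..} t *\<^sub>R ?h t) \<partial>lborel)"
    proof (rule nn_integral_mono)
      fix t :: real
      show "ennreal (norm (g (t *\<^sub>R cexp J \<phi>) \<odot> f (t *\<^sub>R cexp J \<phi>)) / t) * indicator {0<..} t
          \<le> ennreal (\<bar>M\<bar> * b) * ennreal (indicator {0<..} t *\<^sub>R ?h t)"
      proof (cases "t > 0")
        case True
        then have "t *\<^sub>R cexp J \<phi> \<in> double_sector \<theta>" using J \<phi> unfolding double_sector_def by blast
        from divide_right_mono[OF le[OF this], of t] True b(1) show ?thesis
          by (simp add: ennreal_mult[symmetric] ennreal_leI)
      qed simp
    qed
    also have "\<dots> = ennreal (\<bar>M\<bar> * b) * (\<integral>\<^sup>+t. ennreal (indicator {0<..} t *\<^sub>R ?h t) \<partial>lborel)"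
      using meas by (intro nn_integral_cmult) (simp add: measurable_lborel1)
    also have "\<dots> < \<infinity>" unfolding eq using fin by (simp add: ennreal_mult_less_top)
    finally show ?thesis .
  qed
  ultimately show ?thesis unfolding omega_decay_def by blast
qed

section \<open>The functional calculus in components\<close>

text \<open>Integrals over the line are limits over boxes containing a large ball around 0;
  reflection maps boxes to boxes and preserves that ball.\<close>

lemma has_integral_reflect_UNIV:
  fixes F :: "real \<Rightarrow> 'b::banach"
  assumes "(F has_integral I) UNIV"
  shows "((\<lambda>t. F (- t)) has_integral I) UNIV"
  unfolding has_integral_alt'
proof (intro conjI allI impI)
  have F: "F integrable_on cbox a b" for a b
    using assms integrable_on_subcbox has_integral_integrable by blast
  have R: "integral (cbox a b) (\<lambda>t. F (- t)) = integral (cbox (- b) (- a)) F" "(\<lambda>t. F (- t)) integrable_on cbox a b" for a b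
  proof -
    have "((\<lambda>t. F (- t)) has_integral integral (cbox (- b) (- a)) F) (cbox (- (- a)) (- (- b)))"
      by (rule has_integral_reflect_lemma[OF integrable_integral[OF F]])
    then have h: "((\<lambda>t. F (- t)) has_integral integral (cbox (- b) (- a)) F) (cbox a b)" by (simp only: minus_minus)
    show "integral (cbox a b) (\<lambda>t. F (- t)) = integral (cbox (- b) (- a)) F" by (rule integral_unique[OF h])
    show "(\<lambda>t. F (- t)) integrable_on cbox a b" by (rule has_integral_integrable[OF h])
  qed
  show "(\<lambda>t. if t \<in> UNIV then F (- t) else 0) integrable_on cbox a b" for a b using R(2)[of a b] by simp
  fix e :: real assume "e > 0"
  then obtain B where B: "B > 0" "\<And>a b. ball 0 B \<subseteq> cbox a b \<Longrightarrow> norm (integral (cbox a b) F - I) < e"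
    using assms unfolding has_integral_alt'[of F] by (auto simp del: box_real)
  have "ball 0 B \<subseteq> cbox (- b) (- a)" if ab: "ball 0 B \<subseteq> cbox a b" for a b :: real
  proof
    fix x :: real assume "x \<in> ball 0 B"
    then have "- x \<in> ball 0 B" by (simp add: dist_norm)
    then have "- x \<in> cbox a b" using ab by blast
    then show "x \<in> cbox (- b) (- a)" by auto
  qed
  then show "\<exists>B>0. \<forall>a b. ball 0 B \<subseteq> cbox a b \<longrightarrow> norm (integral (cbox a b) (\<lambda>t. if t \<in> UNIV then F (- t) else 0) - I) < e"
    using B by (intro exI[of _ B]) (simp add: R(1) del: box_real cbox_interval)
qed

lemma integral_UNIV_halves:
  fixes F :: "real \<Rightarrow> 'b::banach"
  assumes "F integrable_on {0<..}" "(\<lambda>t. F (- t)) integrable_on {0<..}"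
  shows "integral UNIV F = integral {0<..} F + integral {0<..} (\<lambda>t. F (- t))"
proof -
  have "((\<lambda>t. if t \<in> {0<..} then F t else 0) has_integral integral {0<..} F) UNIV"
    using integrable_integral[OF assms(1)] by (simp only: has_integral_restrict_UNIV)
  moreover have "((\<lambda>t. if - t \<in> {0<..} then F t else 0) has_integral integral {0<..} (\<lambda>t. F (- t))) UNIV"
  proof -
    have "((\<lambda>t. if t \<in> {0<..} then F (- t) else 0) has_integral integral {0<..} (\<lambda>t. F (- t))) UNIV"
      using integrable_integral[OF assms(2)] by (simp only: has_integral_restrict_UNIV)
    from has_integral_reflect_UNIV[OF this] show ?thesis by (simp only: minus_minus)
  qed
  ultimately have "((\<lambda>t. (if t \<in> {0<..} then F t else 0) + (if - t \<in> {0<..} then F t else 0)) has_integral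
      integral {0<..} F + integral {0<..} (\<lambda>t. F (- t))) UNIV"
    by (rule has_integral_add)
  \<comment> \<open>Only \<open>t = 0\<close> belongs to neither half.\<close>
  then have "(F has_integral integral {0<..} F + integral {0<..} (\<lambda>t. F (- t))) UNIV"
    by (rule has_integral_spike[of "{0}", rotated 2]) auto
  then show ?thesis by (rule integral_unique)
qed

definition lmult_op :: "'n clifford \<Rightarrow> ('v::real_normed_vector, 'n::{finite,linorder}) cmodule \<Rightarrow>\<^sub>L ('v, 'n) cmodule" where
  "lmult_op a = Blinfun (lmult a)"

lemma lmult_op_apply: "blinfun_apply (lmult_op a) v = lmult a v"
  unfolding lmult_op_def by (simp add: bounded_linear_Blinfun_apply lmult.bounded_linear_right)

lemma lmult_op_expand: "lmult_op a = (\<Sum>A\<in>UNIV. a $ A *\<^sub>R lmult_op (basis_elt A))"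
  by (rule blinfun_eqI)
     (simp add: lmult_op_apply blinfun.sum_left blinfun.scaleR_left flip: lmult.scaleR_left lmult.sum_left clifford_expand)

lemma lmult_op_one: "lmult_op (basis_elt {}) = id_blinfun"
  by (rule blinfun_eqI) (simp add: lmult_op_apply lmult_one)

lemma sector_path_eq:
  assumes "\<tau> \<in> {1, -1}" "r > 0" "\<sigma> \<in> {1, -1}"
  shows "sector_path J \<phi> \<sigma> (\<tau> * r) = slice_point J (Re (of_real r * ray_dir \<sigma> \<tau> \<phi>)) (Im (of_real r * ray_dir \<sigma> \<tau> \<phi>))"
  using assms by (auto simp: sector_path_def cexp_def slice_point_def creal_def ray_dir_def algebra_simps)

text \<open>Where \<open>t\<close> has sign \<open>\<tau>\<close> the path is linear in
  \<open>t\<close>, since \<open>\<bar>t\<bar> = \<tau> * t\<close> and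
  \<open>sgn t = \<tau>\<close>. The factor \<open>\<tau>\<close> records that for
  \<open>\<tau> = -1\<close> the ray is run through towards the origin.\<close>

lemma vector_derivative_sector_path:
  assumes \<tau>: "\<tau> \<in> {1, -1}" and r: "r > 0" and \<sigma>: "\<sigma> \<in> {1, -1}"
  shows "vector_derivative (sector_path J \<phi> \<sigma>) (at (\<tau> * r)) = \<tau> *\<^sub>R slice_point J (Re (ray_dir \<sigma> \<tau> \<phi>)) (Im (ray_dir \<sigma> \<tau> \<phi>))"
proof (rule vector_derivative_at)
  let ?c = "\<tau> *\<^sub>R slice_point J (Re (ray_dir \<sigma> \<tau> \<phi>)) (Im (ray_dir \<sigma> \<tau> \<phi>))"
  have "((\<lambda>t. t *\<^sub>R ?c) has_vector_derivative ?c) (at (\<tau> * r))"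
    by (auto intro!: derivative_eq_intros simp: has_vector_derivative_def)
  then show "(sector_path J \<phi> \<sigma> has_vector_derivative ?c) (at (\<tau> * r))"
  proof (rule has_vector_derivative_transform_within_open)
    show "open {t. 0 < \<tau> * t}" by (intro open_Collect_less continuous_intros)
    show "\<tau> * r \<in> {t. 0 < \<tau> * t}" using \<tau> r by auto
    fix t assume "t \<in> {t. 0 < \<tau> * t}"
    then have t: "0 < \<tau> * t" by simp
    have tt: "\<tau> * (\<tau> * t) = t" using \<tau> by auto
    show "t *\<^sub>R ?c = sector_path J \<phi> \<sigma> t"
      using sector_path_eq[OF \<tau> t \<sigma>, of J \<phi>] unfolding tt
      by (simp add: slice_point_def creal_def algebra_simps)
  qed
qed

context bisectorial_operator
begin

text \<open>With \<open>m\<close> the value of \<open>h_A\<close> times the direction of the ray, this is the contribution of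
  the component \<open>A\<close> to the integrand: the part without \<open>J\<close> agrees on conjugate rays of opposite
  orientation and the part containing \<open>J\<close> cancels.\<close>

definition slice_term :: "'n clifford \<Rightarrow> 'n set \<Rightarrow> complex \<Rightarrow> complex \<Rightarrow> ('v, 'n) cmodule \<Rightarrow>\<^sub>L ('v, 'n) cmodule" where
  "slice_term J A m z = ((Im m *\<^sub>R slice_even z - Re m *\<^sub>R slice_odd z) o\<^sub>L lmult_op (basis_elt A))
     - ((Re m *\<^sub>R slice_even z + Im m *\<^sub>R slice_odd z) o\<^sub>L (lmult_op J o\<^sub>L lmult_op (basis_elt A)))"

text \<open>Under \<open>(m, z) \<mapsto> (cnj m, cnj z)\<close> the first bracket of
  \<open>slice_term\<close> changes sign and the second, which carries \<open>J\<close>, does not.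
  On the other side, \<open>m K(z)\<close> has the real part \<open>Re m * e + Im m * o\<close> and
  the imaginary part \<open>Im m * e - Re m * o\<close>, with \<open>e\<close> and \<open>o\<close>
  the even and odd parts of \<open>K\<close> at \<open>z\<close>; subtracting the conjugate and
  multiplying by \<open>- i\<close> leaves twice the imaginary part.\<close>

lemma slice_term_pair:
  assumes J: "J \<in> imag_sphere" and z: "z \<in> cobisector \<omega>"
  shows "slice_term J A m z - slice_term J A (cnj m) (cnj z)
    = cscale (right_unit i) (- \<i>) (cscale (right_unit i) m (K z) - cscale (right_unit i) (cnj m) (K (cnj z))) o\<^sub>L lmult_op (basis_elt A)"
proof -
  let ?j = "right_unit i :: ('v, 'n) cmodule \<Rightarrow>\<^sub>L ('v, 'n) cmodule"
  have jj: "?j o\<^sub>L (?j o\<^sub>L k) = - k" for k :: "('v, 'n) cmodule \<Rightarrow>\<^sub>L ('v, 'n) cmodule"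
    by (simp add: compose_assoc[symmetric] right_unit_square compose_bilinear compose_id)
  have two: "(c * 2) *\<^sub>R k = c *\<^sub>R k + c *\<^sub>R k" for c and k :: "('v, 'n) cmodule \<Rightarrow>\<^sub>L ('v, 'n) cmodule"
    by (simp only: mult_2_right scaleR_left_distrib)
  have Kc: "K (cnj z) = slice_even z + (?j o\<^sub>L slice_odd z)"
    using K_slice[of "cnj z"] z
    by (simp add: cnj_cobisector slice_even_odd_cnj compose_bilinear)
  have eq: "cscale ?j (- \<i>) (cscale ?j m (K z) - cscale ?j (cnj m) (K (cnj z))) = 2 *\<^sub>R (Im m *\<^sub>R slice_even z - Re m *\<^sub>R slice_odd z)"
    unfolding Kc K_slice[OF z] cscale_def
    by (simp add: compose_bilinear jj scaleR_2 two algebra_simps)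
  show ?thesis
    unfolding slice_term_def eq by (simp add: slice_even_odd_cnj compose_bilinear scaleR_2 two algebra_simps)
qed

context
  fixes \<theta> :: real and f :: "'n clifford \<Rightarrow> 'n clifford" and f0 f1
  assumes \<theta>: "\<theta> \<in> {\<omega><..<pi / 2}" and sc: "slice_components (double_sector \<theta>) f f0 f1" and dec: "omega_decay \<theta> f"
begin

abbreviation h where "h \<equiv> slice_coeff f0 f1"

lemma theta': "\<theta> \<in> {0<..<pi/2}" using \<theta> \<omega> by auto

text \<open>With \<open>d = x + J y\<close> the direction of the ray,
  \<open>d (- J) (f0 + J f1) = P + J Q\<close>, where the components of \<open>P\<close> and
  \<open>- Q\<close> are the imaginary and real parts of \<open>d h_A\<close>. Multiplying by the
  S-resolvent, even part minus odd part times \<open>J\<close>, and using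
  \<open>J\<^sup>2 = - 1\<close> gives the four terms collected in \<open>L\<close>.\<close>

lemma omega_integrand:
  assumes J: "J \<in> imag_sphere" and \<phi>: "\<phi> \<in> {\<omega><..<\<theta>}" and p: "\<sigma> \<in> {1, -1}" "\<tau> \<in> {1, -1}" and r: "r > 0"
  defines "z \<equiv> of_real r * ray_dir \<sigma> \<tau> \<phi>"
  shows "Blinfun (\<lambda>v. SL_resolvent T (sector_path J \<phi> \<sigma> (\<tau> * r))
       (lmult (vector_derivative (sector_path J \<phi> \<sigma>) (at (\<tau> * r)) \<odot> (- J) \<odot> f (sector_path J \<phi> \<sigma> (\<tau> * r))) v))
    = \<tau> *\<^sub>R (\<Sum>A\<in>UNIV. slice_term J A (ray_dir \<sigma> \<tau> \<phi> * h A z) z)"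
proof -
  define x y where "x = Re (ray_dir \<sigma> \<tau> \<phi>)" and "y = Im (ray_dir \<sigma> \<tau> \<phi>)"
  define u w where "u = f0 (Re z, Im z)" and "w = f1 (Re z, Im z)"
  define P Q where "P = x *\<^sub>R w + y *\<^sub>R u" and "Q = y *\<^sub>R w - x *\<^sub>R u"
  have zb: "z \<in> bisector \<theta>" unfolding z_def using p \<phi> r \<omega> \<theta> by (intro ray_in_bisector) auto
  have zc: "z \<in> cobisector \<omega>" unfolding z_def using p \<phi> r \<omega> \<theta> by (intro ray_in_cobisector) auto
  have JJ: "J \<odot> (J \<odot> a) = - a" for a
    by (simp add: cmult_assoc[symmetric] imag_sphere_square[OF J] cmult.minus_left cmult_one)
  have s: "sector_path J \<phi> \<sigma> (\<tau> * r) = slice_point J (Re z) (Im z)"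
    unfolding z_def by (rule sector_path_eq) (use p r in auto)
  have d: "vector_derivative (sector_path J \<phi> \<sigma>) (at (\<tau> * r)) = \<tau> *\<^sub>R slice_point J x y"
    unfolding x_def y_def by (rule vector_derivative_sector_path) (use p r in auto)
  have "slice_point J x y \<odot> (- J) \<odot> (u + J \<odot> w) = P + J \<odot> Q"
    unfolding slice_point_def P_def Q_def cmult_assoc
    by (simp add: cmult.add_left cmult.add_right cmult.diff_right cmult.scaleR_left cmult.scaleR_right cmult.minus_left
        cmult.minus_right cmult_creal JJ algebra_simps)
  then have a: "vector_derivative (sector_path J \<phi> \<sigma>) (at (\<tau> * r)) \<odot> (- J) \<odot> f (sector_path J \<phi> \<sigma> (\<tau> * r))
      = \<tau> *\<^sub>R (P + J \<odot> Q)"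
    unfolding d unfolding s slice_components_D(1)[OF theta' sc zb J] u_def[symmetric] w_def[symmetric]
    by (simp only: cmult.scaleR_left)
  define L where "L = \<tau> *\<^sub>R ((slice_even z o\<^sub>L lmult_op P) + (slice_odd z o\<^sub>L lmult_op Q)
      + ((slice_even z o\<^sub>L (lmult_op J o\<^sub>L lmult_op Q)) - (slice_odd z o\<^sub>L (lmult_op J o\<^sub>L lmult_op P))))"
  have "(\<lambda>v. SL_resolvent T (sector_path J \<phi> \<sigma> (\<tau> * r))
       (lmult (vector_derivative (sector_path J \<phi> \<sigma>) (at (\<tau> * r)) \<odot> (- J) \<odot> f (sector_path J \<phi> \<sigma> (\<tau> * r))) v))
     = blinfun_apply L"
    unfolding a unfolding s SL_resolvent_even_odd[OF zc J]
  proof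
    fix v :: "('v, 'n) cmodule"
    have odd: "lmult J (lmult (P + J \<odot> Q) v) = lmult J (lmult P v) - lmult Q v"
      unfolding lmult_lmult cmult.add_right JJ by (simp add: lmult.diff_left lmult.add_left lmult.minus_left)
    have even: "lmult (P + J \<odot> Q) v = lmult P v + lmult J (lmult Q v)"
      by (simp only: lmult_lmult lmult.add_left)
    show "slice_even z (lmult (\<tau> *\<^sub>R (P + J \<odot> Q)) v) - slice_odd z (lmult J (lmult (\<tau> *\<^sub>R (P + J \<odot> Q)) v)) = L v"
      unfolding lmult.scaleR_left lmult.scaleR_right odd unfolding even
      by (simp add: L_def blinfun.scaleR_right blinfun.scaleR_left blinfun.add_left
          blinfun.diff_left blinfun.add_right blinfun.diff_right lmult_op_apply algebra_simps)
  qed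
  then have "Blinfun (\<lambda>v. SL_resolvent T (sector_path J \<phi> \<sigma> (\<tau> * r))
       (lmult (vector_derivative (sector_path J \<phi> \<sigma>) (at (\<tau> * r)) \<odot> (- J) \<odot> f (sector_path J \<phi> \<sigma> (\<tau> * r))) v)) = L"
    by (simp only: blinfun_apply_inverse)
  also have "L = \<tau> *\<^sub>R (\<Sum>A\<in>UNIV. slice_term J A (ray_dir \<sigma> \<tau> \<phi> * h A z) z)"
  proof -
    have "P $ A = Im (ray_dir \<sigma> \<tau> \<phi> * h A z)" "Q $ A = - Re (ray_dir \<sigma> \<tau> \<phi> * h A z)" for A
      by (simp_all add: P_def Q_def slice_coeff_def u_def w_def x_def y_def algebra_simps)
    then have PQ: "lmult_op P = (\<Sum>A\<in>UNIV. Im (ray_dir \<sigma> \<tau> \<phi> * h A z) *\<^sub>R lmult_op (basis_elt A))"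
      "lmult_op Q = (\<Sum>A\<in>UNIV. (- Re (ray_dir \<sigma> \<tau> \<phi> * h A z)) *\<^sub>R lmult_op (basis_elt A))"
      using lmult_op_expand[of P] lmult_op_expand[of Q] by (simp_all del: times_complex.sel)
    show ?thesis
      unfolding L_def PQ slice_term_def
      by (simp add: compose_sum compose_bilinear sum.distrib sum_subtractf sum_negf algebra_simps del: times_complex.sel)
  qed
  finally show ?thesis .
qed

lemma slice_term_integrable:
  assumes \<phi>: "\<phi> \<in> {\<omega><..<\<theta>}" and p: "p \<in> signs"
  shows "(\<lambda>r. slice_term J A (dir p \<phi> * h A (of_real r * dir p \<phi>)) (of_real r * dir p \<phi>)) integrable_on {0<..}"
proof -
  \<comment> \<open>An angle strictly between \<open>\<omega>\<close> and \<open>\<phi>\<close>: the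
    uniform resolvent bound holds on \<open>cobisector \<psi>\<close>, and the contour of angle
    \<open>\<phi>\<close> lies there.\<close>
  define \<psi> where "\<psi> = (\<omega> + \<phi>) / 2"
  have \<psi>: "\<psi> \<in> {\<omega><..<pi/2}" "\<phi> \<in> {\<psi><..<pi/2}" and \<phi>': "\<phi> \<in> {0<..<\<theta>}" using \<phi> \<theta> \<omega> by (auto simp: \<psi>_def)
  obtain C where "resolvent (right_unit i) K \<psi> C" using resolvent_locale[OF \<psi>(1)] by blast
  then interpret r: resolvent "right_unit i" K \<psi> C .
  \<comment> \<open>The even and odd parts contain the resolvent at \<open>cnj z\<close>, so the
    conjugate ray enters as well.\<close>
  define p' where "p' = (fst p, - snd p)"
  have p': "p' \<in> signs" using p by (auto simp: p'_def)
  have cnj: "cnj (of_real r * dir p \<phi>) = of_real r * dir p' \<phi>" for r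
    by (simp add: ray_dir_def p'_def cis_cnj)
  define m where "m r = dir p \<phi> * h A (of_real r * dir p \<phi>)" for r
  have dec_h: "ray_decay \<theta> (h A)" by (rule slice_coeff_ray_decay[OF theta' sc dec])
  then have mc: "continuous_on {0<..} m"
    unfolding m_def ray_decay_def using \<theta>
    by (intro continuous_intros holomorphic_ray_continuous[OF _ p \<phi>']) auto
  have mi: "(\<lambda>r. cmod (m r) / r) integrable_on {0<..}"
    using dec_h p \<phi>' r.norm_dir[OF p] unfolding ray_decay_def m_def by (simp only: norm_mult mult_1)
  have Ki: "(\<lambda>r. a r *\<^sub>R K (of_real r * dir q \<phi>)) integrable_on {0<..}"
    if a: "continuous_on {0<..} a" "\<And>r. \<bar>a r\<bar> \<le> cmod (m r)" and q: "q \<in> signs" for a q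
    using r.cs_K_ray_integrable(2)[OF q \<psi>(2), of "\<lambda>r. of_real (a r)" "\<lambda>r. cmod (m r)"] a mi
    by (simp add: r.cs_of_real continuous_on_of_real)
  have even: "(\<lambda>r. a r *\<^sub>R slice_even (of_real r * dir p \<phi>)) integrable_on {0<..}"
    if a: "continuous_on {0<..} a" "\<And>r. \<bar>a r\<bar> \<le> cmod (m r)" for a
    using integrable_cmul[OF integrable_add[OF Ki[OF a p] Ki[OF a p']], of "1 / 2"]
    unfolding slice_even_def cnj by (simp add: scaleR_add_right mult.commute)
  have odd: "(\<lambda>r. a r *\<^sub>R slice_odd (of_real r * dir p \<phi>)) integrable_on {0<..}"
    if a: "continuous_on {0<..} a" "\<And>r. \<bar>a r\<bar> \<le> cmod (m r)" for a
    using integrable_linear[OF integrable_cmul[OF integrable_diff[OF Ki[OF a p] Ki[OF a p']], of "1 / 2"] r.compose_right_linear[of "right_unit i"]]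
    unfolding slice_odd_def cnj by (simp add: compose_bilinear o_def scaleR_diff_right mult.commute)
  have Re: "continuous_on {0<..} (\<lambda>r. Re (m r))" "\<And>r. \<bar>Re (m r)\<bar> \<le> cmod (m r)"
    and Im: "continuous_on {0<..} (\<lambda>r. Im (m r))" "\<And>r. \<bar>Im (m r)\<bar> \<le> cmod (m r)"
    by (auto intro!: continuous_intros mc abs_Re_le_cmod abs_Im_le_cmod)
  have "(\<lambda>r. slice_term J A (m r) (of_real r * dir p \<phi>)) integrable_on {0<..}"
    unfolding slice_term_def
    using integrable_diff[OF
        integrable_linear[OF integrable_diff[OF even[OF Im] odd[OF Re]] r.compose_left_linear[of "lmult_op (basis_elt A)"]]
        integrable_linear[OF integrable_add[OF even[OF Re] odd[OF Im]] r.compose_left_linear[of "lmult_op J o\<^sub>L lmult_op (basis_elt A)"]]]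
    by (simp only: o_def)
  then show ?thesis by (simp only: m_def)
qed

text \<open>For fixed \<open>\<sigma>\<close> the two halves of the real line are the conjugate rays
  \<open>\<tau> = 1\<close> and \<open>\<tau> = -1\<close>. Their integrands are subtracted under
  one integral, which eliminates \<open>J\<close>; in particular the value is the same for all
  units.\<close>

lemma omega_integral_eq:
  assumes J: "J \<in> imag_sphere" and \<phi>: "\<phi> \<in> {\<omega><..<\<theta>}"
  shows "omega_integral T f \<phi> J = (\<Sum>A\<in>UNIV. bisector_integral (right_unit i) K (h A) \<phi> o\<^sub>L lmult_op (basis_elt A))"
proof -
  define \<psi> where "\<psi> = (\<omega> + \<phi>) / 2"
  have \<psi>: "\<psi> \<in> {\<omega><..<pi/2}" "\<phi> \<in> {\<psi><..<pi/2}" and \<phi>': "\<phi> \<in> {0<..<\<theta>}" using \<phi> \<theta> \<omega> by (auto simp: \<psi>_def)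
  obtain C where "resolvent (right_unit i) K \<psi> C" using resolvent_locale[OF \<psi>(1)] by blast
  then interpret r: resolvent "right_unit i" K \<psi> C .
  define S where "S p A r = slice_term J A (dir p \<phi> * h A (of_real r * dir p \<phi>)) (of_real r * dir p \<phi>)" for p A r
  define M where "M p A r = r.cs (dir p \<phi> * h A (of_real r * dir p \<phi>)) (K (of_real r * dir p \<phi>))" for p A r
  define F where "F \<sigma> t = Blinfun (\<lambda>v. SL_resolvent T (sector_path J \<phi> \<sigma> t)
       (lmult (vector_derivative (sector_path J \<phi> \<sigma>) (at t) \<odot> (- J) \<odot> f (sector_path J \<phi> \<sigma> t)) v))" for \<sigma> t
  have Si: "S p A integrable_on {0<..}" if "p \<in> signs" for p A
    unfolding S_def by (rule slice_term_integrable[OF \<phi> that])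
  have dec_h: "ray_decay \<theta> (h A)" for A by (rule slice_coeff_ray_decay[OF theta' sc dec])
  have Mi: "M p A integrable_on {0<..}" if p: "p \<in> signs" for p A
    unfolding M_def
  proof (rule r.cs_K_ray_integrable(2)[OF p \<psi>(2)])
    show "continuous_on {0<..} (\<lambda>r. dir p \<phi> * h A (of_real r * dir p \<phi>))"
      using dec_h[of A] \<theta> unfolding ray_decay_def by (intro continuous_intros holomorphic_ray_continuous[OF _ p \<phi>']) auto
    show "cmod (dir p \<phi> * h A (of_real r * dir p \<phi>)) \<le> cmod (h A (of_real r * dir p \<phi>))" for r
      by (simp add: norm_mult r.norm_dir[OF p])
    show "(\<lambda>r. cmod (h A (of_real r * dir p \<phi>)) / r) integrable_on {0<..}"
      using dec_h[of A] p \<phi>' unfolding ray_decay_def by blast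
  qed
  have F: "F \<sigma> (\<tau> * r) = \<tau> *\<^sub>R (\<Sum>A\<in>UNIV. S (\<sigma>, \<tau>) A r)"
    if "\<sigma> \<in> {1, -1}" "\<tau> \<in> {1, -1}" "r > 0" for \<sigma> \<tau> r
    unfolding F_def S_def using omega_integrand[OF J \<phi> that] by simp
  have pair: "S (\<sigma>, 1) A r - S (\<sigma>, -1) A r = r.cs (- \<i>) (M (\<sigma>, 1) A r - M (\<sigma>, -1) A r) o\<^sub>L lmult_op (basis_elt A)"
    if \<sigma>: "\<sigma> \<in> {1, -1}" and r: "r > 0" for \<sigma> A r
  proof -
    define d where "d = ray_dir \<sigma> 1 \<phi>"
    have d': "ray_dir \<sigma> (-1) \<phi> = cnj d" by (simp add: ray_dir_def d_def cis_cnj)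
    have b: "of_real r * d \<in> bisector \<theta>" unfolding d_def using \<sigma> r \<phi>' \<theta> by (intro ray_in_bisector) auto
    have c: "of_real r * d \<in> cobisector \<omega>" unfolding d_def using \<sigma> r \<phi> \<phi>' \<theta> \<omega> by (intro ray_in_cobisector) auto
    have z: "of_real r * cnj d = cnj (of_real r * d)" by simp
    have m: "cnj d * h A (cnj (of_real r * d)) = cnj (d * h A (of_real r * d))"
      using slice_coeff_cnj[OF theta' sc b, of A] by simp
    show ?thesis
      unfolding S_def M_def fst_conv snd_conv d' d_def[symmetric] z m by (rule slice_term_pair[OF J c])
  qed
  have half: "integral UNIV (F \<sigma>) = (\<Sum>A\<in>UNIV. r.cs (- \<i>) (ray_integral (right_unit i) K (h A) (\<sigma>, 1) \<phi>
      - ray_integral (right_unit i) K (h A) (\<sigma>, -1) \<phi>) o\<^sub>L lmult_op (basis_elt A))" if \<sigma>: "\<sigma> \<in> {1, -1}" for \<sigma>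
  proof -
    have sg: "(\<sigma>, 1) \<in> signs" "(\<sigma>, -1) \<in> signs" using \<sigma> by auto
    have sum_int: "(\<lambda>r. \<tau> *\<^sub>R (\<Sum>A\<in>UNIV. S (\<sigma>, \<tau>) A r)) integrable_on {0<..}" if "\<tau> \<in> {1, -1}" for \<tau>
      using \<sigma> that by (intro integrable_cmul integrable_sum Si) auto
    have Fi: "F \<sigma> integrable_on {0<..}" "(\<lambda>t. F \<sigma> (- t)) integrable_on {0<..}"
      using integrable_eq[OF sum_int[of 1], of "F \<sigma>"] integrable_eq[OF sum_int[of "-1"], of "\<lambda>t. F \<sigma> (- t)"]
        F[OF \<sigma>, of 1] F[OF \<sigma>, of "-1"] by simp_all
    have FS: "integral {0<..} (\<lambda>r. F \<sigma> (\<tau> * r)) = \<tau> *\<^sub>R (\<Sum>A\<in>UNIV. integral {0<..} (S (\<sigma>, \<tau>) A))" if "\<tau> \<in> {1, -1}" for \<tau>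
    proof -
      have "integral {0<..} (\<lambda>r. F \<sigma> (\<tau> * r)) = integral {0<..} (\<lambda>r. \<tau> *\<^sub>R (\<Sum>A\<in>UNIV. S (\<sigma>, \<tau>) A r))"
        by (rule integral_cong) (use F[OF \<sigma> that] in auto)
      also have "\<dots> = \<tau> *\<^sub>R integral {0<..} (\<lambda>r. \<Sum>A\<in>UNIV. S (\<sigma>, \<tau>) A r)" by (rule integral_cmul)
      also have "integral {0<..} (\<lambda>r. \<Sum>A\<in>UNIV. S (\<sigma>, \<tau>) A r) = (\<Sum>A\<in>UNIV. integral {0<..} (S (\<sigma>, \<tau>) A))"
        by (rule integral_sum) (use Si \<sigma> that in auto)
      finally show ?thesis .
    qed
    have "integral UNIV (F \<sigma>) = (\<Sum>A\<in>UNIV. integral {0<..} (S (\<sigma>, 1) A)) - (\<Sum>A\<in>UNIV. integral {0<..} (S (\<sigma>, -1) A))"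
      using integral_UNIV_halves[OF Fi] FS[of 1] FS[of "-1"] by simp
    also have "\<dots> = (\<Sum>A\<in>UNIV. integral {0<..} (\<lambda>r. S (\<sigma>, 1) A r - S (\<sigma>, -1) A r))"
      unfolding sum_subtractf[symmetric] by (intro sum.cong refl integral_diff[symmetric] Si sg)
    also have "\<dots> = (\<Sum>A\<in>UNIV. r.cs (- \<i>) (ray_integral (right_unit i) K (h A) (\<sigma>, 1) \<phi>
      - ray_integral (right_unit i) K (h A) (\<sigma>, -1) \<phi>) o\<^sub>L lmult_op (basis_elt A))"
    proof (rule sum.cong[OF refl])
      fix A
      have "integral {0<..} (\<lambda>r. S (\<sigma>, 1) A r - S (\<sigma>, -1) A r)
          = integral {0<..} (\<lambda>r. r.cs (- \<i>) (M (\<sigma>, 1) A r - M (\<sigma>, -1) A r) o\<^sub>L lmult_op (basis_elt A))"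
        by (rule integral_cong) (use pair[OF \<sigma>] in auto)
      also have "\<dots> = r.cs (- \<i>) (integral {0<..} (\<lambda>r. M (\<sigma>, 1) A r - M (\<sigma>, -1) A r)) o\<^sub>L lmult_op (basis_elt A)"
        by (rule r.integral_bounded_linear[symmetric, OF integrable_diff[OF Mi[OF sg(1)] Mi[OF sg(2)]]
            bounded_linear_compose[OF r.compose_left_linear r.cs.bounded_linear_right]])
      also have "integral {0<..} (\<lambda>r. M (\<sigma>, 1) A r - M (\<sigma>, -1) A r)
          = ray_integral (right_unit i) K (h A) (\<sigma>, 1) \<phi> - ray_integral (right_unit i) K (h A) (\<sigma>, -1) \<phi>"
        unfolding ray_integral_def M_def[symmetric] by (rule integral_diff[OF Mi[OF sg(1)] Mi[OF sg(2)]])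
      finally show "integral {0<..} (\<lambda>r. S (\<sigma>, 1) A r - S (\<sigma>, -1) A r) = r.cs (- \<i>) (ray_integral (right_unit i) K (h A) (\<sigma>, 1) \<phi>
        - ray_integral (right_unit i) K (h A) (\<sigma>, -1) \<phi>) o\<^sub>L lmult_op (basis_elt A)" .
    qed
    finally show ?thesis .
  qed
  have "omega_integral T f \<phi> J = (1 / (2 * pi)) *\<^sub>R (\<Sum>\<sigma>\<in>{1, - 1}. integral UNIV (F \<sigma>))"
    by (simp only: omega_integral_def F_def[abs_def])
  also have "(\<Sum>\<sigma>\<in>{1, - 1}. integral UNIV (F \<sigma>)) = (\<Sum>A\<in>UNIV. r.cs (- \<i>) (\<Sum>\<sigma>\<in>{1, - 1}.
      ray_integral (right_unit i) K (h A) (\<sigma>, 1) \<phi> - ray_integral (right_unit i) K (h A) (\<sigma>, -1) \<phi>) o\<^sub>L lmult_op (basis_elt A))"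
    by (subst r.cs.sum_right, subst compose_sum, subst sum.swap) (intro sum.cong refl half)
  also have "(1 / (2 * pi)) *\<^sub>R \<dots> = (\<Sum>A\<in>UNIV. bisector_integral (right_unit i) K (h A) \<phi> o\<^sub>L lmult_op (basis_elt A))"
    unfolding scaleR_sum_right
  proof (rule sum.cong[OF refl])
    fix A
    let ?r = "\<lambda>p. ray_integral (right_unit i) K (h A) p \<phi>"
    have "(\<Sum>p\<in>signs. snd p *\<^sub>R ?r p) = (\<Sum>\<sigma>\<in>{1, - 1}. \<Sum>\<tau>\<in>{1, -1}. \<tau> *\<^sub>R ?r (\<sigma>, \<tau>))"
      by (simp only: sum.cartesian_product case_prod_unfold prod.collapse)
    also have "\<dots> = (\<Sum>\<sigma>\<in>{1, - 1}. ?r (\<sigma>, 1) - ?r (\<sigma>, -1))" by simp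
    finally have "bisector_integral (right_unit i) K (h A) \<phi> = r.cs (1 / (2 * pi * \<i>)) (\<Sum>\<sigma>\<in>{1, - 1}. ?r (\<sigma>, 1) - ?r (\<sigma>, -1))"
      by (simp only: bisector_integral_def)
    \<comment> \<open>The \<open>1 / (2 pi)\<close> of the calculus and the \<open>- i\<close>
      produced by the pairing combine to the Cauchy constant.\<close>
    moreover have "1 / (2 * pi * \<i>) = of_real (1 / (2 * pi)) * (- \<i>)" by (simp add: field_simps)
    ultimately show "(1 / (2 * pi)) *\<^sub>R (r.cs (- \<i>) (\<Sum>\<sigma>\<in>{1, - 1}. ?r (\<sigma>, 1) - ?r (\<sigma>, -1)) o\<^sub>L lmult_op (basis_elt A))
        = bisector_integral (right_unit i) K (h A) \<phi> o\<^sub>L lmult_op (basis_elt A)"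
      by (simp only: r.cs_cs[symmetric] r.cs_of_real compose_bilinear)
  qed
  finally show ?thesis .
qed

text \<open>The definite description is justified because the right side of
  \<open>omega_integral_eq\<close> contains no \<open>J\<close> and, by independence, has the same
  value at all angles; the existence of a unit and of an admissible angle gives uniqueness.\<close>

lemma omega_calculus_eq:
  assumes \<phi>: "\<phi> \<in> {\<omega><..<\<theta>}"
  shows "omega_calculus \<omega> \<theta> T f = (\<Sum>A\<in>UNIV. bisector_integral (right_unit i) K (h A) \<phi> o\<^sub>L lmult_op (basis_elt A))"
  unfolding omega_calculus_def
proof (rule the_equality)
  show "\<forall>\<psi>\<in>{\<omega><..<\<theta>}. \<forall>J\<in>imag_sphere. omega_integral T f \<psi> J
      = (\<Sum>A\<in>UNIV. bisector_integral (right_unit i) K (h A) \<phi> o\<^sub>L lmult_op (basis_elt A))"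
  proof (intro ballI)
    fix \<psi> and J :: "'n clifford" assume \<psi>: "\<psi> \<in> {\<omega><..<\<theta>}" and J: "J \<in> imag_sphere"
    \<comment> \<open>An angle below both contours, so that one instance of the resolvent bound
      covers them.\<close>
    define \<eta> where "\<eta> = (\<omega> + min \<phi> \<psi>) / 2"
    have \<eta>: "\<eta> \<in> {\<omega><..<pi/2}" "\<eta> < \<phi>" "\<eta> < \<psi>" using \<phi> \<psi> \<theta> by (auto simp: \<eta>_def min_def)
    obtain C where "resolvent (right_unit i) K \<eta> C" using resolvent_locale[OF \<eta>(1)] by blast
    then interpret r: resolvent "right_unit i" K \<eta> C .
    have "bisector_integral (right_unit i) K (h A) \<psi> = bisector_integral (right_unit i) K (h A) \<phi>" for A
      by (rule r.bisector_integral_independent[OF slice_coeff_ray_decay[OF theta' sc dec]]) (use \<eta> \<phi> \<psi> \<theta> in auto)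
    then show "omega_integral T f \<psi> J = (\<Sum>A\<in>UNIV. bisector_integral (right_unit i) K (h A) \<phi> o\<^sub>L lmult_op (basis_elt A))"
      unfolding omega_integral_eq[OF J \<psi>] by simp
  qed
  fix F assume F: "\<forall>\<psi>\<in>{\<omega><..<\<theta>}. \<forall>J\<in>imag_sphere. omega_integral T f \<psi> J = F"
  obtain J :: "'n clifford" where J: "J \<in> imag_sphere" using imag_sphere_nonempty by (rule exE)
  have "omega_integral T f \<phi> J = F" by (rule bspec[OF bspec[OF F \<phi>] J])
  then show "F = (\<Sum>A\<in>UNIV. bisector_integral (right_unit i) K (h A) \<phi> o\<^sub>L lmult_op (basis_elt A))"
    by (simp only: omega_integral_eq[OF J \<phi>])
qed

end

text \<open>Real values have only the component \<open>{}\<close>, so all other summands vanish on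
  the contour, and the basis element of \<open>{}\<close> acts as the identity. No left
  multiplication is left over in \<open>g(T)\<close>.\<close>

lemma omega_calculus_intrinsic:
  fixes g :: "'n clifford \<Rightarrow> 'n clifford" and g0 g1 :: "real \<times> real \<Rightarrow> 'n clifford"
  assumes \<theta>: "\<theta> \<in> {\<omega><..<pi / 2}" and sc: "slice_components (double_sector \<theta>) g g0 g1" and dec: "omega_decay \<theta> g"
    and real: "\<forall>p\<in>slice_domain (double_sector \<theta> :: 'n clifford set). g0 p \<in> range creal \<and> g1 p \<in> range creal"
    and \<phi>: "\<phi> \<in> {\<omega><..<\<theta>}"
  shows "omega_calculus \<omega> \<theta> T g = bisector_integral (right_unit i) K (slice_coeff g0 g1 {}) \<phi>"
proof -
  have \<theta>': "\<theta> \<in> {0<..<pi/2}" using \<theta> \<omega> by auto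
  have zero: "bisector_integral (right_unit i) K (slice_coeff g0 g1 A) \<phi> = 0" if "A \<noteq> {}" for A :: "'n set"
  proof -
    have zero: "slice_coeff g0 g1 A (of_real r * dir p \<phi>) = 0" if "p \<in> signs" "r > 0" for p r
    proof -
      have "of_real r * dir p \<phi> \<in> bisector \<theta>" using that \<phi> \<theta> \<omega> by (intro dir_bisector) auto
      then have "(Re (of_real r * dir p \<phi>), Im (of_real r * dir p \<phi>)) \<in> slice_domain (double_sector \<theta> :: 'n clifford set)"
        using mem_slice_domain_iff[OF \<theta>'] by blast
      with real have "g0 (Re (of_real r * dir p \<phi>), Im (of_real r * dir p \<phi>)) \<in> range creal"
        "g1 (Re (of_real r * dir p \<phi>), Im (of_real r * dir p \<phi>)) \<in> range creal" by blast+
      then show ?thesis using \<open>A \<noteq> {}\<close>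
        by (auto simp: slice_coeff_def creal_def basis_elt_def axis_def complex_eq_iff)
    qed
    have "ray_integral (right_unit i) K (slice_coeff g0 g1 A) p \<phi> = 0" if p: "p \<in> signs" for p
    proof -
      have "ray_integral (right_unit i) K (slice_coeff g0 g1 A) p \<phi> = integral {0<..} (\<lambda>r::real. 0)"
        unfolding ray_integral_def by (rule integral_cong) (use zero[OF p] in \<open>simp add: cscale_def\<close>)
      then show ?thesis by simp
    qed
    then show ?thesis unfolding bisector_integral_def by (simp add: cscale_def cong: sum.cong)
  qed
  have "(\<Sum>A\<in>UNIV. bisector_integral (right_unit i) K (slice_coeff g0 g1 A) \<phi> o\<^sub>L lmult_op (basis_elt A))
      = (\<Sum>A\<in>(UNIV :: 'n set set). if A = {} then bisector_integral (right_unit i) K (slice_coeff g0 g1 {}) \<phi> else 0)"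
    by (intro sum.cong) (auto simp: zero lmult_op_one compose_id compose_bilinear)
  then show ?thesis unfolding omega_calculus_eq[OF \<theta> sc dec \<phi>] by simp
qed

end

theorem theorem3p11:
  fixes T :: "('v::banach, 'n::{finite,linorder}) cmodule \<rightharpoonup> ('v, 'n) cmodule"
    and f g :: "'n clifford \<Rightarrow> 'n clifford"
    and \<omega> \<theta> :: real
  assumes "\<omega> \<in> {0<..<pi / 2}"
    and "bisectorial \<omega> T"
    and "\<theta> \<in> {\<omega><..<pi / 2}"
    and "g \<in> SH_intrinsic0 \<theta>"
    and "f \<in> SH_L0 \<theta>"
  shows "(\<lambda>s. g s \<odot> f s) \<in> SH_L0 \<theta> \<and>
    omega_calculus \<omega> \<theta> T (\<lambda>s. g s \<odot> f s) =
      omega_calculus \<omega> \<theta> T g o\<^sub>L omega_calculus \<omega> \<theta> T f"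
proof -
  note \<omega> = assms(1) and \<theta> = assms(3)
  have \<theta>': "\<theta> \<in> {0<..<pi/2}" using \<omega> \<theta> by auto
  obtain g0 g1 where g: "slice_components (double_sector \<theta>) g g0 g1"
    and real: "\<forall>p\<in>slice_domain (double_sector \<theta> :: 'n clifford set). g0 p \<in> range creal \<and> g1 p \<in> range creal"
    and dg: "omega_decay \<theta> g"
    using assms(4) unfolding SH_intrinsic0_def SH_intrinsic_def by blast
  obtain f0 f1 where f: "slice_components (double_sector \<theta>) f f0 f1" and df: "omega_decay \<theta> f"
    and U: "openin (top_of_set paravectors) (double_sector \<theta> :: 'n clifford set)" "axially_symmetric (double_sector \<theta> :: 'n clifford set)"
    using assms(5) unfolding SH_L0_def SH_L_def by blast
  define k0 where "k0 p = g0 p $ {} *\<^sub>R f0 p + (- 1) *\<^sub>R (g1 p $ {} *\<^sub>R f1 p)" for p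
  define k1 where "k1 p = g0 p $ {} *\<^sub>R f1 p + g1 p $ {} *\<^sub>R f0 p" for p
  have k: "slice_components (double_sector \<theta>) (\<lambda>s. g s \<odot> f s) k0 k1"
    using slice_components_product[OF g f real] by (simp only: k0_def[abs_def] k1_def[abs_def])
  have dk: "omega_decay \<theta> (\<lambda>s. g s \<odot> f s)" by (rule omega_decay_product[OF \<theta>' f dg df])
  have "(\<lambda>s. g s \<odot> f s) \<in> SH_L0 \<theta>" unfolding SH_L0_def SH_L_def using U k dk by blast
  moreover
  \<comment> \<open>Any generator will do as complex unit; the conclusion does not mention
    it.\<close>
  define i :: 'n where "i = undefined"
  interpret bisectorial_operator T \<omega> i using assms(1,2) by unfold_locales
  define \<phi> where "\<phi> = (\<omega> + \<theta>) / 2"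
  define \<psi> where "\<psi> = (\<omega> + \<phi>) / 2"
  have \<phi>: "\<phi> \<in> {\<omega><..<\<theta>}" using \<theta> by (auto simp: \<phi>_def)
  then have \<psi>: "\<psi> \<in> {\<omega><..<pi/2}" "\<psi> < \<phi>" using \<theta> by (auto simp: \<psi>_def)
  obtain C where "resolvent (right_unit i) K \<psi> C" using resolvent_locale[OF \<psi>(1)] by blast
  then interpret r: resolvent "right_unit i" K \<psi> C .
  \<comment> \<open>\<open>k0\<close> and \<open>k1\<close> are formed like the real and imaginary
    part of a complex product, so each component of the product is that of \<open>f\<close> times
    the single one of \<open>g\<close>.\<close>
  have coeff: "slice_coeff k0 k1 A = (\<lambda>z. slice_coeff g0 g1 {} z * slice_coeff f0 f1 A z)" for A
    by (simp add: fun_eq_iff slice_coeff_def k0_def k1_def complex_eq_iff)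
  have "bisector_integral (right_unit i) K (slice_coeff g0 g1 {}) \<phi> o\<^sub>L bisector_integral (right_unit i) K (slice_coeff f0 f1 A) \<phi>
      = bisector_integral (right_unit i) K (slice_coeff k0 k1 A) \<phi>" for A
    unfolding coeff
    by (rule r.bisector_integral_product[OF slice_coeff_ray_decay[OF \<theta>' g dg] slice_coeff_ray_decay[OF \<theta>' f df]])
       (use \<phi> \<psi> \<theta> in auto)
  \<comment> \<open>\<open>g(T)\<close> meets each \<open>h_A(T)\<close> directly, because the basis
    element stands on the right of the latter; the scalar product rule applies summand by
    summand.\<close>
  then have "omega_calculus \<omega> \<theta> T (\<lambda>s. g s \<odot> f s) = omega_calculus \<omega> \<theta> T g o\<^sub>L omega_calculus \<omega> \<theta> T f"
    unfolding omega_calculus_intrinsic[OF \<theta> g dg real \<phi>] omega_calculus_eq[OF \<theta> f df \<phi>] omega_calculus_eq[OF \<theta> k dk \<phi>]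
    by (simp add: compose_sum compose_assoc[symmetric])
  ultimately show ?thesis by blast
qed

end
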